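(* Let $M$ be a smooth finite-dimensional manifold, $V$ a Banach space, $\mathbf y=(y,y^\dagger)\in CRP_{\mathbf X}(M)$ and $\alpha\in\Omega^1(M,V)$ a smooth $V$-valued one-form on $M$. For a gauge $\mathcal G=(\psi,U)$ on $M$ let $$\boldsymbol\alpha_s^{(y,U)}:=\left(\alpha|_{T_{y_s}M},\;\nabla^U_{y_s^\dagger(\cdot)}\alpha\right)\in CRP_y^U(M,V).$$ Then the integral $\int\langle\boldsymbol\alpha^{(y,U)},d\mathbf y^{\mathcal G}\rangle\in CRP_{\mathbf X}(V)$ is independent of the choice of gauge $\mathcal G=(\psi,U)$ on $M$.
   Context: Rough paths. $W=\mathbb R^k$, $T>0$, $1\le p<3$, $\Delta_{[0,T]}=\{(s,t):0\le s\le t\le T\}$. A control is a continuous $\omega:\Delta_{[0,T]}\to[0,\infty)$ with $\omega(s,s)=0$ and $\omega(s,t)+\omega(t,u)\le\omega(s,u)$ for $s\le t\le u$. $\mathbf X=(x,\mathbb X)$ is a fixed weak-geometric $p$-rough path with control $\omega$: $x:[0,T]\to W$ and $\mathbb X:\Delta_{[0,T]}\to W\otimes W$ are continuous and, with $x_{s,t}:=x_t-x_s$, one has $\mathbb X_{s,u}=\mathbb X_{s,t}+\mathbb X_{t,u}+x_{s,t}\otimes x_{t,u}$ for $s\le t\le u$, $|x_{s,t}|\le\omega(s,t)^{1/p}$, $|\mathbb X_{s,t}|\le\omega(s,t)^{2/p}$, and the symmetric part of $\mathbb X_{s,t}$ equals $\frac12x_{s,t}\otimes x_{s,t}$. $F_{s,t}\approx_iG_{s,t}$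 means: there are $C<\infty$, $\delta>0$ (with $\delta$ small enough that all expressions are defined) such that $|F_{s,t}-G_{s,t}|\le C\omega(s,t)^{i/p}$ for all $0\le s\le t\le T$ with $t-s\le\delta$; for values in spaces built from $T_{y_s}M$ the norm is the (operator) norm from any fixed Riemannian metric on $M$. $CRP_{\mathbf X}(V)$: continuous pairs $(z,z^\dagger)$, $z:[0,T]\to V$, $z^\dagger:[0,T]\to L(W,V)$, for which there is $C$ with $|z_t-z_s-z_s^\dagger x_{s,t}|\le C\omega(s,t)^{2/p}$ and $|z_t^\dagger-z_s^\dagger|\le C\omega(s,t)^{1/p}$ for all $0\le s\le t\le T$. Gauges. A diagonal domain is an open $\mathcal D\subseteq M\times M$ containing the diagonal. A logarithm is a smooth $\psi:\mathcal D\to TM$ with $\psi(m,n)\in T_mM$, $\psi(m,m)=0_m$, and differential of $\psi(m,\cdot)$ at $m$ equal to the identity of $T_mM$. A parallelism is a smooth map $(n,m)\in\mathcal D\mapsto U(n,m)\in L(T_mM,T_nM)$ with $U(m,m)=I$. A gauge is a pair $(\psi,U)$ of these with common domain $\mathcal D$. $CRP_{\mathbf X}(M)$: continuous pairs $(y,y^\dagger)$, $y:[0,T]\to M$, $y_s^\dagger\in L(W,T_{y_s}M)$, with $\psi(y_s,y_t)\approx_2y_s^\dagger x_{s,t}$ and $U(y_s,y_t)y_t^\dagger\approx_1y_s^\dagger$ (this does not depend on the gauge chosen). $CRP_y^U(M,V)$: pairs $(\alpha,\alpha^\dagger)$ with $\alpha_s\in L(T_{y_s}M,V)$, $\alpha_s^\dagger\in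 L(W\otimes T_{y_s}M,V)$, $\alpha_t\circ U(y_t,y_s)-\alpha_s-\alpha_s^\dagger(x_{s,t}\otimes(\cdot))\approx_20$ and $\alpha_t^\dagger\circ(I\otimes U(y_t,y_s))-\alpha_s^\dagger\approx_10$. Covariant derivative $\nabla^U$: for a vector field $Y$ and $v\in T_mM$, $\nabla^U_vY:=\frac{d}{dt}\big|_0U(m,\sigma_t)Y(\sigma_t)$ with $\dot\sigma_0=v$; on one-forms, $v[\alpha(Y)]=(\nabla^U_v\alpha)(Y(m))+\alpha_m(\nabla^U_vY)$. The second component of $\boldsymbol\alpha^{(y,U)}_s$ is $w\otimes v\mapsto(\nabla^U_{y_s^\dagger w}\alpha)(v)$. Compatibility tensor. For parallelisms $\tilde U,U$: $S_m^{\tilde U,U}[v\otimes w]:=v\left[n\mapsto U(n,m)^{-1}\tilde U(n,m)w\right]$ (derivative at $m$ in direction $v$ of a $T_mM$-valued function), $v,w\in T_mM$. For a gauge $\mathcal G=(\psi,U)$: $S^{\mathcal G}:=S^{U^\psi,U}$ where $U^\psi(m,n):=$ differential of $\psi(m,\cdot)$ at $n$, viewed as a map $T_nM\to T_mM$. Integral. For $\boldsymbol\alpha\in CRP_y^U(M,V)$, $\int\langle\boldsymbol\alpha,d\mathbf y^{\mathcal G}\rangle$ is the unique $(z,z^\dagger)\in CRP_{\mathbf X}(V)$ with $z_0=0$, $z_s^\dagger=\alpha_s\circ y_s^\dagger$ and $z_t-z_s\approx_3\alpha_s\left(\psi(y_s,y_t)+S^{\mathcal G}_{y_s}((y_s^\dagger\otimes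 y_s^\dagger)\mathbb X_{s,t})\right)+\alpha_s^\dagger(I\otimes y_s^\dagger)\mathbb X_{s,t}$. *)

theory Defs
  imports "HOL-Analysis.Analysis" "HOL-Library.Function_Algebras"
begin

text \<open>On an open subset of a finite-dimensional space a map is of class \<open>C\<^sup>k\<^sup>+\<^sup>1\<close> iff it is
  differentiable and all its directional derivatives are of class \<open>C\<^sup>k\<close>.\<close>

primrec Ck :: "nat \<Rightarrow> 'a::euclidean_space set \<Rightarrow> ('a \<Rightarrow> 'b::real_normed_vector) \<Rightarrow> bool" where
  "Ck 0 S f \<longleftrightarrow> continuous_on S f"
| "Ck (Suc k) S f \<longleftrightarrow> (\<forall>x\<in>S. f differentiable (at x)) \<and>
     (\<forall>v. Ck k S (\<lambda>x. frechet_derivative f (at x) v))"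

definition smooth_on :: "'a::euclidean_space set \<Rightarrow> ('a \<Rightarrow> 'b::real_normed_vector) \<Rightarrow> bool" where
  "smooth_on S f \<longleftrightarrow> (\<forall>k. Ck k S f)"

text \<open>A chart is a domain together with a coordinate map; the values of the coordinate map off
  the domain are irrelevant. The manifold is the whole type \<open>'m\<close>, its smooth structure
  is given by an atlas (not necessarily maximal).\<close>

type_synonym ('m, 'e) chart = "'m set \<times> ('m \<Rightarrow> 'e)"

definition chart_inv :: "('m, 'e) chart \<Rightarrow> 'e \<Rightarrow> 'm" where
  "chart_inv c = inv_into (fst c) (snd c)"

definition smooth_atlas ::
  "('m::{t2_space,second_countable_topology}, 'e::euclidean_space) chart set \<Rightarrow> bool" where
  "smooth_atlas A \<longleftrightarrow>
     (\<Union>c\<in>A. fst c) = UNIV \<and>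
     (\<forall>c\<in>A. open (fst c) \<and> open (snd c ` fst c) \<and>
        homeomorphism (fst c) (snd c ` fst c) (snd c) (chart_inv c)) \<and>
     (\<forall>c\<in>A. \<forall>c'\<in>A. smooth_on (snd c ` (fst c \<inter> fst c')) (snd c' \<circ> chart_inv c))"

text \<open>A tangent vector at \<open>m\<close> is the family of its coordinate vectors in all charts of the
  atlas around \<open>m\<close>, related by the differentials of the transition maps (and \<open>0\<close> at all other
  indices). Vector operations are pointwise, so the tangent space at \<open>m\<close> is a
  subspace of the function space \<open>('m, 'e) chart \<Rightarrow> 'e\<close>.\<close>

type_synonym ('m, 'e) tvec = "('m, 'e) chart \<Rightarrow> 'e"

instantiation "fun" :: (type, real_vector) real_vector
begin

definition scaleR_fun :: "real \<Rightarrow> ('a \<Rightarrow> 'b) \<Rightarrow> 'a \<Rightarrow> 'b" where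
  "scaleR_fun r f = (\<lambda>x. r *\<^sub>R f x)"

instance
  by standard (simp_all add: scaleR_fun_def fun_eq_iff scaleR_add_right scaleR_add_left)

end

definition tspace :: "('m, 'e::euclidean_space) chart set \<Rightarrow> 'm \<Rightarrow> ('m, 'e) tvec set" where
  "tspace A m = {v.
     (\<forall>c\<in>A. \<forall>c'\<in>A. m \<in> fst c \<and> m \<in> fst c' \<longrightarrow>
        v c' = frechet_derivative (snd c' \<circ> chart_inv c) (at (snd c m)) (v c)) \<and>
     (\<forall>c. c \<notin> A \<or> m \<notin> fst c \<longrightarrow> v c = 0)}"

text \<open>For \<open>m\<close> in the domain of \<open>c\<close>, the tangent vector at \<open>m\<close> whose coordinate vector in the chart \<open>c\<close> is \<open>e\<close>.\<close>

definition coord_vec ::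
  "('m, 'e::euclidean_space) chart set \<Rightarrow> ('m, 'e) chart \<Rightarrow> 'm \<Rightarrow> 'e \<Rightarrow> ('m, 'e) tvec" where
  "coord_vec A c m e = (\<lambda>c'. if c' \<in> A \<and> m \<in> fst c'
     then frechet_derivative (snd c' \<circ> chart_inv c) (at (snd c m)) e else 0)"

definition linear_between ::
  "'a::real_vector set \<Rightarrow> 'b::real_vector set \<Rightarrow> ('a \<Rightarrow> 'b) \<Rightarrow> bool" where
  "linear_between S R L \<longleftrightarrow> (\<forall>v\<in>S. L v \<in> R) \<and>
     (\<forall>v\<in>S. \<forall>w\<in>S. L (v + w) = L v + L w) \<and> (\<forall>r. \<forall>v\<in>S. L (r *\<^sub>R v) = r *\<^sub>R L v)"

text \<open>\<open>vderiv A m v f\<close> is the derivative \<open>v[f]\<close> of a vector-valued function at \<open>m\<close> in the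
  direction \<open>v\<close>, equivalently the derivative at \<open>0\<close> of \<open>f\<close> along any curve with velocity \<open>v\<close>
  at \<open>m\<close>; by the chain rule it does not depend on the chart in which it is computed.
  For a function with values in the fixed tangent space at some point it is taken
  componentwise.\<close>

definition vderiv :: "('m, 'e::euclidean_space) chart set \<Rightarrow> 'm \<Rightarrow> ('m, 'e) tvec \<Rightarrow>
    ('m \<Rightarrow> 'v::real_normed_vector) \<Rightarrow> 'v" where
  "vderiv A m v f = (let c = (SOME c. c \<in> A \<and> m \<in> fst c)
     in frechet_derivative (f \<circ> chart_inv c) (at (snd c m)) (v c))"

definition tderiv :: "('m, 'e::euclidean_space) chart set \<Rightarrow> 'm \<Rightarrow> ('m, 'e) tvec \<Rightarrow>
    ('m \<Rightarrow> ('m, 'e) tvec) \<Rightarrow> ('m, 'e) tvec" where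
  "tderiv A m v F = (\<lambda>c. vderiv A m v (\<lambda>n. F n c))"

definition smooth_vector_field_on ::
  "('m, 'e::euclidean_space) chart set \<Rightarrow> 'm set \<Rightarrow> ('m \<Rightarrow> ('m, 'e) tvec) \<Rightarrow> bool" where
  "smooth_vector_field_on A N Y \<longleftrightarrow> (\<forall>n\<in>N. Y n \<in> tspace A n) \<and>
     (\<forall>c\<in>A. smooth_on (snd c ` (fst c \<inter> N)) (\<lambda>u. Y (chart_inv c u) c))"

text \<open>Smoothness of forms, metrics and parallelisms is smoothness of the components with respect
  to constant coordinate vectors.\<close>

definition smooth_one_form :: "('m, 'e::euclidean_space) chart set \<Rightarrow>
    ('m \<Rightarrow> ('m, 'e) tvec \<Rightarrow> 'v::real_normed_vector) \<Rightarrow> bool" where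
  "smooth_one_form A \<alpha> \<longleftrightarrow> (\<forall>m. linear_between (tspace A m) UNIV (\<alpha> m)) \<and>
     (\<forall>c\<in>A. \<forall>e. smooth_on (snd c ` fst c)
        (\<lambda>u. \<alpha> (chart_inv c u) (coord_vec A c (chart_inv c u) e)))"

definition riemannian_metric :: "('m, 'e::euclidean_space) chart set \<Rightarrow>
    ('m \<Rightarrow> ('m, 'e) tvec \<Rightarrow> ('m, 'e) tvec \<Rightarrow> real) \<Rightarrow> bool" where
  "riemannian_metric A g \<longleftrightarrow>
     (\<forall>m. \<forall>v\<in>tspace A m. linear_between (tspace A m) UNIV (g m v) \<and>
        (\<forall>w\<in>tspace A m. g m v w = g m w v) \<and> (v \<noteq> 0 \<longrightarrow> g m v v > 0)) \<and>
     (\<forall>c\<in>A. \<forall>e e'. smooth_on (snd c ` fst c)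
        (\<lambda>u. g (chart_inv c u) (coord_vec A c (chart_inv c u) e) (coord_vec A c (chart_inv c u) e')))"

definition gnorm ::
  "('m \<Rightarrow> ('m, 'e) tvec \<Rightarrow> ('m, 'e) tvec \<Rightarrow> real) \<Rightarrow> 'm \<Rightarrow> ('m, 'e) tvec \<Rightarrow> real" where
  "gnorm g m v = sqrt (g m v v)"

definition diagonal_domain :: "('m::topological_space \<times> 'm) set \<Rightarrow> bool" where
  "diagonal_domain D \<longleftrightarrow> open D \<and> (\<forall>m. (m, m) \<in> D)"

text \<open>Smoothness on \<open>D\<close>, in the charts \<open>c\<close> (first variable) and \<open>c'\<close> (second variable).\<close>

definition smooth_in_charts :: "('m \<times> 'm) set \<Rightarrow> ('m, 'e::euclidean_space) chart \<Rightarrow>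
    ('m, 'e) chart \<Rightarrow> ('m \<Rightarrow> 'm \<Rightarrow> 'v::real_normed_vector) \<Rightarrow> bool" where
  "smooth_in_charts D c c' f \<longleftrightarrow>
     smooth_on {(snd c m, snd c' n) |m n. m \<in> fst c \<and> n \<in> fst c' \<and> (m, n) \<in> D}
       (\<lambda>(u, u'). f (chart_inv c u) (chart_inv c' u'))"

definition logarithm :: "('m::topological_space, 'e::euclidean_space) chart set \<Rightarrow> ('m \<times> 'm) set \<Rightarrow>
    ('m \<Rightarrow> 'm \<Rightarrow> ('m, 'e) tvec) \<Rightarrow> bool" where
  "logarithm A D \<psi> \<longleftrightarrow>
     (\<forall>(m, n)\<in>D. \<psi> m n \<in> tspace A m) \<and>
     (\<forall>c\<in>A. \<forall>c'\<in>A. smooth_in_charts D c c' (\<lambda>m n. \<psi> m n c)) \<and>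
     (\<forall>m. \<psi> m m = 0) \<and>
     (\<forall>m. \<forall>v\<in>tspace A m. tderiv A m v (\<psi> m) = v)"

text \<open>\<open>U n m\<close> is a map from the tangent space at \<open>m\<close> to the tangent space at \<open>n\<close>.\<close>

definition parallelism :: "('m::topological_space, 'e::euclidean_space) chart set \<Rightarrow> ('m \<times> 'm) set \<Rightarrow>
    ('m \<Rightarrow> 'm \<Rightarrow> ('m, 'e) tvec \<Rightarrow> ('m, 'e) tvec) \<Rightarrow> bool" where
  "parallelism A D U \<longleftrightarrow>
     (\<forall>(n, m)\<in>D. linear_between (tspace A m) (tspace A n) (U n m)) \<and>
     (\<forall>c\<in>A. \<forall>c'\<in>A. \<forall>e. smooth_in_charts D c c' (\<lambda>n m. U n m (coord_vec A c' m e) c)) \<and>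
     (\<forall>m. \<forall>v\<in>tspace A m. U m m v = v)"

text \<open>Not to be confused with the gauges of Henstock-Kurzweil integration.\<close>

definition geometric_gauge :: "('m::topological_space, 'e::euclidean_space) chart set \<Rightarrow> ('m \<times> 'm) set \<Rightarrow>
    ('m \<Rightarrow> 'm \<Rightarrow> ('m, 'e) tvec) \<Rightarrow> ('m \<Rightarrow> 'm \<Rightarrow> ('m, 'e) tvec \<Rightarrow> ('m, 'e) tvec) \<Rightarrow> bool" where
  "geometric_gauge A D \<psi> U \<longleftrightarrow> diagonal_domain D \<and> logarithm A D \<psi> \<and> parallelism A D U"

text \<open>The parallelism \<open>U\<^sup>\<psi>\<close>: \<open>log_parallelism A \<psi> m n\<close> is the differential of \<open>\<psi>(m, \<cdot>)\<close> at \<open>n\<close>.\<close>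

definition log_parallelism :: "('m, 'e::euclidean_space) chart set \<Rightarrow>
    ('m \<Rightarrow> 'm \<Rightarrow> ('m, 'e) tvec) \<Rightarrow> 'm \<Rightarrow> 'm \<Rightarrow> ('m, 'e) tvec \<Rightarrow> ('m, 'e) tvec" where
  "log_parallelism A \<psi> m n v = tderiv A n v (\<psi> m)"

text \<open>The inverse of \<open>U n m\<close> only matters for \<open>n\<close> near \<open>m\<close>, where \<open>U n m\<close> is invertible.\<close>

definition compat_tensor :: "('m, 'e::euclidean_space) chart set \<Rightarrow>
    ('m \<Rightarrow> 'm \<Rightarrow> ('m, 'e) tvec \<Rightarrow> ('m, 'e) tvec) \<Rightarrow>
    ('m \<Rightarrow> 'm \<Rightarrow> ('m, 'e) tvec \<Rightarrow> ('m, 'e) tvec) \<Rightarrow>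
    'm \<Rightarrow> ('m, 'e) tvec \<Rightarrow> ('m, 'e) tvec \<Rightarrow> ('m, 'e) tvec" where
  "compat_tensor A U' U m v w =
     tderiv A m v (\<lambda>n. inv_into (tspace A m) (U n m) (U' n m w))"

definition gauge_tensor :: "('m, 'e::euclidean_space) chart set \<Rightarrow>
    ('m \<Rightarrow> 'm \<Rightarrow> ('m, 'e) tvec) \<Rightarrow> ('m \<Rightarrow> 'm \<Rightarrow> ('m, 'e) tvec \<Rightarrow> ('m, 'e) tvec) \<Rightarrow>
    'm \<Rightarrow> ('m, 'e) tvec \<Rightarrow> ('m, 'e) tvec \<Rightarrow> ('m, 'e) tvec" where
  "gauge_tensor A \<psi> U = compat_tensor A (log_parallelism A \<psi>) U"

definition cov_deriv :: "('m, 'e::euclidean_space) chart set \<Rightarrow>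
    ('m \<Rightarrow> 'm \<Rightarrow> ('m, 'e) tvec \<Rightarrow> ('m, 'e) tvec) \<Rightarrow>
    'm \<Rightarrow> ('m, 'e) tvec \<Rightarrow> ('m \<Rightarrow> ('m, 'e) tvec) \<Rightarrow> ('m, 'e) tvec" where
  "cov_deriv A U m v Y = tderiv A m v (\<lambda>n. U m n (Y n))"

text \<open>The value on \<open>w\<close> of the covariant derivative of the one-form \<open>\<alpha>\<close> in the direction \<open>v\<close>,
  determined by the product rule for all vector fields \<open>Y\<close> with \<open>Y m = w\<close>. The fields are only
  required to be defined and smooth near \<open>m\<close>, which is all the product rule at \<open>m\<close> sees.\<close>

definition cov_deriv_form :: "('m::topological_space, 'e::euclidean_space) chart set \<Rightarrow>
    ('m \<Rightarrow> 'm \<Rightarrow> ('m, 'e) tvec \<Rightarrow> ('m, 'e) tvec) \<Rightarrow>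
    ('m \<Rightarrow> ('m, 'e) tvec \<Rightarrow> 'v::real_normed_vector) \<Rightarrow>
    'm \<Rightarrow> ('m, 'e) tvec \<Rightarrow> ('m, 'e) tvec \<Rightarrow> 'v" where
  "cov_deriv_form A U \<alpha> m v w = (THE a. \<forall>N Y. open N \<and> m \<in> N \<and> smooth_vector_field_on A N Y \<and> Y m = w \<longrightarrow>
     vderiv A m v (\<lambda>n. \<alpha> n (Y n)) = a + \<alpha> m (cov_deriv A U m v Y))"

text \<open>\<open>W \<otimes> W\<close> is the space of matrices, with the Hilbert-Schmidt norm; a bilinear map \<open>B\<close> on
  \<open>W \<times> W\<close> induces the linear map \<open>tensor_lift B\<close> on \<open>W \<otimes> W\<close>.\<close>

definition tensor :: "real^'k \<Rightarrow> real^'k \<Rightarrow> real^'k^'k" where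
  "tensor v w = (\<chi> i j. v $ i * w $ j)"

definition tensor_lift ::
  "(real^'k \<Rightarrow> real^'k \<Rightarrow> 'b::real_vector) \<Rightarrow> real^'k^'k \<Rightarrow> 'b" where
  "tensor_lift B X = (\<Sum>i\<in>UNIV. \<Sum>j\<in>UNIV. (X $ i $ j) *\<^sub>R B (axis i 1) (axis j 1))"

definition control :: "real \<Rightarrow> (real \<Rightarrow> real \<Rightarrow> real) \<Rightarrow> bool" where
  "control T \<omega> \<longleftrightarrow>
     continuous_on {(s, t). 0 \<le> s \<and> s \<le> t \<and> t \<le> T} (\<lambda>(s, t). \<omega> s t) \<and>
     (\<forall>s t. 0 \<le> s \<and> s \<le> t \<and> t \<le> T \<longrightarrow> 0 \<le> \<omega> s t) \<and>
     (\<forall>s. 0 \<le> s \<and> s \<le> T \<longrightarrow> \<omega> s s = 0) \<and>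
     (\<forall>s t u. 0 \<le> s \<and> s \<le> t \<and> t \<le> u \<and> u \<le> T \<longrightarrow> \<omega> s t + \<omega> t u \<le> \<omega> s u)"

definition weak_geometric_rough_path :: "real \<Rightarrow> real \<Rightarrow> (real \<Rightarrow> real \<Rightarrow> real) \<Rightarrow>
    (real \<Rightarrow> real^'k) \<Rightarrow> (real \<Rightarrow> real \<Rightarrow> real^'k^'k) \<Rightarrow> bool" where
  "weak_geometric_rough_path p T \<omega> x X \<longleftrightarrow> control T \<omega> \<and>
     continuous_on {0..T} x \<and>
     continuous_on {(s, t). 0 \<le> s \<and> s \<le> t \<and> t \<le> T} (\<lambda>(s, t). X s t) \<and>
     (\<forall>s t u. 0 \<le> s \<and> s \<le> t \<and> t \<le> u \<and> u \<le> T \<longrightarrow>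
        X s u = X s t + X t u + tensor (x t - x s) (x u - x t)) \<and>
     (\<forall>s t. 0 \<le> s \<and> s \<le> t \<and> t \<le> T \<longrightarrow>
        norm (x t - x s) \<le> \<omega> s t powr (1 / p) \<and>
        norm (X s t) \<le> \<omega> s t powr (2 / p) \<and>
        (1 / 2) *\<^sub>R (X s t + transpose (X s t)) = (1 / 2) *\<^sub>R tensor (x t - x s) (x t - x s))"

text \<open>\<open>approx p T \<omega> i P B F G\<close> is the relation \<open>F \<approx>\<^sub>i G\<close>: \<open>P s t\<close> says that the expressions are
  defined at \<open>(s, t)\<close>, and \<open>B s r\<close> is the closed ball of radius \<open>r\<close> around \<open>0\<close> in the
  space in which the values at \<open>(s, t)\<close> lie.\<close>

definition approx :: "real \<Rightarrow> real \<Rightarrow> (real \<Rightarrow> real \<Rightarrow> real) \<Rightarrow> nat \<Rightarrow> (real \<Rightarrow> real \<Rightarrow> bool) \<Rightarrow>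
    (real \<Rightarrow> real \<Rightarrow> 'b::minus set) \<Rightarrow> (real \<Rightarrow> real \<Rightarrow> 'b) \<Rightarrow> (real \<Rightarrow> real \<Rightarrow> 'b) \<Rightarrow> bool" where
  "approx p T \<omega> i P B F G \<longleftrightarrow> (\<exists>C \<delta>. \<delta> > 0 \<and>
     (\<forall>s t. 0 \<le> s \<and> s \<le> t \<and> t \<le> T \<and> t - s \<le> \<delta> \<longrightarrow>
        P s t \<and> F s t - G s t \<in> B s (C * \<omega> s t powr (real i / p))))"

text \<open>Closed balls for the norm given by the metric on the tangent space and for the operator norms
  on \<open>L(W, T\<^sub>mM)\<close>, \<open>L(T\<^sub>mM, V)\<close> and \<open>L(W \<otimes> T\<^sub>mM, V)\<close>; elements of the
  last space are regarded as bilinear maps.\<close>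

definition tball where
  "tball A g m r = {v \<in> tspace A m. gnorm g m v \<le> r}"

definition Wtball :: "('m, 'e::euclidean_space) chart set \<Rightarrow>
    ('m \<Rightarrow> ('m, 'e) tvec \<Rightarrow> ('m, 'e) tvec \<Rightarrow> real) \<Rightarrow> 'm \<Rightarrow> real \<Rightarrow> (real^'k \<Rightarrow> ('m, 'e) tvec) set" where
  "Wtball A g m r = {L. \<forall>w. L w \<in> tball A g m (r * norm w)}"

definition tVball :: "('m, 'e::euclidean_space) chart set \<Rightarrow>
    ('m \<Rightarrow> ('m, 'e) tvec \<Rightarrow> ('m, 'e) tvec \<Rightarrow> real) \<Rightarrow> 'm \<Rightarrow> real \<Rightarrow>
    (('m, 'e) tvec \<Rightarrow> 'v::real_normed_vector) set" where
  "tVball A g m r = {L. \<forall>v\<in>tspace A m. norm (L v) \<le> r * gnorm g m v}"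

definition WtVball :: "('m, 'e::euclidean_space) chart set \<Rightarrow>
    ('m \<Rightarrow> ('m, 'e) tvec \<Rightarrow> ('m, 'e) tvec \<Rightarrow> real) \<Rightarrow> 'm \<Rightarrow> real \<Rightarrow>
    (real^'k \<Rightarrow> ('m, 'e) tvec \<Rightarrow> 'v::real_normed_vector) set" where
  "WtVball A g m r = {L. \<forall>w. \<forall>v\<in>tspace A m. norm (L w v) \<le> r * norm w * gnorm g m v}"

text \<open>Functions on \<open>[0, T]\<close> are made total by the conventional value \<open>undefined\<close> off \<open>[0, T]\<close>, so that
  equality of controlled paths is equality on \<open>[0, T]\<close>.\<close>

definition CRP :: "real \<Rightarrow> real \<Rightarrow> (real \<Rightarrow> real \<Rightarrow> real) \<Rightarrow> (real \<Rightarrow> real^'k) \<Rightarrow>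
    ((real \<Rightarrow> 'v::real_normed_vector) \<times> (real \<Rightarrow> (real^'k) \<Rightarrow>\<^sub>L 'v)) set" where
  "CRP p T \<omega> x = {(z, z'). z \<in> extensional {0..T} \<and> z' \<in> extensional {0..T} \<and>
     continuous_on {0..T} z \<and> continuous_on {0..T} z' \<and>
     (\<exists>C. \<forall>s t. 0 \<le> s \<and> s \<le> t \<and> t \<le> T \<longrightarrow>
        norm (z t - z s - blinfun_apply (z' s) (x t - x s)) \<le> C * \<omega> s t powr (2 / p) \<and>
        norm (z' t - z' s) \<le> C * \<omega> s t powr (1 / p))}"

definition manifold_CRP_gauge :: "('m::topological_space, 'e::euclidean_space) chart set \<Rightarrow>
    ('m \<Rightarrow> ('m, 'e) tvec \<Rightarrow> ('m, 'e) tvec \<Rightarrow> real) \<Rightarrow>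
    real \<Rightarrow> real \<Rightarrow> (real \<Rightarrow> real \<Rightarrow> real) \<Rightarrow> (real \<Rightarrow> real^'k) \<Rightarrow> ('m \<times> 'm) set \<Rightarrow>
    ('m \<Rightarrow> 'm \<Rightarrow> ('m, 'e) tvec) \<Rightarrow> ('m \<Rightarrow> 'm \<Rightarrow> ('m, 'e) tvec \<Rightarrow> ('m, 'e) tvec) \<Rightarrow>
    (real \<Rightarrow> 'm) \<Rightarrow> (real \<Rightarrow> real^'k \<Rightarrow> ('m, 'e) tvec) \<Rightarrow> bool" where
  "manifold_CRP_gauge A g p T \<omega> x D \<psi> U y y' \<longleftrightarrow>
     continuous_on {0..T} y \<and>
     (\<forall>s\<in>{0..T}. linear_between UNIV (tspace A (y s)) (y' s)) \<and>
     (\<forall>c\<in>A. \<forall>w. continuous_on {s\<in>{0..T}. y s \<in> fst c} (\<lambda>s. y' s w c)) \<and>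
     approx p T \<omega> 2 (\<lambda>s t. (y s, y t) \<in> D) (\<lambda>s. tball A g (y s))
       (\<lambda>s t. \<psi> (y s) (y t)) (\<lambda>s t. y' s (x t - x s)) \<and>
     approx p T \<omega> 1 (\<lambda>s t. (y s, y t) \<in> D) (\<lambda>s. Wtball A g (y s))
       (\<lambda>s t w. U (y s) (y t) (y' t w)) (\<lambda>s t. y' s)"

text \<open>The defining estimates hold for one gauge iff they hold for every gauge.\<close>

definition manifold_CRP :: "('m::topological_space, 'e::euclidean_space) chart set \<Rightarrow>
    ('m \<Rightarrow> ('m, 'e) tvec \<Rightarrow> ('m, 'e) tvec \<Rightarrow> real) \<Rightarrow>
    real \<Rightarrow> real \<Rightarrow> (real \<Rightarrow> real \<Rightarrow> real) \<Rightarrow> (real \<Rightarrow> real^'k) \<Rightarrow>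
    ((real \<Rightarrow> 'm) \<times> (real \<Rightarrow> real^'k \<Rightarrow> ('m, 'e) tvec)) set" where
  "manifold_CRP A g p T \<omega> x =
     {(y, y'). \<exists>D \<psi> U. geometric_gauge A D \<psi> U \<and> manifold_CRP_gauge A g p T \<omega> x D \<psi> U y y'}"

definition form_CRP :: "('m::topological_space, 'e::euclidean_space) chart set \<Rightarrow>
    ('m \<Rightarrow> ('m, 'e) tvec \<Rightarrow> ('m, 'e) tvec \<Rightarrow> real) \<Rightarrow>
    real \<Rightarrow> real \<Rightarrow> (real \<Rightarrow> real \<Rightarrow> real) \<Rightarrow> (real \<Rightarrow> real^'k) \<Rightarrow> (real \<Rightarrow> 'm) \<Rightarrow> ('m \<times> 'm) set \<Rightarrow>
    ('m \<Rightarrow> 'm \<Rightarrow> ('m, 'e) tvec \<Rightarrow> ('m, 'e) tvec) \<Rightarrow>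
    ((real \<Rightarrow> ('m, 'e) tvec \<Rightarrow> 'v::real_normed_vector) \<times>
     (real \<Rightarrow> real^'k \<Rightarrow> ('m, 'e) tvec \<Rightarrow> 'v)) set" where
  "form_CRP A g p T \<omega> x y D U = {(a, a').
     (\<forall>s\<in>{0..T}. linear_between (tspace A (y s)) UNIV (a s)) \<and>
     (\<forall>s\<in>{0..T}. (\<forall>w. linear_between (tspace A (y s)) UNIV (a' s w)) \<and>
        (\<forall>v\<in>tspace A (y s). linear (\<lambda>w. a' s w v))) \<and>
     approx p T \<omega> 2 (\<lambda>s t. (y t, y s) \<in> D) (\<lambda>s. tVball A g (y s))
       (\<lambda>s t v. a t (U (y t) (y s) v) - a s v - a' s (x t - x s) v) (\<lambda>s t. 0) \<and>
     approx p T \<omega> 1 (\<lambda>s t. (y t, y s) \<in> D) (\<lambda>s. WtVball A g (y s))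
       (\<lambda>s t w v. a' t w (U (y t) (y s) v) - a' s w v) (\<lambda>s t. 0)}"

definition form_along :: "('m::topological_space, 'e::euclidean_space) chart set \<Rightarrow>
    ('m \<Rightarrow> 'm \<Rightarrow> ('m, 'e) tvec \<Rightarrow> ('m, 'e) tvec) \<Rightarrow>
    (real \<Rightarrow> 'm) \<times> (real \<Rightarrow> real^'k \<Rightarrow> ('m, 'e) tvec) \<Rightarrow>
    ('m \<Rightarrow> ('m, 'e) tvec \<Rightarrow> 'v::real_normed_vector) \<Rightarrow>
    (real \<Rightarrow> ('m, 'e) tvec \<Rightarrow> 'v) \<times> (real \<Rightarrow> real^'k \<Rightarrow> ('m, 'e) tvec \<Rightarrow> 'v)" where
  "form_along A U = (\<lambda>(y, y') \<alpha>.
     (\<lambda>s. \<alpha> (y s), \<lambda>s w v. cov_deriv_form A U \<alpha> (y s) (y' s w) v))"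

definition is_rough_integral :: "('m::topological_space, 'e::euclidean_space) chart set \<Rightarrow>
    real \<Rightarrow> real \<Rightarrow> (real \<Rightarrow> real \<Rightarrow> real) \<Rightarrow> (real \<Rightarrow> real^'k) \<Rightarrow> (real \<Rightarrow> real \<Rightarrow> real^'k^'k) \<Rightarrow>
    ('m \<times> 'm) set \<Rightarrow> ('m \<Rightarrow> 'm \<Rightarrow> ('m, 'e) tvec) \<Rightarrow>
    ('m \<Rightarrow> 'm \<Rightarrow> ('m, 'e) tvec \<Rightarrow> ('m, 'e) tvec) \<Rightarrow>
    (real \<Rightarrow> ('m, 'e) tvec \<Rightarrow> 'v::real_normed_vector) \<times> (real \<Rightarrow> real^'k \<Rightarrow> ('m, 'e) tvec \<Rightarrow> 'v) \<Rightarrow>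
    (real \<Rightarrow> 'm) \<times> (real \<Rightarrow> real^'k \<Rightarrow> ('m, 'e) tvec) \<Rightarrow>
    (real \<Rightarrow> 'v) \<times> (real \<Rightarrow> (real^'k) \<Rightarrow>\<^sub>L 'v) \<Rightarrow> bool" where
  "is_rough_integral A p T \<omega> x X D \<psi> U = (\<lambda>(a, a') (y, y') (z, z').
     (z, z') \<in> CRP p T \<omega> x \<and> z 0 = 0 \<and>
     (\<forall>s\<in>{0..T}. \<forall>w. blinfun_apply (z' s) w = a s (y' s w)) \<and>
     approx p T \<omega> 3 (\<lambda>s t. (y s, y t) \<in> D) (\<lambda>s. cball 0)
       (\<lambda>s t. z t - z s)
       (\<lambda>s t. a s (\<psi> (y s) (y t)
                  + tensor_lift (\<lambda>w w'. gauge_tensor A \<psi> U (y s) (y' s w) (y' s w')) (X s t))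
              + tensor_lift (\<lambda>w w'. a' s w (y' s w')) (X s t)))"

definition rough_integral :: "('m::topological_space, 'e::euclidean_space) chart set \<Rightarrow>
    real \<Rightarrow> real \<Rightarrow> (real \<Rightarrow> real \<Rightarrow> real) \<Rightarrow> (real \<Rightarrow> real^'k) \<Rightarrow> (real \<Rightarrow> real \<Rightarrow> real^'k^'k) \<Rightarrow>
    ('m \<times> 'm) set \<Rightarrow> ('m \<Rightarrow> 'm \<Rightarrow> ('m, 'e) tvec) \<Rightarrow>
    ('m \<Rightarrow> 'm \<Rightarrow> ('m, 'e) tvec \<Rightarrow> ('m, 'e) tvec) \<Rightarrow>
    (real \<Rightarrow> ('m, 'e) tvec \<Rightarrow> 'v::real_normed_vector) \<times> (real \<Rightarrow> real^'k \<Rightarrow> ('m, 'e) tvec \<Rightarrow> 'v) \<Rightarrow>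
    (real \<Rightarrow> 'm) \<times> (real \<Rightarrow> real^'k \<Rightarrow> ('m, 'e) tvec) \<Rightarrow>
    (real \<Rightarrow> 'v) \<times> (real \<Rightarrow> (real^'k) \<Rightarrow>\<^sub>L 'v)" where
  "rough_integral A p T \<omega> x X D \<psi> U a yy =
     (THE Z. is_rough_integral A p T \<omega> x X D \<psi> U a yy Z)"

end

theory Submission
  imports Defs
begin

text \<open>In a chart, let \<open>\<eta>\<close> be the coordinates of \<open>y\<close>, \<open>\<beta>\<close> those of \<open>\<alpha>\<close>, and let \<open>\<partial>\<^sub>1\<close>, \<open>\<partial>\<^sub>2\<close> be
  derivatives in the two variables of the gauge, taken on the diagonal. Differentiating \<open>\<psi>(u, u) = 0\<close>, \<open>\<partial>\<^sub>2\<psi>(u, u) = I\<close> and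
  \<open>U(u, u) = I\<close> along the diagonal gives \<open>S = - \<partial>\<^sub>2\<partial>\<^sub>2\<psi> - \<partial>\<^sub>1U\<close> and \<open>\<nabla>\<alpha> = \<partial>\<beta> + \<beta>(\<partial>\<^sub>1U)\<close>. Since \<open>\<partial>\<^sub>2\<partial>\<^sub>2\<psi>\<close> is
  symmetric and the symmetric part of \<open>X\<close> is \<open>x \<otimes> x / 2\<close>, the term \<open>\<partial>\<^sub>2\<partial>\<^sub>2\<psi>\<close> of \<open>S\<close> cancels the quadratic
  Taylor term of \<open>\<psi>\<close> up to third order, while the two contributions of \<open>\<partial>\<^sub>1U\<close> cancel exactly. What remains of
  the local approximation of the integral is \<open>\<beta>(\<eta>\<^sub>t - \<eta>\<^sub>s) + \<partial>\<beta>(y' \<otimes> y')X\<close>, which does not mention the gauge.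
  By Chen's relation this germ is additive up to third order, so that it can be sewn together because
  \<open>3 / p > 1\<close>, and the integral it determines is unique.\<close>

section \<open>Smooth functions\<close>

text \<open>The path need not stay in one chart, and the coordinate germ depends on the chart. It is
  therefore never globalised: the estimates along the path are stated for pairs of times close to a
  given time, where one chart suffices, and the germ of a gauge is compared there with the
  coordinate germ of that chart. Compactness of \<open>[0, T]\<close> then produces one constant and
  one mesh size, and what is sewn is the germ of the gauge itself, an expression on the manifold.
  Smoothness of forms, logarithms and parallelisms is given for fixed coordinate vectors, and
  \<open>V\<close> may be infinite-dimensional. Operator bounds, product rules and joint continuity
  are recovered by expanding the moving vector in the finite basis of the model space; completeness
  of \<open>V\<close> is used for the convergence of the sewn sums. Invariance is proved for the
  predicate that characterises the integral: its third order estimate is transferred from one gauge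
  to the other, so the two definite descriptions coincide, and existence and uniqueness make them
  meaningful.\<close>

lemma frechet_derivative_has:
  "f differentiable (at x) \<Longrightarrow> (f has_derivative frechet_derivative f (at x)) (at x)"
  using frechet_derivative_works by blast

text \<open>A Frechet derivative at a point sees a full neighbourhood, so equality on
  \<open>S\<close> passes to derivatives because \<open>S\<close> is open. The rules for sums,
  products and compositions use this to replace the derivative of a compound expression by its
  formula, which is valid on \<open>S\<close>.\<close>

lemma Ck_cong:
  assumes "open S" "\<And>x. x \<in> S \<Longrightarrow> f x = g x" "Ck k S f"
  shows "Ck k S g"
  using assms(2,3)
proof (induction k arbitrary: f g)
  case 0 then show ?case by (simp cong: continuous_on_cong)
next
  case (Suc k)
  have der: "(g has_derivative frechet_derivative f (at x)) (at x)" if "x \<in> S" for x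
    by (rule has_derivative_transform_within_open[OF frechet_derivative_has assms(1) that])
      (use Suc.prems that in auto)
  have eq: "frechet_derivative f (at x) v = frechet_derivative g (at x) v" if "x \<in> S" for x v
    using frechet_derivative_at[OF der[OF that]] by simp
  have "Ck k S (\<lambda>x. frechet_derivative g (at x) v)" for v
    by (rule Suc.IH[of "\<lambda>x. frechet_derivative f (at x) v", OF eq]) (use Suc.prems in simp_all)
  then show ?case using der by (auto simp: differentiable_def)
qed

lemma Ck_Suc_imp: "Ck (Suc k) S f \<Longrightarrow> Ck k S f"
proof (induction k arbitrary: f)
  case 0
  then show ?case
    by (auto intro!: continuous_at_imp_continuous_on differentiable_imp_continuous_within)
next
  case (Suc k)
  then show ?case by simp
qed

lemma Ck_const: "Ck k S (\<lambda>x. c)"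
  by (induction k arbitrary: c) auto

lemma Ck_add:
  assumes "open S" "Ck k S f" "Ck k S g"
  shows "Ck k S (\<lambda>x. f x + g x)"
  using assms(2,3)
proof (induction k arbitrary: f g)
  case 0 then show ?case by (auto intro: continuous_intros)
next
  case (Suc k)
  have der: "((\<lambda>x. f x + g x) has_derivative
      (\<lambda>v. frechet_derivative f (at x) v + frechet_derivative g (at x) v)) (at x)" if "x \<in> S" for x
    using Suc.prems that by (auto intro!: has_derivative_add frechet_derivative_has)
  have "Ck k S (\<lambda>x. frechet_derivative (\<lambda>x. f x + g x) (at x) v)" for v
    by (rule Ck_cong[OF assms(1) _ Suc.IH[of "\<lambda>x. frechet_derivative f (at x) v" "\<lambda>x. frechet_derivative
        g (at x) v"]])
      (use Suc.prems frechet_derivative_at[OF der, symmetric] in auto)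
  then show ?case using der by (auto simp: differentiable_def)
qed

lemma Ck_sum:
  assumes "open S" "finite I" "\<And>i. i \<in> I \<Longrightarrow> Ck k S (f i)"
  shows "Ck k S (\<lambda>x. \<Sum>i\<in>I. f i x)"
  using assms(2,3) by (induction I rule: finite_induct) (auto intro: Ck_add Ck_const assms(1))

lemma Ck_scaleR:
  fixes f :: "'a::euclidean_space \<Rightarrow> real"
  assumes "open S" "Ck k S f" "Ck k S g"
  shows "Ck k S (\<lambda>x. f x *\<^sub>R g x)"
  using assms(2,3)
proof (induction k arbitrary: f g)
  case 0 then show ?case by (auto intro: continuous_intros)
next
  case (Suc k)
  have der: "((\<lambda>x. f x *\<^sub>R g x) has_derivative
      (\<lambda>v. f x *\<^sub>R frechet_derivative g (at x) v + frechet_derivative f (at x) v *\<^sub>R g x)) (at x)" if "x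
          \<in> S" for x
    using Suc.prems that by (auto intro!: has_derivative_scaleR frechet_derivative_has)
  \<comment> \<open>Each Leibniz term keeps one factor undifferentiated, which
    \<open>Ck_Suc_imp\<close> lowers to order \<open>k\<close>; hence both factors are generalised
    in the induction.\<close>
  have "Ck k S (\<lambda>x. frechet_derivative (\<lambda>x. f x *\<^sub>R g x) (at x) v)" for v
    by (rule Ck_cong[OF assms(1) _ Ck_add[OF assms(1) Suc.IH[of f "\<lambda>x. frechet_derivative g (at x) v"]
            Suc.IH[of "\<lambda>x. frechet_derivative f (at x) v" g]]])
      (use Suc.prems frechet_derivative_at[OF der, symmetric] Ck_Suc_imp[OF Suc.prems(1)] Ck_Suc_imp[OF
          Suc.prems(2)] in auto)
  then show ?case using der by (auto simp: differentiable_def)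
qed

lemma Ck_bounded_linear:
  assumes "open S" "bounded_linear L" "Ck k S f"
  shows "Ck k S (\<lambda>x. L (f x))"
  using assms(3)
proof (induction k arbitrary: f)
  case 0 then show ?case
    using bounded_linear.continuous_on[OF assms(2)] by auto
next
  case (Suc k)
  have der: "((\<lambda>x. L (f x)) has_derivative (\<lambda>v. L (frechet_derivative f (at x) v))) (at x)" if "x \<in> S" for x
    using Suc.prems that by (auto intro!: bounded_linear.has_derivative[OF assms(2)] frechet_derivative_has)
  have "Ck k S (\<lambda>x. frechet_derivative (\<lambda>x. L (f x)) (at x) v)" for v
    by (rule Ck_cong[OF assms(1) _ Suc.IH[of "\<lambda>x. frechet_derivative f (at x) v"]])
      (use Suc.prems frechet_derivative_at[OF der, symmetric] in auto)
  then show ?case using der by (auto simp: differentiable_def)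
qed

text \<open>The device that turns facts about fixed vectors into facts about moving ones: the domain
  has a finite basis, while the codomain may be any real vector space.\<close>

lemma linear_euclidean_expand:
  fixes e :: "'e::euclidean_space"
  assumes "linear L"
  shows "L e = (\<Sum>b\<in>Basis. (e \<bullet> b) *\<^sub>R L b)"
proof -
  have "L e = L (\<Sum>b\<in>Basis. (e \<bullet> b) *\<^sub>R b)" by (simp add: euclidean_representation)
  also have "\<dots> = (\<Sum>b\<in>Basis. (e \<bullet> b) *\<^sub>R L b)"
    by (simp add: linear_sum[OF assms] linear_cmul[OF assms])
  finally show ?thesis .
qed

text \<open>By the chain rule the derivative of \<open>f\<close> is evaluated in a direction that
  moves with \<open>x\<close>, whereas \<open>Ck\<close> speaks of constant directions. Expanding
  that direction in the basis leaves sums of scalar functions times compositions of order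
  \<open>k\<close>, to which the induction hypothesis applies.\<close>

lemma Ck_compose:
  fixes f :: "'b::euclidean_space \<Rightarrow> 'c::real_normed_vector" and g :: "'a::euclidean_space \<Rightarrow> 'b"
  assumes "open S" "open T" "g ` S \<subseteq> T" "Ck k T f" "Ck k S g"
  shows "Ck k S (\<lambda>x. f (g x))"
  using assms(4,5)
proof (induction k arbitrary: f)
  case 0 then show ?case
    using assms(3) by (auto intro: continuous_on_compose2)
next
  case (Suc k)
  have gT: "g x \<in> T" if "x \<in> S" for x using assms(3) that by auto
  have der: "((\<lambda>x. f (g x)) has_derivative
      (\<lambda>v. frechet_derivative f (at (g x)) (frechet_derivative g (at x) v))) (at x)" if "x \<in> S" for x
    using Suc.prems that gT[OF that] by (auto intro!: has_derivative_compose[of g _ x] frechet_derivative_has)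
  have lin: "frechet_derivative f (at (g x)) w = (\<Sum>b\<in>Basis. (w \<bullet> b) *\<^sub>R frechet_derivative f (at (g x)) b)"
    if "x \<in> S" for x w
    by (rule linear_euclidean_expand, rule linear_frechet_derivative) (use Suc.prems gT[OF that] in auto)
  have "Ck k S (\<lambda>x. \<Sum>b\<in>Basis. (frechet_derivative g (at x) v \<bullet> b) *\<^sub>R frechet_derivative f (at (g x))
      b)" for v
    by (intro Ck_sum Ck_scaleR assms(1) finite_Basis Suc.IH Ck_bounded_linear[OF assms(1)
        bounded_linear_inner_left])
      (use Suc.prems Ck_Suc_imp[OF Suc.prems(2)] in auto)
  then have "Ck k S (\<lambda>x. frechet_derivative (\<lambda>x. f (g x)) (at x) v)" for v
    by (rule Ck_cong[OF assms(1), rotated])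
      (auto simp: frechet_derivative_at[OF der, symmetric] lin[symmetric])
  then show ?case using der by (auto simp: differentiable_def)
qed

lemma smooth_on_deriv: "smooth_on S f \<Longrightarrow> smooth_on S (\<lambda>x. frechet_derivative f (at x) v)"
  unfolding smooth_on_def by (metis Ck.simps(2))

lemma smooth_on_differentiable: "smooth_on S f \<Longrightarrow> x \<in> S \<Longrightarrow> f differentiable (at x)"
  unfolding smooth_on_def by (metis Ck.simps(2))

lemma smooth_on_has_derivative:
  "smooth_on S f \<Longrightarrow> x \<in> S \<Longrightarrow> (f has_derivative frechet_derivative f (at x)) (at x)"
  by (intro frechet_derivative_has smooth_on_differentiable)

lemma smooth_on_linear: "smooth_on S f \<Longrightarrow> x \<in> S \<Longrightarrow> linear (frechet_derivative f (at x))"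
  by (intro linear_frechet_derivative smooth_on_differentiable)

lemma smooth_on_continuous: "smooth_on S f \<Longrightarrow> continuous_on S f"
  unfolding smooth_on_def by (metis Ck.simps(1))

lemma smooth_on_isCont: "smooth_on S f \<Longrightarrow> x \<in> S \<Longrightarrow> isCont f x"
  by (intro differentiable_imp_continuous_within smooth_on_differentiable)

lemma smooth_on_cong:
  "open S \<Longrightarrow> (\<And>x. x \<in> S \<Longrightarrow> f x = g x) \<Longrightarrow> smooth_on S f \<Longrightarrow> smooth_on S g"
  unfolding smooth_on_def using Ck_cong by blast

section \<open>Domination along filters\<close>

text \<open>The relation \<open>f \<in> O[G](q)\<close>, which the library defines only for \<open>f\<close> with values in a normed field.\<close>

definition dominated :: "'i filter \<Rightarrow> ('i \<Rightarrow> 'b::real_normed_vector) \<Rightarrow> ('i \<Rightarrow> real) \<Rightarrow> bool" where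
  "dominated G f q \<longleftrightarrow> (\<exists>C. \<forall>\<^sub>F z in G. norm (f z) \<le> C * \<bar>q z\<bar>)"

lemma dominated_nonneg:
  assumes "dominated G f q"
  obtains C where "C \<ge> 0" "\<forall>\<^sub>F z in G. norm (f z) \<le> C * \<bar>q z\<bar>"
proof -
  obtain C where C: "\<forall>\<^sub>F z in G. norm (f z) \<le> C * \<bar>q z\<bar>" using assms by (auto simp: dominated_def)
  have "\<forall>\<^sub>F z in G. norm (f z) \<le> \<bar>C\<bar> * \<bar>q z\<bar>"
    using C by (rule eventually_mono) (smt (verit) mult_right_mono abs_ge_zero)
  then show ?thesis using that[of "\<bar>C\<bar>"] by auto
qed

lemma dominatedI: "\<forall>\<^sub>F z in G. norm (f z) \<le> C * \<bar>q z\<bar> \<Longrightarrow> dominated G f q"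
  by (auto simp: dominated_def)

lemma dominated_cong:
  assumes "dominated G f q" "\<forall>\<^sub>F z in G. f z = f' z \<and> q z = q' z"
  shows "dominated G f' q'"
proof -
  obtain C where C: "\<forall>\<^sub>F z in G. norm (f z) \<le> C * \<bar>q z\<bar>" using assms by (auto simp: dominated_def)
  show ?thesis by (rule dominatedI[where C = "C"]) (use C assms(2) in eventually_elim, auto)
qed

lemma dominated_zero [simp]: "dominated G (\<lambda>z. 0) q"
  by (rule dominatedI[where C = "0"]) auto

lemma dominated_add:
  assumes "dominated G f q" "dominated G g q"
  shows "dominated G (\<lambda>z. f z + g z) q"
proof -
  obtain C1 C2 where "\<forall>\<^sub>F z in G. norm (f z) \<le> C1 * \<bar>q z\<bar>" "\<forall>\<^sub>F z in G. norm (g z) \<le> C2 * \<bar>q z\<bar>"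
    using assms by (auto simp: dominated_def)
  then have "\<forall>\<^sub>F z in G. norm (f z + g z) \<le> (C1 + C2) * \<bar>q z\<bar>"
    by eventually_elim (auto simp: distrib_right intro: norm_triangle_le add_mono)
  then show ?thesis by (rule dominatedI)
qed

lemma dominated_minus: "dominated G f q \<Longrightarrow> dominated G (\<lambda>z. - f z) q"
  by (auto simp: dominated_def)

lemma dominated_diff: "dominated G f q \<Longrightarrow> dominated G g q \<Longrightarrow> dominated G (\<lambda>z. f z - g z) q"
  using dominated_add[OF _ dominated_minus, of G f q g] by simp

lemma dominated_sum:
  "finite I \<Longrightarrow> (\<And>i. i \<in> I \<Longrightarrow> dominated G (f i) q) \<Longrightarrow> dominated G (\<lambda>z. \<Sum>i\<in>I. f i z) q"
  by (induction I rule: finite_induct) (auto intro: dominated_add)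

lemma dominated_norm: "dominated G (\<lambda>z. norm (f z)) q \<longleftrightarrow> dominated G f q"
  by (simp add: dominated_def)

text \<open>Comparison functions may themselves be dominated, so orders of smallness can be chained;
  the absolute value around the comparison function avoids sign conditions.\<close>

lemma dominated_trans:
  assumes "dominated G f q" "dominated G q r"
  shows "dominated G f r"
proof -
  obtain C where C: "C \<ge> 0" "\<forall>\<^sub>F z in G. norm (f z) \<le> C * \<bar>q z\<bar>" using dominated_nonneg[OF assms(1)] .
  obtain D where D: "D \<ge> 0" "\<forall>\<^sub>F z in G. norm (q z) \<le> D * \<bar>r z\<bar>" using dominated_nonneg[OF assms(2)] .
  have "\<forall>\<^sub>F z in G. norm (f z) \<le> (C * D) * \<bar>r z\<bar>"
    using C(2) D(2)
  proof eventually_elim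
    case (elim z)
    have "C * \<bar>q z\<bar> \<le> C * (D * \<bar>r z\<bar>)" using elim C by (intro mult_left_mono) auto
    then show ?case using elim by (simp add: mult.assoc)
  qed
  then show ?thesis by (rule dominatedI)
qed

lemma dominated_scaleR:
  assumes "dominated G f p" "dominated G g q"
  shows "dominated G (\<lambda>z. f z *\<^sub>R g z) (\<lambda>z. p z * q z)"
proof -
  obtain C where C: "C \<ge> 0" "\<forall>\<^sub>F z in G. norm (f z) \<le> C * \<bar>p z\<bar>" using dominated_nonneg[OF assms(1)] .
  obtain D where D: "D \<ge> 0" "\<forall>\<^sub>F z in G. norm (g z) \<le> D * \<bar>q z\<bar>" using dominated_nonneg[OF assms(2)] .
  have "\<forall>\<^sub>F z in G. norm (f z *\<^sub>R g z) \<le> (C * D) * \<bar>p z * q z\<bar>"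
    using C(2) D(2)
  proof eventually_elim
    case (elim z)
    have "norm (f z) * norm (g z) \<le> (C * \<bar>p z\<bar>) * (D * \<bar>q z\<bar>)" using elim C D by (intro mult_mono) auto
    then show ?case by (simp add: abs_mult mult_ac)
  qed
  then show ?thesis by (rule dominatedI)
qed

lemma dominated_mult:
  fixes f g :: "'i \<Rightarrow> real"
  shows "dominated G f p \<Longrightarrow> dominated G g q \<Longrightarrow> dominated G (\<lambda>z. f z * g z) (\<lambda>z. p z * q z)"
  using dominated_scaleR[of G f p g q] by simp

lemma dominated_power:
  fixes f :: "'i \<Rightarrow> real"
  assumes "dominated G f p"
  shows "dominated G (\<lambda>z. f z ^ n) (\<lambda>z. p z ^ n)"
proof (induction n)
  case 0 show ?case by (rule dominatedI[where C = "1"]) auto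
next
  case (Suc n) then show ?case using dominated_mult[OF assms Suc] by simp
qed

lemma dominated_bounded_linear:
  assumes "bounded_linear L" "dominated G f q"
  shows "dominated G (\<lambda>z. L (f z)) q"
proof -
  interpret bounded_linear L by fact
  obtain K where K: "K \<ge> 0" "\<And>x. norm (L x) \<le> norm x * K" using nonneg_bounded by blast
  have "dominated G (\<lambda>z. L (f z)) (\<lambda>z. norm (f z))"
    by (rule dominatedI[where C = "K"]) (use K in \<open>auto simp: mult.commute\<close>)
  then show ?thesis using dominated_trans assms(2) dominated_norm by blast
qed

text \<open>Evaluation of a varying linear map at a varying vector: the orders multiply, although
  the map is estimated on the finitely many basis vectors only.\<close>

lemma dominated_linear:
  fixes e :: "'i \<Rightarrow> 'e::euclidean_space"
  assumes lin: "\<forall>\<^sub>F z in G. linear (L z)"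
    and L: "\<And>b. b \<in> Basis \<Longrightarrow> dominated G (\<lambda>z. L z b) p" and e: "dominated G e q"
  shows "dominated G (\<lambda>z. L z (e z)) (\<lambda>z. p z * q z)"
proof -
  have "dominated G (\<lambda>z. \<Sum>b\<in>Basis. (e z \<bullet> b) *\<^sub>R L z b) (\<lambda>z. q z * p z)"
    by (intro dominated_sum dominated_scaleR L finite_Basis
        dominated_bounded_linear[OF bounded_linear_inner_left e]) auto
  then show ?thesis
  proof (rule dominated_cong, use lin in eventually_elim)
    case (elim z)
    then show ?case using linear_euclidean_expand[OF elim, of "e z"] by (simp add: mult.commute)
  qed
qed

lemma dominated_compose:
  assumes "dominated G f q" "filterlim h G H"
  shows "dominated H (\<lambda>z. f (h z)) (\<lambda>z. q (h z))"
proof -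
  obtain C where C: "\<forall>\<^sub>F z in G. norm (f z) \<le> C * \<bar>q z\<bar>" using assms by (auto simp: dominated_def)
  show ?thesis using eventually_compose_filterlim[OF C assms(2)] by (rule dominatedI)
qed

lemma dominated_tendsto:
  assumes "(f \<longlongrightarrow> l) G"
  shows "dominated G f (\<lambda>z. 1)"
proof (rule dominatedI)
  have "((\<lambda>z. norm (f z)) \<longlongrightarrow> norm l) G" using assms by (rule tendsto_norm)
  then have "\<forall>\<^sub>F z in G. norm (f z) < norm l + 1" by (rule order_tendstoD) simp
  then show "\<forall>\<^sub>F z in G. norm (f z) \<le> (norm l + 1) * \<bar>1\<bar>" by eventually_elim simp
qed

section \<open>Uniform Taylor estimates and the symmetry of second derivatives\<close>

lemma eventually_nhds_pair_cball:
  assumes "\<exists>r>0. \<forall>x\<in>cball z0 r. \<forall>y\<in>cball z0 r. P x y"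
  shows "\<forall>\<^sub>F p in nhds z0 \<times>\<^sub>F nhds z0. P (fst p) (snd p)"
proof -
  from assms obtain r where r: "r > 0" "\<And>x y. x \<in> cball z0 r \<Longrightarrow> y \<in> cball z0 r \<Longrightarrow> P x y" by blast
  have "\<forall>\<^sub>F x in nhds z0. x \<in> cball z0 r"
    using r eventually_nhds_in_open[of "ball z0 r" z0] by (auto elim!: eventually_mono)
  then show ?thesis unfolding eventually_prod_filter
    using r by (intro exI[of _ "\<lambda>x. x \<in> cball z0 r"]) auto
qed

text \<open>For each basis direction the derivative is continuous, hence bounded on the compact set;
  summing these bounds controls all directions at once.\<close>

lemma smooth_on_deriv_bound:
  fixes f :: "'a::euclidean_space \<Rightarrow> 'b::real_normed_vector"
  assumes f: "smooth_on S f" and K: "compact K" "K \<subseteq> S"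
  obtains C where "C \<ge> 0" "\<And>x v. x \<in> K \<Longrightarrow> norm (frechet_derivative f (at x) v) \<le> C * norm v"
proof -
  have "\<exists>B. \<forall>x\<in>K. norm (frechet_derivative f (at x) b) \<le> B" for b
  proof -
    have "compact ((\<lambda>x. frechet_derivative f (at x) b) ` K)"
      by (intro compact_continuous_image K continuous_on_subset[OF smooth_on_continuous[OF
          smooth_on_deriv[OF f]]])
    then have "bounded ((\<lambda>x. frechet_derivative f (at x) b) ` K)" by (rule compact_imp_bounded)
    then show ?thesis by (auto simp: bounded_iff)
  qed
  then obtain B where B: "\<And>b x. x \<in> K \<Longrightarrow> norm (frechet_derivative f (at x) b) \<le> B b" by metis
  define C where "C = (\<Sum>b\<in>Basis. \<bar>B b\<bar>)"
  have "norm (frechet_derivative f (at x) v) \<le> C * norm v" if "x \<in> K" for x v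
  proof -
    have "norm (frechet_derivative f (at x) v) = norm (\<Sum>b\<in>Basis. (v \<bullet> b) *\<^sub>R frechet_derivative f (at x) b)"
      using linear_euclidean_expand[OF smooth_on_linear[OF f], of x v] that K(2) by auto
    also have "\<dots> \<le> (\<Sum>b\<in>Basis. \<bar>B b\<bar> * norm v)"
    proof (rule sum_norm_le)
      fix b :: 'a assume b: "b \<in> Basis"
      have "norm ((v \<bullet> b) *\<^sub>R frechet_derivative f (at x) b) = \<bar>v \<bullet> b\<bar> * norm (frechet_derivative f (at
          x) b)" by simp
      also have "\<dots> \<le> norm v * \<bar>B b\<bar>"
        using Basis_le_norm[OF b, of v] B[OF that, of b] by (intro mult_mono) auto
      finally show "norm ((v \<bullet> b) *\<^sub>R frechet_derivative f (at x) b) \<le> \<bar>B b\<bar> * norm v" by (simp add: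
          mult.commute)
    qed
    finally show ?thesis by (simp add: C_def sum_distrib_right)
  qed
  moreover have "C \<ge> 0" by (auto simp: C_def intro: sum_nonneg)
  ultimately show ?thesis by (rule that[rotated])
qed

lemma smooth_on_lipschitz:
  fixes f :: "'a::euclidean_space \<Rightarrow> 'b::real_normed_vector"
  assumes "smooth_on S f" "compact K" "convex K" "K \<subseteq> S"
  obtains C where "C \<ge> 0" "\<And>x y. x \<in> K \<Longrightarrow> y \<in> K \<Longrightarrow> norm (f y - f x) \<le> C * norm (y - x)"
proof -
  obtain C where C: "C \<ge> 0" "\<And>x v. x \<in> K \<Longrightarrow> norm (frechet_derivative f (at x) v) \<le> C * norm v"
    by (rule smooth_on_deriv_bound[OF assms(1,2,4)]) blast
  have "norm (f y - f x) \<le> C * norm (y - x)" if "x \<in> K" "y \<in> K" for x y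
  proof (rule differentiable_bound[OF assms(3), where f' = "\<lambda>x. frechet_derivative f (at x)"])
    fix z assume z: "z \<in> K"
    show "(f has_derivative frechet_derivative f (at z)) (at z within K)"
      using z assms(4) smooth_on_has_derivative[OF assms(1), of z] has_derivative_at_withinI by blast
    show "onorm (frechet_derivative f (at z)) \<le> C"
      using C z by (intro onorm_bound) auto
  qed (use that in auto)
  then show ?thesis using C(1) that by blast
qed

text \<open>The factor \<open>q\<close> carries the order of smallness: it is the distance of two
  points for the second order Taylor estimate and the square of that distance for the third order
  one.\<close>

lemma linear_family_bound:
  fixes L :: "'z \<Rightarrow> 'e::euclidean_space \<Rightarrow> 'b::real_normed_vector"
  assumes "\<And>z. z \<in> Z \<Longrightarrow> linear (L z)" "\<And>z. z \<in> Z \<Longrightarrow> q z \<ge> 0"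
    and "\<And>b. b \<in> Basis \<Longrightarrow> \<exists>C. \<forall>z\<in>Z. norm (L z b) \<le> C * q z"
  obtains C where "C \<ge> 0" "\<And>z v. z \<in> Z \<Longrightarrow> norm (L z v) \<le> C * q z * norm v"
proof -
  obtain B where B: "\<And>b z. b \<in> Basis \<Longrightarrow> z \<in> Z \<Longrightarrow> norm (L z b) \<le> B b * q z" using assms(3) by metis
  define C where "C = (\<Sum>b\<in>Basis. \<bar>B b\<bar>)"
  have "norm (L z v) \<le> C * q z * norm v" if "z \<in> Z" for z v
  proof -
    have "norm (L z v) = norm (\<Sum>b\<in>Basis. (v \<bullet> b) *\<^sub>R L z b)"
      using linear_euclidean_expand[OF assms(1)[OF that], of v] by simp
    also have "\<dots> \<le> (\<Sum>b\<in>Basis. \<bar>B b\<bar> * (q z * norm v))"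
    proof (rule sum_norm_le)
      fix b :: 'e assume b: "b \<in> Basis"
      have "norm (L z b) \<le> \<bar>B b\<bar> * q z" using B[OF b that] assms(2)[OF that] by (smt (verit) mult_right_mono)
      then have "\<bar>v \<bullet> b\<bar> * norm (L z b) \<le> norm v * (\<bar>B b\<bar> * q z)"
        using Basis_le_norm[OF b, of v] by (intro mult_mono) auto
      then show "norm ((v \<bullet> b) *\<^sub>R L z b) \<le> \<bar>B b\<bar> * (q z * norm v)" by (simp add: mult_ac)
    qed
    finally show ?thesis by (simp add: C_def sum_distrib_right mult.assoc)
  qed
  moreover have "C \<ge> 0" by (auto simp: C_def intro: sum_nonneg)
  ultimately show ?thesis by (rule that[rotated])
qed

lemma smooth_on_taylor2:
  fixes f :: "'a::euclidean_space \<Rightarrow> 'b::real_normed_vector"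
  assumes f: "smooth_on S f" and K: "compact K" "convex K" "K \<subseteq> S"
  obtains C where "C \<ge> 0" "\<And>x y. x \<in> K \<Longrightarrow> y \<in> K \<Longrightarrow>
    norm (f y - f x - frechet_derivative f (at x) (y - x)) \<le> C * norm (y - x) ^ 2"
proof -
  \<comment> \<open>The variation of the derivative between the two points of \<open>p\<close>.
    Indexing by pairs turns its Lipschitz bound into a bound for a family of linear maps.\<close>
  define L where "L p v = frechet_derivative f (at (snd p)) v - frechet_derivative f (at (fst p)) v" for p v
  have "\<exists>C. \<forall>p\<in>K\<times>K. norm (L p b) \<le> C * norm (snd p - fst p)" for b
  proof -
    obtain C where "\<And>x y. x \<in> K \<Longrightarrow> y \<in> K \<Longrightarrow>
      norm (frechet_derivative f (at y) b - frechet_derivative f (at x) b) \<le> C * norm (y - x)"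
      using smooth_on_lipschitz[OF smooth_on_deriv[OF f, of b] K] by metis
    then show ?thesis by (auto simp: L_def)
  qed
  moreover have "linear (L p)" if "p \<in> K \<times> K" for p
    unfolding L_def using that K(3) by (intro linear_compose_sub smooth_on_linear[OF f]) auto
  ultimately obtain C where C: "C \<ge> 0" "\<And>p v. p \<in> K \<times> K \<Longrightarrow> norm (L p v) \<le> C * norm (snd p - fst p) * norm v"
    using linear_family_bound[of "K \<times> K" L "\<lambda>p. norm (snd p - fst p)"] by (metis norm_ge_zero)
  have "norm (f y - f x - frechet_derivative f (at x) (y - x)) \<le> C * norm (y - x) ^ 2" if x: "x \<in> K" and
      y: "y \<in> K" for x y
  proof -
    have "norm (f y - f x - frechet_derivative f (at x) (y - x)) \<le> norm (y - x) * (C * norm (y - x))"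
    proof (rule differentiable_bound_linearization[where S = "closed_segment x y" and f' = "\<lambda>x.
        frechet_derivative f (at x)"])
      fix t :: real assume "t \<in> {0..1}" then show "x + t *\<^sub>R (y - x) \<in> closed_segment x y"
        by (auto simp: in_segment algebra_simps intro!: exI[of _ t])
    next
      fix z assume z: "z \<in> closed_segment x y"
      then have zK: "z \<in> K" using K(2) x y closed_segment_subset by blast
      show "(f has_derivative frechet_derivative f (at z)) (at z within closed_segment x y)"
        using zK K(3) smooth_on_has_derivative[OF f, of z] has_derivative_at_withinI by blast
      have "norm (z - x) \<le> norm (y - x)"
        using segment_bound(1)[OF z] .
      then have le: "C * norm (z - x) \<le> C * norm (y - x)" using C(1) by (intro mult_left_mono) auto
      show "onorm (frechet_derivative f (at z) - frechet_derivative f (at x)) \<le> C * norm (y - x)"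
      proof (rule onorm_bound)
        fix v
        have "norm (L (x, z) v) \<le> C * norm (z - x) * norm v" using C(2)[of "(x, z)" v] zK x by auto
        also have "\<dots> \<le> C * norm (y - x) * norm v" using le by (intro mult_right_mono) auto
        finally show "norm ((frechet_derivative f (at z) - frechet_derivative f (at x)) v) \<le> C * norm (y
            - x) * norm v"
          by (simp add: L_def)
      qed (use C(1) in auto)
    qed auto
    then show ?thesis by (simp add: power2_eq_square mult_ac)
  qed
  then show ?thesis using C(1) that by blast
qed

text \<open>The second derivative differentiates \<open>frechet_derivative f (at z) v\<close> in
  \<open>z\<close> with \<open>v\<close> frozen, so linearity in \<open>v\<close> is not built in.
  It follows by differentiating the linearity identity, which holds near \<open>x\<close> as
  \<open>S\<close> is open.\<close>

lemma smooth_on_deriv2_linear: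
  fixes f :: "'a::euclidean_space \<Rightarrow> 'b::real_normed_vector"
  assumes f: "smooth_on S f" and S: "open S" and x: "x \<in> S"
  shows "linear (\<lambda>v. frechet_derivative (\<lambda>z. frechet_derivative f (at z) v) (at x) k)"
proof -
  let ?D = "\<lambda>v z. frechet_derivative f (at z) v"
  have d: "(?D v has_derivative frechet_derivative (?D v) (at x)) (at x)" for v
    by (rule smooth_on_has_derivative[OF smooth_on_deriv[OF f] x])
  have lin: "linear (frechet_derivative f (at z))" if "z \<in> S" for z
    using smooth_on_linear[OF f that] .
  show ?thesis
  proof (rule linearI)
    fix v w
    have "(?D (v + w) has_derivative (\<lambda>k. frechet_derivative (?D v) (at x) k + frechet_derivative (?D w)
        (at x) k)) (at x)"
      by (rule has_derivative_transform_within_open[OF has_derivative_add[OF d d] S x])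
        (simp add: linear_add[OF lin])
    from fun_cong[OF frechet_derivative_at[OF this], of k]
    show "frechet_derivative (?D (v + w)) (at x) k = frechet_derivative (?D v) (at x) k +
        frechet_derivative (?D w) (at x) k"
      by (rule sym)
  next
    fix r v
    have "(?D (r *\<^sub>R v) has_derivative (\<lambda>k. r *\<^sub>R frechet_derivative (?D v) (at x) k)) (at x)"
      by (rule has_derivative_transform_within_open[OF has_derivative_scaleR_right[OF d] S x])
        (simp add: linear_cmul[OF lin])
    from fun_cong[OF frechet_derivative_at[OF this], of k]
    show "frechet_derivative (?D (r *\<^sub>R v)) (at x) k = r *\<^sub>R frechet_derivative (?D v) (at x) k"
      by (rule sym)
  qed
qed

text \<open>The second order estimate for the directional derivatives, in operator form, bounds the
  derivative of the remainder along the segment; the mean value inequality then supplies the third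
  power of the increment.\<close>

lemma smooth_on_taylor3:
  fixes f :: "'a::euclidean_space \<Rightarrow> 'b::real_normed_vector"
  assumes f: "smooth_on S f" and S: "open S" and K: "compact K" "convex K" "K \<subseteq> S"
  obtains C where "C \<ge> 0" "\<And>x y. x \<in> K \<Longrightarrow> y \<in> K \<Longrightarrow>
    norm (f y - f x - frechet_derivative f (at x) (y - x)
      - (1/2) *\<^sub>R frechet_derivative (\<lambda>z. frechet_derivative f (at z) (y - x)) (at x) (y - x)) \<le> C *
          norm (y - x) ^ 3"
proof -
  let ?D = "\<lambda>v x. frechet_derivative f (at x) v"
  define L where "L p v = ?D v (snd p) - ?D v (fst p) - frechet_derivative (?D v) (at (fst p)) (snd p -
      fst p)" for p v
  have "\<exists>C. \<forall>p\<in>K\<times>K. norm (L p b) \<le> C * norm (snd p - fst p) ^ 2" for b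
  proof -
    obtain C where "\<And>x y. x \<in> K \<Longrightarrow> y \<in> K \<Longrightarrow>
      norm (?D b y - ?D b x - frechet_derivative (?D b) (at x) (y - x)) \<le> C * norm (y - x) ^ 2"
      using smooth_on_taylor2[OF smooth_on_deriv[OF f, of b] K] by metis
    then show ?thesis by (auto simp: L_def)
  qed
  moreover have "linear (L p)" if "p \<in> K \<times> K" for p
    unfolding L_def using that K(3)
    by (intro linear_compose_sub smooth_on_linear[OF f] smooth_on_deriv2_linear[OF f S]) auto
  ultimately obtain C where C: "C \<ge> 0" "\<And>p v. p \<in> K \<times> K \<Longrightarrow> norm (L p v) \<le> C * norm (snd p - fst p) ^ 2 *
      norm v"
    using linear_family_bound[of "K \<times> K" L "\<lambda>p. norm (snd p - fst p) ^ 2"] by (metis zero_le_power2)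
  have "norm (f y - f x - ?D (y - x) x - (1/2) *\<^sub>R frechet_derivative (?D (y - x)) (at x) (y - x)) \<le> C *
      norm (y - x) ^ 3"
    if x: "x \<in> K" and y: "y \<in> K" for x y
  proof -
    define h where "h = y - x"
    \<comment> \<open>\<open>g 1 - g 0\<close> is the remainder to be estimated, and the derivative
      of \<open>g\<close> at \<open>t\<close> is \<open>L (x, x + t *\<^sub>R h) h\<close>.\<close>
    define g where "g t = f (x + t *\<^sub>R h) - t *\<^sub>R ?D h x - (t^2/2) *\<^sub>R frechet_derivative (?D h) (at x)
        h" for t
    have seg: "x + t *\<^sub>R h \<in> K" if "t \<in> {0..1}" for t
    proof -
      have "x + t *\<^sub>R h = (1 - t) *\<^sub>R x + t *\<^sub>R y" by (simp add: h_def algebra_simps)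
      then show ?thesis using convexD_alt[OF K(2) x y, of t] that by simp
    qed
    have "norm (g 1 - g 0) \<le> (C * norm h ^ 3) * norm (1 - 0 :: real)"
    proof (rule differentiable_bound[of "{0..1}" g "\<lambda>t s. s *\<^sub>R (?D h (x + t *\<^sub>R h) - ?D h x - t *\<^sub>R
        frechet_derivative (?D h) (at x) h)"])
      fix t :: real assume t: "t \<in> {0..1}"
      have fd: "(f has_derivative frechet_derivative f (at (x + t *\<^sub>R h))) (at (x + t *\<^sub>R h))"
        using smooth_on_has_derivative[OF f] seg[OF t] K(3) by auto
      have l: "linear (frechet_derivative f (at (x + t *\<^sub>R h)))"
        using smooth_on_linear[OF f] seg[OF t] K(3) by auto
      have "((\<lambda>t. f (x + t *\<^sub>R h)) has_derivative (\<lambda>s. frechet_derivative f (at (x + t *\<^sub>R h)) (s *\<^sub>R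
          h))) (at t within {0..1})"
        by (rule has_derivative_compose[where f = "\<lambda>t. x + t *\<^sub>R h" and x = t, OF _ fd]) (auto intro!:
            derivative_eq_intros)
      then show "(g has_derivative (\<lambda>s. s *\<^sub>R (?D h (x + t *\<^sub>R h) - ?D h x - t *\<^sub>R frechet_derivative
          (?D h) (at x) h))) (at t within {0..1})"
        unfolding g_def
        by (auto intro!: derivative_eq_intros simp: linear_cmul[OF l] scaleR_diff_right fun_eq_iff)
      have xt: "(x, x + t *\<^sub>R h) \<in> K \<times> K" using x seg[OF t] by auto
      have l2: "linear (frechet_derivative (?D h) (at x))"
        using smooth_on_linear[OF smooth_on_deriv[OF f]] x K(3) by auto
      have "norm (L (x, x + t *\<^sub>R h) h) \<le> C * norm (t *\<^sub>R h) ^ 2 * norm h" using C(2)[OF xt, of h] by simp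
      also have "\<dots> \<le> C * norm h ^ 2 * norm h"
        using t C(1) by (intro mult_right_mono mult_left_mono power_mono) (auto simp: mult_left_le_one_le)
      finally have *: "norm (?D h (x + t *\<^sub>R h) - ?D h x - t *\<^sub>R frechet_derivative (?D h) (at x) h) \<le> C
          * norm h ^ 3"
        by (simp add: L_def linear_cmul[OF l2] power3_eq_cube power2_eq_square mult_ac)
      show "onorm (\<lambda>s. s *\<^sub>R (?D h (x + t *\<^sub>R h) - ?D h x - t *\<^sub>R frechet_derivative (?D h) (at x) h)) \<le>
          C * norm h ^ 3"
        by (rule onorm_bound) (use * C(1) in \<open>auto simp: mult.commute mult_left_mono\<close>)
    qed auto
    then show ?thesis by (simp add: g_def h_def algebra_simps)
  qed
  then show ?thesis using C(1) that by blast
qed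

text \<open>The second difference is symmetric in \<open>v\<close> and \<open>w\<close>; comparing this expansion with the one where \<open>v\<close>
  and \<open>w\<close> are exchanged gives the symmetry of the second derivative.\<close>

lemma smooth_on_second_difference:
  fixes f :: "'a::euclidean_space \<Rightarrow> 'b::real_normed_vector"
  assumes f: "smooth_on S f" and S: "open S" and x: "x \<in> S"
  obtains C r where "r > 0" "\<And>t. 0 < t \<Longrightarrow> t < r \<Longrightarrow>
    norm (f (x + t *\<^sub>R v + t *\<^sub>R w) - f (x + t *\<^sub>R v) - f (x + t *\<^sub>R w) + f x
      - t^2 *\<^sub>R frechet_derivative (\<lambda>z. frechet_derivative f (at z) w) (at x) v) \<le> C * t^3"
proof -
  let ?D = "\<lambda>z. frechet_derivative f (at z) w"
  define L where "L = frechet_derivative ?D (at x)"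
  obtain \<epsilon> where \<epsilon>: "\<epsilon> > 0" "cball x \<epsilon> \<subseteq> S" using S x open_contains_cball by blast
  obtain C where C: "C \<ge> 0" "\<And>y. y \<in> cball x \<epsilon> \<Longrightarrow> norm (?D y - ?D x - L (y - x)) \<le> C * norm (y - x) ^ 2"
    unfolding L_def
    by (rule smooth_on_taylor2[OF smooth_on_deriv[OF f, of w] compact_cball convex_cball \<epsilon>(2)]) (use
        \<epsilon>(1) in auto)
  have L: "linear L" unfolding L_def by (rule smooth_on_linear[OF smooth_on_deriv[OF f] x])
  define N where "N = norm v + norm w + 1"
  have N: "N > 0" "N \<ge> norm v + norm w" by (auto simp: N_def add_nonneg_pos)
  show ?thesis
  proof (rule that[of "\<epsilon> / N" "2 * C * N^2"])
    show "\<epsilon> / N > 0" using \<epsilon>(1) N(1) by simp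
    fix t :: real assume t: "0 < t" "t < \<epsilon> / N"
    have tN: "t * N \<le> \<epsilon>" using t(2) N(1) by (simp add: field_simps)
    have nrm: "norm (a *\<^sub>R t *\<^sub>R v + \<rho> *\<^sub>R t *\<^sub>R w) \<le> t * N" if "a \<in> {0..1}" "\<rho> \<in> {0..1}" for a \<rho>
    proof -
      have "norm (a *\<^sub>R t *\<^sub>R v + \<rho> *\<^sub>R t *\<^sub>R w) \<le> a * (t * norm v) + \<rho> * (t * norm w)"
        using that t by (intro norm_triangle_le add_mono) auto
      also have "\<dots> \<le> 1 * (t * norm v) + 1 * (t * norm w)"
        using that t by (intro add_mono mult_right_mono) auto
      also have "\<dots> \<le> t * N" using t N(2) by (simp add: distrib_left[symmetric])
      finally show ?thesis .
    qed
    have mem: "x + (a *\<^sub>R t *\<^sub>R v + \<rho> *\<^sub>R t *\<^sub>R w) \<in> cball x \<epsilon>" if "a \<in> {0..1}" "\<rho> \<in> {0..1}" for a \<rho>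
      using order_trans[OF nrm[OF that] tN] by (simp only: mem_cball dist_norm norm_minus_commute[of x]
          add_diff_cancel_left')
    have est: "norm (?D (x + (a *\<^sub>R t *\<^sub>R v + \<rho> *\<^sub>R t *\<^sub>R w)) - ?D x - L (a *\<^sub>R t *\<^sub>R v + \<rho> *\<^sub>R t *\<^sub>R
        w)) \<le> C * (t * N)^2"
      if "a \<in> {0..1}" "\<rho> \<in> {0..1}" for a \<rho>
    proof -
      have "C * norm (a *\<^sub>R t *\<^sub>R v + \<rho> *\<^sub>R t *\<^sub>R w) ^ 2 \<le> C * (t * N)^2"
        using nrm[OF that] C(1) by (intro mult_left_mono power_mono) auto
      then show ?thesis using C(2)[OF mem[OF that]] by simp
    qed
    \<comment> \<open>Difference of the values of \<open>f\<close> along two parallel segments, with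
      the expected second order term removed. Its derivative is \<open>t\<close> times the
      difference of two Taylor remainders of \<open>?D\<close>, each at most
      \<open>C * (t * N)^2\<close>; hence the constant \<open>2 * C * N^2\<close>.\<close>
    define g where "g \<rho> = f (x + (1 *\<^sub>R t *\<^sub>R v + \<rho> *\<^sub>R t *\<^sub>R w)) - f (x + (0 *\<^sub>R t *\<^sub>R v + \<rho> *\<^sub>R t *\<^sub>R
        w)) - \<rho> *\<^sub>R t^2 *\<^sub>R L v" for \<rho>
    define g' where "g' \<rho> = t *\<^sub>R (?D (x + (1 *\<^sub>R t *\<^sub>R v + \<rho> *\<^sub>R t *\<^sub>R w)) - ?D (x + (0 *\<^sub>R t *\<^sub>R v + \<rho>
        *\<^sub>R t *\<^sub>R w)) - t *\<^sub>R L v)" for \<rho>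
    have "norm (g 1 - g 0) \<le> (2 * C * N^2 * t^3) * norm (1 - 0 :: real)"
    proof (rule differentiable_bound[of "{0..1}" g "\<lambda>\<rho> s. s *\<^sub>R g' \<rho>"])
      fix \<rho> :: real assume \<rho>: "\<rho> \<in> {0..1}"
      have fd: "((\<lambda>\<rho>. f (x + (a *\<^sub>R t *\<^sub>R v + \<rho> *\<^sub>R t *\<^sub>R w))) has_derivative
          (\<lambda>s. s *\<^sub>R t *\<^sub>R ?D (x + (a *\<^sub>R t *\<^sub>R v + \<rho> *\<^sub>R t *\<^sub>R w)))) (at \<rho> within {0..1})"
        if "a \<in> {0..1}" for a
      proof -
        have "x + (a *\<^sub>R t *\<^sub>R v + \<rho> *\<^sub>R t *\<^sub>R w) \<in> S" using mem[OF that \<rho>] \<epsilon>(2) by blast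
        note d = smooth_on_has_derivative[OF f this] and l = smooth_on_linear[OF f this]
        have "((\<lambda>\<rho>. f (x + (a *\<^sub>R t *\<^sub>R v + \<rho> *\<^sub>R t *\<^sub>R w))) has_derivative
          (\<lambda>s. frechet_derivative f (at (x + (a *\<^sub>R t *\<^sub>R v + \<rho> *\<^sub>R t *\<^sub>R w))) (s *\<^sub>R t *\<^sub>R w))) (at \<rho>
              within {0..1})"
          by (rule has_derivative_compose[where f = "\<lambda>\<rho>. x + (a *\<^sub>R t *\<^sub>R v + \<rho> *\<^sub>R t *\<^sub>R w)" and x = \<rho>,
              OF _ d]) (auto intro!: derivative_eq_intros)
        then show ?thesis by (simp only: linear_cmul[OF l])
      qed
      show "(g has_derivative (\<lambda>s. s *\<^sub>R g' \<rho>)) (at \<rho> within {0..1})"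
        unfolding g_def g'_def
        by (rule has_derivative_eq_rhs, rule has_derivative_diff[OF has_derivative_diff[OF fd fd]])
          (auto intro!: derivative_eq_intros simp: fun_eq_iff algebra_simps power2_eq_square)
      have "norm (?D (x + (1 *\<^sub>R t *\<^sub>R v + \<rho> *\<^sub>R t *\<^sub>R w)) - ?D (x + (0 *\<^sub>R t *\<^sub>R v + \<rho> *\<^sub>R t *\<^sub>R w)) -
          t *\<^sub>R L v) \<le>
          C * (t * N)^2 + C * (t * N)^2"
        by (rule order_trans[OF _ order_trans[OF norm_triangle_ineq4 add_mono[OF est[of 1 \<rho>] est[of 0 \<rho>]]]])
          (use \<rho> in \<open>auto simp: linear_add[OF L] linear_cmul[OF L] algebra_simps\<close>)
      then have "norm (g' \<rho>) \<le> t * (C * (t * N)^2 + C * (t * N)^2)"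
        unfolding g'_def using t by (simp add: mult_left_mono)
      then have *: "norm (g' \<rho>) \<le> 2 * C * N^2 * t^3"
        by (simp add: power2_eq_square power3_eq_cube algebra_simps)
      show "onorm (\<lambda>s. s *\<^sub>R g' \<rho>) \<le> 2 * C * N^2 * t^3"
        by (rule onorm_bound) (use * C(1) t(1) in \<open>auto simp: mult.commute[of "\<bar>_\<bar>"] intro!: mult_right_mono\<close>)
    qed auto
    then show "norm (f (x + t *\<^sub>R v + t *\<^sub>R w) - f (x + t *\<^sub>R v) - f (x + t *\<^sub>R w) + f x
      - t^2 *\<^sub>R frechet_derivative ?D (at x) v) \<le> 2 * C * N^2 * t^3"
      by (simp add: g_def L_def[symmetric] algebra_simps)
  qed
qed

lemma smooth_on_deriv2_symmetric:
  fixes f :: "'a::euclidean_space \<Rightarrow> 'b::real_normed_vector"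
  assumes f: "smooth_on S f" and S: "open S" and x: "x \<in> S"
  shows "frechet_derivative (\<lambda>z. frechet_derivative f (at z) v) (at x) w =
         frechet_derivative (\<lambda>z. frechet_derivative f (at z) w) (at x) v" (is "?A = ?B")
proof (rule ccontr)
  assume neq: "?A \<noteq> ?B"
  obtain C1 r1 where 1: "r1 > 0" "\<And>t. 0 < t \<Longrightarrow> t < r1 \<Longrightarrow>
    norm (f (x + t *\<^sub>R v + t *\<^sub>R w) - f (x + t *\<^sub>R v) - f (x + t *\<^sub>R w) + f x - t^2 *\<^sub>R ?B) \<le> C1 * t^3"
    by (rule smooth_on_second_difference[OF f S x, of v w]) (rule that; assumption)
  obtain C2 r2 where 2: "r2 > 0" "\<And>t. 0 < t \<Longrightarrow> t < r2 \<Longrightarrow>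
    norm (f (x + t *\<^sub>R w + t *\<^sub>R v) - f (x + t *\<^sub>R w) - f (x + t *\<^sub>R v) + f x - t^2 *\<^sub>R ?A) \<le> C2 * t^3"
    by (rule smooth_on_second_difference[OF f S x, of w v]) (rule that; assumption)
  define a where "a = norm (?A - ?B)"
  have a: "a > 0" using neq by (simp add: a_def)
  have le: "a \<le> (C1 + C2) * t" if t: "0 < t" "t < r1" "t < r2" for t
  proof -
    have gen: "a - b = (P - q - r + F - b) - (P - r - q + F - a)" for P q r F a b :: 'b by simp
    have eq: "x + t *\<^sub>R w + t *\<^sub>R v = x + t *\<^sub>R v + t *\<^sub>R w" by (simp add: add_ac)
    have "t^2 * a = norm (t^2 *\<^sub>R ?A - t^2 *\<^sub>R ?B)" by (simp add: a_def scaleR_diff_right[symmetric])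
    also have "\<dots> \<le> C1 * t^3 + C2 * t^3"
      unfolding gen[of "t^2 *\<^sub>R ?A" "t^2 *\<^sub>R ?B" "f (x + t *\<^sub>R v + t *\<^sub>R w)" "f (x + t *\<^sub>R v)" "f (x + t
          *\<^sub>R w)" "f x"]
      by (rule order_trans[OF norm_triangle_ineq4 add_mono[OF 1(2)[OF t(1,2)] 2(2)[OF t(1,3), unfolded eq]]])
    also have "\<dots> = t^2 * ((C1 + C2) * t)" by (simp add: algebra_simps power2_eq_square power3_eq_cube)
    finally show ?thesis using t by simp
  qed
  define M where "M = \<bar>C1 + C2\<bar> + 1"
  have M: "M > 0" "C1 + C2 \<le> M" by (auto simp: M_def)
  \<comment> \<open>Small enough for both expansions and for \<open>(C1 + C2) * t\<close> to be at
    most \<open>a / 2\<close>, which contradicts \<open>a \<le> (C1 + C2) * t\<close>.\<close>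
  define t where "t = min (min (r1/2) (r2/2)) (a / (2 * M))"
  have t: "0 < t" "t < r1" "t < r2" using 1(1) 2(1) a M by (auto simp: t_def)
  have "(C1 + C2) * t \<le> M * t" using t M by (intro mult_right_mono) auto
  also have "\<dots> \<le> M * (a / (2 * M))"
    using M by (intro mult_left_mono) (auto simp: t_def)
  also have "\<dots> = a / 2" using M by simp
  finally show False using le[OF t] a by simp
qed

text \<open>Bridges two styles of estimate: a bound on compact convex sets becomes a bound along the
  product filter, with base point and end point both free to move near \<open>z0\<close>. A closed
  ball inside \<open>S\<close> is the compact convex set.\<close>

lemma dominated_nhds_pair:
  fixes f :: "'a::euclidean_space \<Rightarrow> 'a \<Rightarrow> 'b::real_normed_vector"
  assumes S: "open S" "z0 \<in> S"
    and "\<And>K. compact K \<Longrightarrow> convex K \<Longrightarrow> K \<subseteq> S \<Longrightarrow> \<exists>C. \<forall>x\<in>K. \<forall>y\<in>K. norm (f x y) \<le> C * q x y"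
  shows "dominated (nhds z0 \<times>\<^sub>F nhds z0) (\<lambda>p. f (fst p) (snd p)) (\<lambda>p. q (fst p) (snd p))"
proof -
  obtain r where r: "r > 0" "cball z0 r \<subseteq> S" using S open_contains_cball by blast
  then obtain C where C: "\<forall>x\<in>cball z0 r. \<forall>y\<in>cball z0 r. norm (f x y) \<le> C * q x y"
    using assms(3)[of "cball z0 r"] by auto
  have "norm (f x y) \<le> \<bar>C\<bar> * \<bar>q x y\<bar>" if "x \<in> cball z0 r" "y \<in> cball z0 r" for x y
  proof -
    have "norm (f x y) \<le> C * q x y" using C that by blast
    also have "\<dots> \<le> \<bar>C\<bar> * \<bar>q x y\<bar>" by (metis abs_ge_self abs_mult)
    finally show ?thesis .
  qed
  then have "\<forall>\<^sub>F p in nhds z0 \<times>\<^sub>F nhds z0. norm (f (fst p) (snd p)) \<le> \<bar>C\<bar> * \<bar>q (fst p) (snd p)\<bar>"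
    using r by (intro eventually_nhds_pair_cball) auto
  then show ?thesis by (rule dominatedI)
qed

lemma dominated_lipschitz:
  fixes f :: "'a::euclidean_space \<Rightarrow> 'b::real_normed_vector"
  assumes f: "smooth_on S f" and S: "open S" "z0 \<in> S"
  shows "dominated (nhds z0 \<times>\<^sub>F nhds z0) (\<lambda>p. f (snd p) - f (fst p)) (\<lambda>p. norm (snd p - fst p))"
  by (rule dominated_nhds_pair[OF S, where f = "\<lambda>x y. f y - f x"]) (use smooth_on_lipschitz[OF f] in metis)

lemma dominated_taylor2:
  fixes f :: "'a::euclidean_space \<Rightarrow> 'b::real_normed_vector"
  assumes f: "smooth_on S f" and S: "open S" "z0 \<in> S"
  shows "dominated (nhds z0 \<times>\<^sub>F nhds z0) (\<lambda>p. f (snd p) - f (fst p) - frechet_derivative f (at (fst p))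
      (snd p - fst p))
    (\<lambda>p. norm (snd p - fst p) ^ 2)"
  by (rule dominated_nhds_pair[OF S, where f = "\<lambda>x y. f y - f x - frechet_derivative f (at x) (y - x)"])
    (use smooth_on_taylor2[OF f] in metis)

lemma dominated_taylor3:
  fixes f :: "'a::euclidean_space \<Rightarrow> 'b::real_normed_vector"
  assumes f: "smooth_on S f" and S: "open S" "z0 \<in> S"
  shows "dominated (nhds z0 \<times>\<^sub>F nhds z0) (\<lambda>p. f (snd p) - f (fst p) - frechet_derivative f (at (fst p))
      (snd p - fst p)
      - (1/2) *\<^sub>R frechet_derivative (\<lambda>z. frechet_derivative f (at z) (snd p - fst p)) (at (fst p)) (snd
          p - fst p))
    (\<lambda>p. norm (snd p - fst p) ^ 3)"
  by (rule dominated_nhds_pair[OF S, where f = "\<lambda>x y. f y - f x - frechet_derivative f (at x) (y - x)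
      - (1/2) *\<^sub>R frechet_derivative (\<lambda>z. frechet_derivative f (at z) (y - x)) (at x) (y - x)"])
    (use smooth_on_taylor3[OF f S(1)] in metis)

section \<open>The sewing lemma\<close>

lemma control_nonneg: "control T \<omega> \<Longrightarrow> 0 \<le> s \<Longrightarrow> s \<le> t \<Longrightarrow> t \<le> T \<Longrightarrow> 0 \<le> \<omega> s t"
  by (simp add: control_def)

lemma control_diag: "control T \<omega> \<Longrightarrow> 0 \<le> s \<Longrightarrow> s \<le> T \<Longrightarrow> \<omega> s s = 0"
  by (simp add: control_def)

lemma control_add: "control T \<omega> \<Longrightarrow> 0 \<le> s \<Longrightarrow> s \<le> r \<Longrightarrow> r \<le> t \<Longrightarrow> t \<le> T \<Longrightarrow> \<omega> s r + \<omega> r t \<le> \<omega> s t"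
  unfolding control_def by blast

lemma control_mono:
  assumes "control T \<omega>" "0 \<le> s" "s \<le> s'" "s' \<le> t'" "t' \<le> t" "t \<le> T"
  shows "\<omega> s' t' \<le> \<omega> s t"
  using control_add[OF assms(1), of s s' t] control_add[OF assms(1), of s' t' t]
    control_nonneg[OF assms(1), of s s'] control_nonneg[OF assms(1), of t' t] assms by linarith

text \<open>Uniform continuity on the compact triangle, applied to \<open>(s, t)\<close> and the
  diagonal point \<open>(s, s)\<close>, where the control vanishes.\<close>

lemma control_small:
  assumes c: "control T \<omega>" and e: "e > 0"
  obtains d where "d > 0" "\<And>s t. 0 \<le> s \<Longrightarrow> s \<le> t \<Longrightarrow> t \<le> T \<Longrightarrow> t - s \<le> d \<Longrightarrow> \<omega> s t \<le> e"
proof -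
  let ?S = "{(s::real, t). 0 \<le> s \<and> s \<le> t \<and> t \<le> T}"
  have cont: "continuous_on ?S (\<lambda>(s, t). \<omega> s t)" using c by (simp add: control_def)
  have eq: "?S = ({0..T} \<times> {0..T}) \<inter> {p. fst p \<le> snd p}" by auto
  have "compact ?S" unfolding eq
    by (intro compact_Int_closed compact_Times compact_Icc closed_Collect_le continuous_intros)
  with cont have "uniformly_continuous_on ?S (\<lambda>(s, t). \<omega> s t)" by (rule compact_uniformly_continuous)
  then obtain d where d: "d > 0" "\<And>p q. p \<in> ?S \<Longrightarrow> q \<in> ?S \<Longrightarrow> dist q p < d \<Longrightarrow>
      dist ((\<lambda>(s, t). \<omega> s t) q) ((\<lambda>(s, t). \<omega> s t) p) < e"
    unfolding uniformly_continuous_on_def using e by meson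
  show ?thesis
  proof (rule that[of "d/2"])
    fix s t assume st: "0 \<le> s" "s \<le> t" "t \<le> T" "t - s \<le> d / 2"
    have "dist (s, t) (s, s) < d" using st d(1) by (simp add: dist_Pair_Pair dist_real_def)
    from d(2)[OF _ _ this] st control_diag[OF c, of s] show "\<omega> s t \<le> e" by (auto simp: dist_real_def)
  qed (use d in auto)
qed

section \<open>Dyadic grids and power sums of a control\<close>

lemma control_sum_le:
  assumes c: "control T \<omega>" and \<tau>: "\<And>k. \<tau> k \<le> \<tau> (Suc k)" "\<And>k. 0 \<le> \<tau> k" "\<And>k. \<tau> k \<le> T"
  shows "i \<le> j \<Longrightarrow> (\<Sum>k\<in>{i..<j}. \<omega> (\<tau> k) (\<tau> (Suc k))) \<le> \<omega> (\<tau> i) (\<tau> j)"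
proof (induction j rule: dec_induct)
  case base show ?case using control_diag[OF c] \<tau> by simp
next
  case (step j)
  have "\<tau> i \<le> \<tau> j" using lift_Suc_mono_le[of \<tau>] \<tau>(1) step by blast
  then show ?case using step control_add[OF c, of "\<tau> i" "\<tau> j" "\<tau> (Suc j)"] \<tau> by simp
qed

text \<open>One dyadic grid of \<open>[0, T]\<close> serves all intervals: its points are clamped
  into \<open>[s, t]\<close>, which makes the cells outside degenerate. Grids of adjacent intervals
  are thus cut from the same grid, so that their sums can be compared cell by cell.\<close>

definition grid :: "real \<Rightarrow> nat \<Rightarrow> real \<Rightarrow> real \<Rightarrow> nat \<Rightarrow> real" where
  "grid T n s t k = max s (min t (real k * T / 2 ^ n))"

lemma grid_simps:
  assumes "0 \<le> s" "s \<le> t" "t \<le> T"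
  shows "grid T n s t 0 = s" "grid T n s t (2 ^ n) = t"
    "s \<le> grid T n s t k" "grid T n s t k \<le> t" "0 \<le> grid T n s t k" "grid T n s t k \<le> T"
    "grid T n s t k \<le> grid T n s t (Suc k)" "grid T n s t (Suc k) - grid T n s t k \<le> T / 2 ^ n"
    "grid T (n + m) s t (k * 2 ^ m) = grid T n s t k"
proof -
  have T: "0 \<le> T" using assms by linarith
  have 1: "real k * T / 2 ^ n \<le> real (Suc k) * T / 2 ^ n"
    using T by (intro divide_right_mono mult_right_mono) auto
  have 2: "real (Suc k) * T / 2 ^ n - real k * T / 2 ^ n = T / 2 ^ n"
    by (simp add: diff_divide_distrib[symmetric] algebra_simps)
  show "grid T n s t k \<le> grid T n s t (Suc k)" using 1 unfolding grid_def by linarith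
  show "grid T n s t (Suc k) - grid T n s t k \<le> T / 2 ^ n" using 1 2 unfolding grid_def by linarith
  have "real (k * 2 ^ m) * T / 2 ^ (n + m) = real k * T / 2 ^ n" by (simp add: power_add)
  then show "grid T (n + m) s t (k * 2 ^ m) = grid T n s t k" by (simp add: grid_def)
qed (use assms in \<open>auto simp: grid_def\<close>)

text \<open>On a fine grid \<open>\<omega>\<close> is small on every cell, so the factor with
  exponent \<open>\<theta> - 1\<close> can be pulled out; superadditivity bounds the remaining sum
  by \<open>\<omega> 0 T\<close>.\<close>

lemma grid_power_sum_small:
  assumes c: "control T \<omega>" and T: "0 \<le> T" and \<theta>: "\<theta> > 1" and e: "e > 0"
  obtains N where "\<And>n s t. n \<ge> N \<Longrightarrow> 0 \<le> s \<Longrightarrow> s \<le> t \<Longrightarrow> t \<le> T \<Longrightarrow>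
    (\<Sum>k<2^n. \<omega> (grid T n s t k) (grid T n s t (Suc k)) powr \<theta>) \<le> e"
proof -
  define W where "W = \<omega> 0 T + 1"
  have W: "W > 0" using control_nonneg[OF c, of 0 T] T by (simp add: W_def)
  \<comment> \<open>Chosen so that \<open>\<epsilon> powr (\<theta> - 1) = e / W\<close>; the
    summand 1 in \<open>W\<close> keeps the divisor positive even if the control vanishes.\<close>
  define \<epsilon> where "\<epsilon> = (e / W) powr (1 / (\<theta> - 1))"
  have \<epsilon>: "\<epsilon> > 0" "\<epsilon> powr (\<theta> - 1) = e / W" using e W \<theta> by (simp_all add: \<epsilon>_def powr_powr)
  obtain d where d: "d > 0" "\<And>s t. 0 \<le> s \<Longrightarrow> s \<le> t \<Longrightarrow> t \<le> T \<Longrightarrow> t - s \<le> d \<Longrightarrow> \<omega> s t \<le> \<epsilon>"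
    using control_small[OF c \<epsilon>(1)] by blast
  obtain N where N: "T / d < 2 ^ N" using real_arch_pow[of 2 "T / d"] by auto
  show ?thesis
  proof (rule that[of N])
    fix n s t assume n: "n \<ge> N" and st: "0 \<le> s" "s \<le> t" "t \<le> T"
    let ?g = "grid T n s t"
    note g = grid_simps[OF st, of n]
    have "(2::real) ^ N \<le> 2 ^ n" using n by (intro power_increasing) auto
    then have "T / d < 2 ^ n" using N by linarith
    then have "T / 2 ^ n \<le> d" using d(1) by (simp add: field_simps)
    then have small: "\<omega> (?g k) (?g (Suc k)) \<le> \<epsilon>" for k
      using g(3-8)[of k] g(3-6)[of "Suc k"] by (intro d(2)) auto
    have nn: "0 \<le> \<omega> (?g k) (?g (Suc k))" for k using g(5-7)[of k] g(6)[of "Suc k"] by (intro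
        control_nonneg[OF c]) auto
    have "(\<Sum>k<2^n. \<omega> (?g k) (?g (Suc k)) powr \<theta>) \<le> (\<Sum>k<2^n. (e / W) * \<omega> (?g k) (?g (Suc k)))"
    proof (rule sum_mono)
      fix k
      have "\<omega> (?g k) (?g (Suc k)) powr \<theta> = \<omega> (?g k) (?g (Suc k)) powr (\<theta> - 1) * \<omega> (?g k) (?g (Suc k)) powr 1"
        by (simp only: powr_add[symmetric]) simp
      also have "\<dots> = \<omega> (?g k) (?g (Suc k)) powr (\<theta> - 1) * \<omega> (?g k) (?g (Suc k))" using nn[of k] by simp
      also have "\<dots> \<le> \<epsilon> powr (\<theta> - 1) * \<omega> (?g k) (?g (Suc k))"
        using nn[of k] small[of k] \<theta> by (intro mult_right_mono powr_mono2) auto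
      finally show "\<omega> (?g k) (?g (Suc k)) powr \<theta> \<le> (e / W) * \<omega> (?g k) (?g (Suc k))" using \<epsilon> by simp
    qed
    also have "\<dots> = (e / W) * (\<Sum>k\<in>{0..<2^n}. \<omega> (?g k) (?g (Suc k)))"
      by (simp add: sum_distrib_left lessThan_atLeast0)
    also have "\<dots> \<le> (e / W) * \<omega> 0 T"
    proof -
      have "(\<Sum>k\<in>{0..<2^n}. \<omega> (?g k) (?g (Suc k))) \<le> \<omega> (?g 0) (?g (2^n))"
        by (rule control_sum_le[OF c]) (use g in auto)
      also have "\<dots> \<le> \<omega> 0 T" using control_mono[OF c, of 0 s t T] st g by simp
      finally show ?thesis using e W by (intro mult_left_mono) auto
    qed
    also have "\<dots> \<le> (e / W) * W" using e W by (intro mult_left_mono) (auto simp: W_def)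
    also have "\<dots> = e" using W by simp
    finally show "(\<Sum>k<2^n. \<omega> (?g k) (?g (Suc k)) powr \<theta>) \<le> e" .
  qed
qed

section \<open>Sewing an almost additive germ\<close>

locale almost_additive =
  fixes T \<theta> C \<delta> :: real and \<omega> :: "real \<Rightarrow> real \<Rightarrow> real" and \<Xi> :: "real \<Rightarrow> real \<Rightarrow> 'v::banach"
  assumes control: "control T \<omega>" and T: "0 \<le> T" and theta: "1 < \<theta>" and C: "0 \<le> C" and delta: "0 < \<delta>"
    and defect: "\<And>s r t. 0 \<le> s \<Longrightarrow> s \<le> r \<Longrightarrow> r \<le> t \<Longrightarrow> t \<le> T \<Longrightarrow> t - s \<le> \<delta> \<Longrightarrow>
      norm (\<Xi> s t - \<Xi> s r - \<Xi> r t) \<le> C * \<omega> s t powr \<theta>"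
begin

text \<open>The defect of the degenerate triple \<open>s, s, s\<close> is
  \<open>- \<Xi> s s\<close>, and the control is 0 there.\<close>

lemma diag: "0 \<le> s \<Longrightarrow> s \<le> T \<Longrightarrow> \<Xi> s s = 0"
  using defect[of s s s] control_diag[OF control, of s] delta by simp

text \<open>The constant for which the recursion in the bound for partition sums closes.\<close>

definition "K = 2 * C / (1 - 2 powr (1 - \<theta>))"

lemma two_powr_less_one: "2 powr (1 - \<theta>) < (1::real)"
  using powr_less_mono[of "1 - \<theta>" 0 2] theta by simp

lemma K_nonneg: "0 \<le> K"
  using two_powr_less_one C by (simp add: K_def)

text \<open>The two outer pieces of a partition carry at most half of the control each and
  contribute \<open>2 * K * (1/2) powr \<theta>\<close>; the two cuts at the ends of the middle cell
  contribute \<open>2 * C\<close>. \<open>K\<close> is the fixed point of this recursion, a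
  nonnegative number because \<open>\<theta> > 1\<close>.\<close>

lemma K_recursion: "2 * K * (1/2) powr \<theta> + 2 * C = K"
proof -
  have "2 * (1/2) powr \<theta> = (2::real) powr (1 - \<theta>)" by (simp add: powr_diff powr_divide)
  then have "2 * K * (1/2) powr \<theta> = K * 2 powr (1 - \<theta>)" by (simp add: mult_ac)
  moreover have "K * (1 - 2 powr (1 - \<theta>)) = 2 * C" using two_powr_less_one theta by (simp add: K_def)
  ultimately have "2 * K * (1/2) powr \<theta> + 2 * C = K * 2 powr (1 - \<theta>) + K * (1 - 2 powr (1 - \<theta>))" by
      (simp only:)
  also have "\<dots> = K" by (simp add: right_diff_distrib)
  finally show ?thesis .
qed

text \<open>The partition is cut at the cell that contains the point where \<open>\<omega>(\<tau>\<^sub>i, \<cdot>)\<close> passes half of its final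
  value, so that both remaining pieces carry at most half of the control.\<close>

lemma partition_sum_bound:
  assumes \<tau>: "\<And>k. \<tau> k \<le> \<tau> (Suc k)" "\<And>k. 0 \<le> \<tau> k" "\<And>k. \<tau> k \<le> T"
  shows "i \<le> j \<Longrightarrow> \<tau> j - \<tau> i \<le> \<delta> \<Longrightarrow>
    norm ((\<Sum>k\<in>{i..<j}. \<Xi> (\<tau> k) (\<tau> (Suc k))) - \<Xi> (\<tau> i) (\<tau> j)) \<le> K * \<omega> (\<tau> i) (\<tau> j) powr \<theta>"
proof (induction "j - i" arbitrary: i j rule: less_induct)
  case less
  have mono: "a \<le> b \<Longrightarrow> \<tau> a \<le> \<tau> b" for a b using lift_Suc_mono_le[of \<tau>] \<tau>(1) by blast
  let ?S = "\<lambda>i j. \<Sum>k\<in>{i..<j}. \<Xi> (\<tau> k) (\<tau> (Suc k))"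
  let ?w = "\<lambda>i j. \<omega> (\<tau> i) (\<tau> j)"
  have wnn: "0 \<le> ?w a b" if "a \<le> b" for a b using control_nonneg[OF control] \<tau> mono that by blast
  show ?case
  proof (cases "i = j")
    case True then show ?thesis using diag \<tau> K_nonneg by simp
  next
    case False
    define M where "M = {k. i \<le> k \<and> k < j \<and> ?w i k \<le> ?w i j / 2}"
    have fin: "finite M" by (rule finite_subset[of _ "{i..<j}"]) (auto simp: M_def)
    have iM: "i \<in> M" using False less.prems wnn[of i j] control_diag[OF control] \<tau> by (simp add: M_def)
    define k where "k = Max M"
    have kM: "k \<in> M" using Max_in[OF fin] iM unfolding k_def by blast
    then have k: "i \<le> k" "k < j" "?w i k \<le> ?w i j / 2" by (auto simp: M_def)
    \<comment> \<open>By maximality of \<open>k\<close> the control from \<open>\<tau> i\<close> to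
      \<open>\<tau> (Suc k)\<close> exceeds half of the total, so superadditivity leaves at most
      half beyond it. If \<open>Suc k = j\<close>, the right piece is degenerate.\<close>
    have right: "?w (Suc k) j \<le> ?w i j / 2"
    proof (cases "Suc k = j")
      case True
      then show ?thesis using control_diag[OF control] \<tau> wnn[of i j] less.prems by simp
    next
      case False
      have "Suc k \<notin> M" using Max_ge[OF fin, of "Suc k"] unfolding k_def by fastforce
      then have "?w i (Suc k) > ?w i j / 2" using k False by (auto simp: M_def)
      moreover have "?w i (Suc k) + ?w (Suc k) j \<le> ?w i j"
        by (rule control_add[OF control]) (use \<tau> mono k in auto)
      ultimately show ?thesis by linarith
    qed
    have half: "K * ?w a b powr \<theta> \<le> K * ((1/2) powr \<theta> * ?w i j powr \<theta>)" if "a \<le> b" "?w a b \<le> ?w i j / 2"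
        for a b
    proof -
      have "?w a b powr \<theta> \<le> (1/2 * ?w i j) powr \<theta>" using that wnn theta by (intro powr_mono2) auto
      also have "\<dots> = (1/2) powr \<theta> * ?w i j powr \<theta>" by (rule powr_mult)
      finally show ?thesis using K_nonneg by (intro mult_left_mono)
    qed
    have len: "\<tau> b - \<tau> a \<le> \<delta>" if "i \<le> a" "a \<le> b" "b \<le> j" for a b
      using mono[OF that(1)] mono[OF that(3)] less.prems by linarith
    have 1: "norm (?S i k - \<Xi> (\<tau> i) (\<tau> k)) \<le> K * ((1/2) powr \<theta> * ?w i j powr \<theta>)"
      by (rule order_trans[OF less.hyps half]) (use k len in auto)
    have 2: "norm (?S (Suc k) j - \<Xi> (\<tau> (Suc k)) (\<tau> j)) \<le> K * ((1/2) powr \<theta> * ?w i j powr \<theta>)"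
      by (rule order_trans[OF less.hyps half]) (use k len right in auto)
    have 3: "norm (\<Xi> (\<tau> i) (\<tau> j) - \<Xi> (\<tau> i) (\<tau> k) - \<Xi> (\<tau> k) (\<tau> j)) \<le> C * ?w i j powr \<theta>"
      by (rule defect) (use \<tau> mono k len in auto)
    have "norm (\<Xi> (\<tau> k) (\<tau> j) - \<Xi> (\<tau> k) (\<tau> (Suc k)) - \<Xi> (\<tau> (Suc k)) (\<tau> j)) \<le> C * ?w k j powr \<theta>"
      by (rule defect) (use \<tau> mono k len in auto)
    also have "\<dots> \<le> C * ?w i j powr \<theta>"
      using C theta k less.prems wnn[of k j]
      by (intro mult_left_mono powr_mono2 control_mono[OF control]) (auto simp: \<tau> mono)
    finally have 4: "norm (\<Xi> (\<tau> k) (\<tau> j) - \<Xi> (\<tau> k) (\<tau> (Suc k)) - \<Xi> (\<tau> (Suc k)) (\<tau> j)) \<le> C * ?w i j powr \<theta>" .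
    have "?S i j = ?S i k + ?S k j" using k by (simp add: sum.atLeastLessThan_concat)
    also have "?S k j = \<Xi> (\<tau> k) (\<tau> (Suc k)) + ?S (Suc k) j" using k by (simp add: sum.atLeast_Suc_lessThan)
    finally have eq: "?S i j - \<Xi> (\<tau> i) (\<tau> j) =
      ((?S i k - \<Xi> (\<tau> i) (\<tau> k)) + (?S (Suc k) j - \<Xi> (\<tau> (Suc k)) (\<tau> j))) +
      (- (\<Xi> (\<tau> i) (\<tau> j) - \<Xi> (\<tau> i) (\<tau> k) - \<Xi> (\<tau> k) (\<tau> j)) +
       - (\<Xi> (\<tau> k) (\<tau> j) - \<Xi> (\<tau> k) (\<tau> (Suc k)) - \<Xi> (\<tau> (Suc k)) (\<tau> j)))" by simp
    have "norm (?S i j - \<Xi> (\<tau> i) (\<tau> j)) \<le> (K * ((1/2) powr \<theta> * ?w i j powr \<theta>) + K * ((1/2) powr \<theta> * ?w i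
        j powr \<theta>)) +
        (C * ?w i j powr \<theta> + C * ?w i j powr \<theta>)"
      unfolding eq by (intro norm_triangle_mono 1 2) (use 3 4 in \<open>simp_all only: norm_minus_cancel\<close>)
    also have "\<dots> = (2 * K * (1/2) powr \<theta> + 2 * C) * ?w i j powr \<theta>" by (simp add: algebra_simps)
    finally show ?thesis by (simp only: K_recursion)
  qed
qed

definition J :: "nat \<Rightarrow> real \<Rightarrow> real \<Rightarrow> 'v" where
  "J n s t = (\<Sum>k<2^n. \<Xi> (grid T n s t k) (grid T n s t (Suc k)))"

text \<open>A coarse cell is itself partitioned by \<open>2 ^ m\<close> fine cells, so the bound for
  partition sums applies inside each coarse cell. The result is independent of \<open>m\<close>, as
  the Cauchy property requires.\<close>

lemma J_refine:
  assumes st: "0 \<le> s" "s \<le> t" "t \<le> T" and n: "T / 2 ^ n \<le> \<delta>"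
  shows "norm (J (n + m) s t - J n s t) \<le> K * (\<Sum>k<2^n. \<omega> (grid T n s t k) (grid T n s t (Suc k)) powr \<theta>)"
proof -
  let ?g = "grid T (n + m) s t"
  note g = grid_simps[OF st]
  have "J (n + m) s t = (\<Sum>k<2^n. \<Sum>i\<in>{k*2^m..<k*2^m+2^m}. \<Xi> (?g i) (?g (Suc i)))"
    unfolding J_def power_add by (rule sum.nat_group[symmetric])
  then have eq: "J (n + m) s t - J n s t = (\<Sum>k<2^n. (\<Sum>i\<in>{k*2^m..<Suc k*2^m}. \<Xi> (?g i) (?g (Suc i)))
      - \<Xi> (?g (k*2^m)) (?g (Suc k*2^m)))"
    unfolding J_def g(9) sum_subtractf by (simp add: add.commute)
  have "norm (J (n + m) s t - J n s t) \<le> (\<Sum>k<2^n. K * \<omega> (?g (k*2^m)) (?g (Suc k*2^m)) powr \<theta>)"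
    unfolding eq
  proof (rule sum_norm_le)
    fix k
    show "norm ((\<Sum>i\<in>{k*2^m..<Suc k*2^m}. \<Xi> (?g i) (?g (Suc i))) - \<Xi> (?g (k*2^m)) (?g (Suc k*2^m)))
      \<le> K * \<omega> (?g (k*2^m)) (?g (Suc k*2^m)) powr \<theta>"
    proof (rule partition_sum_bound)
      show "?g (Suc k * 2 ^ m) - ?g (k * 2 ^ m) \<le> \<delta>" using g(8)[of n k] n unfolding g(9) by linarith
    qed (use g in auto)
  qed
  then show ?thesis unfolding g(9) by (simp add: sum_distrib_left)
qed

lemma mesh_eventually_small: "\<exists>N. \<forall>n\<ge>N. T / 2 ^ n \<le> \<delta>"
proof -
  obtain N where N: "T / \<delta> < 2 ^ N" using real_arch_pow[of 2 "T / \<delta>"] by auto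
  have "T / 2 ^ n \<le> \<delta>" if "n \<ge> N" for n
  proof -
    have "(2::real) ^ N \<le> 2 ^ n" using that by (intro power_increasing) auto
    then have "T / \<delta> < 2 ^ n" using N by linarith
    then show ?thesis using delta by (simp add: field_simps)
  qed
  then show ?thesis by blast
qed

lemma J_convergent:
  assumes st: "0 \<le> s" "s \<le> t" "t \<le> T"
  shows "convergent (\<lambda>n. J n s t)"
proof (rule Cauchy_convergent, rule metric_CauchyI)
  fix e :: real assume e: "e > 0"
  \<comment> \<open>The summand 1 keeps the divisor positive for \<open>K = 0\<close>. Each distance
    to level \<open>N\<close> must stay below \<open>e / 2\<close>, since two of them are
    added.\<close>
  define \<epsilon> where "\<epsilon> = e / (4 * (K + 1))"
  have \<epsilon>: "\<epsilon> > 0" "K * \<epsilon> < e / 2"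
  proof -
    show "\<epsilon> > 0" using e K_nonneg by (simp add: \<epsilon>_def)
    then have "K * \<epsilon> \<le> (K + 1) * \<epsilon>" by simp
    also have "\<dots> = e / 4" using K_nonneg by (simp add: \<epsilon>_def field_simps)
    finally show "K * \<epsilon> < e / 2" using e by simp
  qed
  obtain N1 where N1: "\<And>n s t. n \<ge> N1 \<Longrightarrow> 0 \<le> s \<Longrightarrow> s \<le> t \<Longrightarrow> t \<le> T \<Longrightarrow>
    (\<Sum>k<2^n. \<omega> (grid T n s t k) (grid T n s t (Suc k)) powr \<theta>) \<le> \<epsilon>"
    using grid_power_sum_small[OF control T theta \<epsilon>(1)] by blast
  obtain N2 where N2: "\<forall>n\<ge>N2. T / 2 ^ n \<le> \<delta>" using mesh_eventually_small by blast
  define N where "N = max N1 N2"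
  have close: "norm (J n s t - J N s t) < e / 2" if "n \<ge> N" for n
  proof -
    have "norm (J (N + (n - N)) s t - J N s t) \<le> K * \<epsilon>"
      by (rule order_trans[OF J_refine[OF st] mult_left_mono[OF N1]])
        (use N2 st K_nonneg in \<open>auto simp: N_def\<close>)
    then show ?thesis using that \<epsilon>(2) by simp
  qed
  show "\<exists>M. \<forall>m\<ge>M. \<forall>n\<ge>M. dist (J m s t) (J n s t) < e"
  proof (intro exI[of _ N] allI impI)
    fix m n assume "N \<le> m" "N \<le> n"
    then show "dist (J m s t) (J n s t) < e"
      using dist_triangle2[of "J m s t" "J n s t" "J N s t"] close[of m] close[of n]
      by (simp add: dist_norm)
  qed
qed

definition sewn :: "real \<Rightarrow> real \<Rightarrow> 'v" where
  "sewn s t = lim (\<lambda>n. J n s t)"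

lemma J_tendsto: "0 \<le> s \<Longrightarrow> s \<le> t \<Longrightarrow> t \<le> T \<Longrightarrow> (\<lambda>n. J n s t) \<longlonglongrightarrow> sewn s t"
  using J_convergent unfolding sewn_def convergent_LIMSEQ_iff by blast

text \<open>The bound for partition sums does not depend on the partition and so passes to the
  limit; the length restriction is the one under which the defect is controlled.\<close>

lemma sewn_bound:
  assumes st: "0 \<le> s" "s \<le> t" "t \<le> T" "t - s \<le> \<delta>"
  shows "norm (sewn s t - \<Xi> s t) \<le> K * \<omega> s t powr \<theta>"
proof (rule LIMSEQ_le_const2)
  show "(\<lambda>n. norm (J n s t - \<Xi> s t)) \<longlonglongrightarrow> norm (sewn s t - \<Xi> s t)"
    by (intro tendsto_intros J_tendsto st)
  note g = grid_simps[OF st(1-3)]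
  have "norm (J n s t - \<Xi> s t) \<le> K * \<omega> s t powr \<theta>" for n
    using partition_sum_bound[of "grid T n s t" 0 "2^n"] g st by (simp add: J_def lessThan_atLeast0)
  then show "\<exists>N. \<forall>n\<ge>N. norm (J n s t - \<Xi> s t) \<le> K * \<omega> s t powr \<theta>" by blast
qed

text \<open>The grids of \<open>[s, r]\<close> and \<open>[r, t]\<close> are the grid of
  \<open>[s, t]\<close> truncated at \<open>r\<close>. A cell on one side of \<open>r\<close> occurs
  in one of them and is degenerate in the other, so it cancels; a cell around \<open>r\<close>
  leaves a defect. The bound by the full power sum is generous but still tends to 0.\<close>

lemma sewn_add:
  assumes "0 \<le> s" "s \<le> r" "r \<le> t" "t \<le> T"
  shows "sewn s t = sewn s r + sewn r t"
proof -
  have lim: "(\<lambda>n. J n s t - J n s r - J n r t) \<longlonglongrightarrow> sewn s t - sewn s r - sewn r t"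
    by (intro tendsto_intros J_tendsto) (use assms in auto)
  obtain N2 where N2: "\<forall>n\<ge>N2. T / 2 ^ n \<le> \<delta>" using mesh_eventually_small by blast
  note g = grid_simps[of s t T]
  have bound: "norm (J n s t - J n s r - J n r t) \<le> C * (\<Sum>k<2^n. \<omega> (grid T n s t k) (grid T n s t (Suc
      k)) powr \<theta>)"
    if "n \<ge> N2" for n
  proof -
    let ?g = "grid T n"
    have eq: "J n s t - J n s r - J n r t = (\<Sum>k<2^n. \<Xi> (?g s t k) (?g s t (Suc k)) - \<Xi> (?g s r k) (?g s
        r (Suc k)) - \<Xi> (?g r t k) (?g r t (Suc k)))"
      by (simp add: J_def sum_subtractf)
    have "norm (J n s t - J n s r - J n r t) \<le> (\<Sum>k<2^n. C * \<omega> (?g s t k) (?g s t (Suc k)) powr \<theta>)"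
      unfolding eq
    proof (rule sum_norm_le)
      fix k
      have gk: "0 \<le> ?g s t k" "?g s t k \<le> ?g s t (Suc k)" "?g s t (Suc k) \<le> T" "?g s t (Suc k) - ?g s t k \<le> \<delta>"
        using g(5)[of n k] g(7)[of n k] g(6)[of n "Suc k"] g(8)[of n k] assms N2 that by (auto intro:
            order_trans)
      have s: "?g s r j = min (?g s t j) r" "?g r t j = max (?g s t j) r" for j
        using assms by (auto simp: grid_def)
      have r: "\<Xi> r r = 0" using diag assms by simp
      have nn: "0 \<le> C * \<omega> (?g s t k) (?g s t (Suc k)) powr \<theta>" using C by simp
      consider "?g s t (Suc k) \<le> r" | "r \<le> ?g s t k" | "?g s t k \<le> r" "r \<le> ?g s t (Suc k)" by linarith
      then show "norm (\<Xi> (?g s t k) (?g s t (Suc k)) - \<Xi> (?g s r k) (?g s r (Suc k)) - \<Xi> (?g r t k) (?g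
          r t (Suc k)))
        \<le> C * \<omega> (?g s t k) (?g s t (Suc k)) powr \<theta>"
      proof cases
        case 1 then show ?thesis using gk r nn unfolding s by (simp add: min_absorb1 max_absorb2)
      next
        case 2 then show ?thesis using gk r nn unfolding s by (simp add: min_absorb2 max_absorb1)
      next
        case 3 then show ?thesis using gk defect[OF gk(1) 3(1,2) gk(3,4)] unfolding s by (simp add:
            min_absorb1 min_absorb2 max_absorb1 max_absorb2)
      qed
    qed
    then show ?thesis by (simp add: sum_distrib_left)
  qed
  have "(\<lambda>n. J n s t - J n s r - J n r t) \<longlonglongrightarrow> 0"
  proof (rule metric_LIMSEQ_I)
    fix e :: real assume e: "e > 0"
    obtain N1 where N1: "\<And>n s t. n \<ge> N1 \<Longrightarrow> 0 \<le> s \<Longrightarrow> s \<le> t \<Longrightarrow> t \<le> T \<Longrightarrow>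
      (\<Sum>k<2^n. \<omega> (grid T n s t k) (grid T n s t (Suc k)) powr \<theta>) \<le> e / (2 * (C + 1))"
      using grid_power_sum_small[OF control T theta, of "e / (2 * (C + 1))"] e C by fastforce
    have Ce: "C * (e / (2 * (C + 1))) < e" 
    proof -
      have "C * (e / (2 * (C + 1))) \<le> (C + 1) * (e / (2 * (C + 1)))" using e C by (intro mult_right_mono) auto
      also have "\<dots> = e / 2" using C by (simp add: divide_simps add_nonneg_eq_0_iff)
      finally show ?thesis using e by linarith
    qed
    show "\<exists>N. \<forall>n\<ge>N. dist (J n s t - J n s r - J n r t) 0 < e"
    proof (intro exI[of _ "max N1 N2"] allI impI)
      fix n assume n: "max N1 N2 \<le> n"
      have "norm (J n s t - J n s r - J n r t) \<le> C * (e / (2 * (C + 1)))"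
        by (rule order_trans[OF bound mult_left_mono[OF N1]]) (use n assms C in auto)
      then show "dist (J n s t - J n s r - J n r t) 0 < e" using Ce by simp
    qed
  qed
  from LIMSEQ_unique[OF lim this] show ?thesis by (simp add: algebra_simps)
qed

end

text \<open>Telescoping over a grid bounds the increment by a power sum with exponent above 1, which
  can be made arbitrarily small. Applied to the difference of two candidates, this gives uniqueness
  of the integral.\<close>

lemma control_increment_constant:
  fixes z :: "real \<Rightarrow> 'v::real_normed_vector"
  assumes c: "control T \<omega>" and \<theta>: "1 < \<theta>" and \<delta>: "0 < \<delta>"
    and z: "\<And>s t. 0 \<le> s \<Longrightarrow> s \<le> t \<Longrightarrow> t \<le> T \<Longrightarrow> t - s \<le> \<delta> \<Longrightarrow> norm (z t - z s) \<le> C * \<omega> s t powr \<theta>"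
    and t: "0 \<le> t" "t \<le> T"
  shows "z t = z 0"
proof (rule ccontr)
  assume neq: "z t \<noteq> z 0"
  define e where "e = norm (z t - z 0)"
  have e: "e > 0" using neq by (simp add: e_def)
  define D where "D = \<bar>C\<bar> + 1"
  have D: "D > 0" "C \<le> D" by (auto simp: D_def)
  have T: "0 \<le> T" using t by linarith
  obtain N1 where N1: "\<And>n s t. n \<ge> N1 \<Longrightarrow> 0 \<le> s \<Longrightarrow> s \<le> t \<Longrightarrow> t \<le> T \<Longrightarrow>
      (\<Sum>k<2^n. \<omega> (grid T n s t k) (grid T n s t (Suc k)) powr \<theta>) \<le> e / (2 * D)"
    using grid_power_sum_small[OF c T \<theta>, of "e / (2 * D)"] e D by fastforce
  obtain N2 where N2: "T / \<delta> < 2 ^ N2" using real_arch_pow[of 2 "T / \<delta>"] by auto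
  define n where "n = max N1 N2"
  have "(2::real) ^ N2 \<le> 2 ^ n" unfolding n_def by (intro power_increasing) auto
  then have "T / \<delta> < 2 ^ n" using N2 by linarith
  then have mesh: "T / 2 ^ n \<le> \<delta>" using \<delta> by (simp add: field_simps)
  let ?g = "grid T n 0 t"
  note g = grid_simps[of 0 t T n]
  have eq: "z t - z 0 = (\<Sum>k<2^n. z (?g (Suc k)) - z (?g k))"
    using sum_lessThan_telescope[of "\<lambda>k. z (?g k)" "2^n"] g t by simp
  have "norm (z t - z 0) \<le> (\<Sum>k<2^n. D * \<omega> (?g k) (?g (Suc k)) powr \<theta>)"
    unfolding eq
  proof (rule sum_norm_le)
    fix k
    have "norm (z (?g (Suc k)) - z (?g k)) \<le> C * \<omega> (?g k) (?g (Suc k)) powr \<theta>"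
      using g(5-8)[of k] g(6)[of "Suc k"] t mesh by (intro z) auto
    also have "\<dots> \<le> D * \<omega> (?g k) (?g (Suc k)) powr \<theta>" using D by (intro mult_right_mono) auto
    finally show "norm (z (?g (Suc k)) - z (?g k)) \<le> D * \<omega> (?g k) (?g (Suc k)) powr \<theta>" .
  qed
  also have "\<dots> = D * (\<Sum>k<2^n. \<omega> (?g k) (?g (Suc k)) powr \<theta>)" by (simp add: sum_distrib_left)
  also have "\<dots> \<le> D * (e / (2 * D))" using D t by (intro mult_left_mono N1) (auto simp: n_def)
  also have "\<dots> = e / 2" using D by simp
  finally show False using e by (simp add: e_def)
qed

section \<open>Tangent vectors and gauges in charts\<close>

abbreviation fd :: "('a::real_normed_vector \<Rightarrow> 'b::real_normed_vector) \<Rightarrow> 'a \<Rightarrow> 'a \<Rightarrow> 'b" where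
  "fd f x \<equiv> frechet_derivative f (at x)"

text \<open>Since \<open>g\<close> vanishes at \<open>u0\<close>, the variation of
  \<open>\<phi>\<close> is multiplied by something of first order, and continuity of
  \<open>\<phi>\<close> is enough. This serves for a coefficient whose differentiability is still to
  be shown.\<close>

lemma has_derivative_scaleR_vanishing:
  fixes g :: "'a::real_normed_vector \<Rightarrow> 'b::real_normed_vector"
  assumes \<phi>: "isCont \<phi> u0" and g: "(g has_derivative g') (at u0)" and g0: "g u0 = 0"
  shows "((\<lambda>u. \<phi> u *\<^sub>R g u) has_derivative (\<lambda>v. \<phi> u0 *\<^sub>R g' v)) (at u0)"
proof (rule has_derivativeI_sandwich[of 1])
  have bl: "bounded_linear g'" using g by (rule has_derivative_bounded_linear)
  then show "bounded_linear (\<lambda>v. \<phi> u0 *\<^sub>R g' v)" by (rule bounded_linear_const_scaleR)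
  have lim: "((\<lambda>u. norm (g u - g' (u - u0)) / norm (u - u0)) \<longlongrightarrow> 0) (at u0)"
    using g g0 by (simp add: has_derivative_iff_norm)
  have "((\<lambda>u. \<bar>\<phi> u\<bar> * (norm (g u - g' (u - u0)) / norm (u - u0)) + \<bar>\<phi> u - \<phi> u0\<bar> * onorm g')
      \<longlongrightarrow> \<bar>\<phi> u0\<bar> * 0 + \<bar>\<phi> u0 - \<phi> u0\<bar> * onorm g') (at u0)"
    using \<phi>[unfolded isCont_def] by (intro tendsto_intros lim)
  then show "((\<lambda>u. \<bar>\<phi> u\<bar> * (norm (g u - g' (u - u0)) / norm (u - u0)) + \<bar>\<phi> u - \<phi> u0\<bar> * onorm g') \<longlongrightarrow> 0) (at u0)"
    by simp
  fix u assume "u \<noteq> u0"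
  then have pos: "norm (u - u0) > 0" by simp
  have "norm (\<phi> u *\<^sub>R g u - \<phi> u0 *\<^sub>R g u0 - \<phi> u0 *\<^sub>R g' (u - u0)) =
    norm (\<phi> u *\<^sub>R (g u - g' (u - u0)) + (\<phi> u - \<phi> u0) *\<^sub>R g' (u - u0))"
    using g0 by (simp add: algebra_simps)
  also have "\<dots> \<le> \<bar>\<phi> u\<bar> * norm (g u - g' (u - u0)) + \<bar>\<phi> u - \<phi> u0\<bar> * (onorm g' * norm (u - u0))"
    by (intro norm_triangle_le add_mono) (auto intro!: mult_left_mono onorm bl)
  finally show "norm (\<phi> u *\<^sub>R g u - \<phi> u0 *\<^sub>R g u0 - \<phi> u0 *\<^sub>R g' (u - u0)) / norm (u - u0)
     \<le> \<bar>\<phi> u\<bar> * (norm (g u - g' (u - u0)) / norm (u - u0)) + \<bar>\<phi> u - \<phi> u0\<bar> * onorm g'"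
    using pos by (simp add: divide_simps algebra_simps)
qed simp

lemma fd_eqI: "(f has_derivative f') (at x) \<Longrightarrow> fd f x = f'"
  using frechet_derivative_at by metis

lemma has_derivative_transform_nhds:
  assumes f: "(f has_derivative f') (at x)" and "\<forall>\<^sub>F y in nhds x. f y = g y"
  shows "(g has_derivative f') (at x)"
  using eventually_nhds_x_imp_x[OF assms(2)] assms(2)
  by (intro has_derivative_transform_eventually[OF f]) (auto simp: eventually_at_filter elim: eventually_mono)

text \<open>Differentiating the basis expansion and using uniqueness of derivatives shows that the
  derivative inherits linearity in the vector \<open>y\<close>.\<close>

lemma linear_family_derivative_expand:
  fixes L :: "'a::real_normed_vector \<Rightarrow> 'e::euclidean_space \<Rightarrow> 'b::real_normed_vector"
  assumes lin: "\<forall>\<^sub>F u in nhds u0. linear (L u)"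
    and L: "\<And>e. ((\<lambda>u. L u e) has_derivative L' e) (at u0)"
  shows "L' y v = (\<Sum>b\<in>Basis. (y \<bullet> b) *\<^sub>R L' b v)"
proof -
  have "((\<lambda>u. \<Sum>b\<in>Basis. (y \<bullet> b) *\<^sub>R L u b) has_derivative (\<lambda>v. \<Sum>b\<in>Basis. (y \<bullet> b) *\<^sub>R L' b v)) (at u0)"
    by (intro has_derivative_sum has_derivative_scaleR_right L)
  moreover have "\<forall>\<^sub>F u in nhds u0. (\<Sum>b\<in>Basis. (y \<bullet> b) *\<^sub>R L u b) = L u y"
    using lin by eventually_elim (rule linear_euclidean_expand[symmetric])
  ultimately have "((\<lambda>u. L u y) has_derivative (\<lambda>v. \<Sum>b\<in>Basis. (y \<bullet> b) *\<^sub>R L' b v)) (at u0)"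
    by (rule has_derivative_transform_nhds)
  from has_derivative_unique[OF L this] show ?thesis by (rule fun_cong)
qed

text \<open>The product rule for a family that is known to be differentiable vector by vector: the
  basis expansion reduces it to scalar coefficients.\<close>

lemma has_derivative_linear_family:
  fixes L :: "'a::real_normed_vector \<Rightarrow> 'e::euclidean_space \<Rightarrow> 'b::real_normed_vector"
  assumes lin: "\<forall>\<^sub>F u in nhds u0. linear (L u)"
    and L: "\<And>e. ((\<lambda>u. L u e) has_derivative L' e) (at u0)" and Y: "(Y has_derivative Y') (at u0)"
  shows "((\<lambda>u. L u (Y u)) has_derivative (\<lambda>v. L u0 (Y' v) + L' (Y u0) v)) (at u0)"
proof -
  have lin0: "linear (L u0)" using lin by (rule eventually_nhds_x_imp_x)
  have "((\<lambda>u. \<Sum>b\<in>Basis. (Y u \<bullet> b) *\<^sub>R L u b) has_derivative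
      (\<lambda>v. \<Sum>b\<in>Basis. (Y u0 \<bullet> b) *\<^sub>R L' b v + (Y' v \<bullet> b) *\<^sub>R L u0 b)) (at u0)"
    by (intro has_derivative_sum has_derivative_scaleR L has_derivative_inner_left Y)
  moreover have "(\<Sum>b\<in>Basis. (Y u0 \<bullet> b) *\<^sub>R L' b v + (Y' v \<bullet> b) *\<^sub>R L u0 b) = L u0 (Y' v) + L' (Y u0) v" for v
    unfolding linear_family_derivative_expand[OF lin L, where y = "Y u0"] linear_euclidean_expand[OF
        lin0, of "Y' v"]
    by (simp add: sum.distrib add.commute)
  ultimately have "((\<lambda>u. \<Sum>b\<in>Basis. (Y u \<bullet> b) *\<^sub>R L u b) has_derivative (\<lambda>v. L u0 (Y' v) + L' (Y u0) v))
      (at u0)"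
    by simp
  moreover have "\<forall>\<^sub>F u in nhds u0. (\<Sum>b\<in>Basis. (Y u \<bullet> b) *\<^sub>R L u b) = L u (Y u)"
    using lin by eventually_elim (rule linear_euclidean_expand[symmetric])
  ultimately show ?thesis by (rule has_derivative_transform_nhds)
qed

text \<open>In finite dimension, continuity on the basis vectors is continuity in operator norm;
  \<open>n\<close> bounds the distance to the identity, and the threshold 1/2 later gives
  invertibility.\<close>

lemma linear_family_near_identity:
  fixes M :: "'a::real_normed_vector \<Rightarrow> 'e::euclidean_space \<Rightarrow> 'e"
  assumes lin: "\<forall>\<^sub>F u in nhds u0. linear (M u)" and id: "\<And>e. M u0 e = e"
    and M: "\<And>b. b \<in> Basis \<Longrightarrow> isCont (\<lambda>u. M u b) u0"
  obtains n where "(n \<longlongrightarrow> 0) (at u0)" "\<forall>\<^sub>F u in nhds u0. linear (M u) \<and> n u \<le> 1/2 \<and> (\<forall>e. norm (M u e - e)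
      \<le> n u * norm e)"
proof
  define n where "n u = (\<Sum>b\<in>Basis. norm (M u b - b))" for u
  have "(n \<longlongrightarrow> (\<Sum>b\<in>Basis. norm (M u0 b - b))) (at u0)"
    unfolding n_def using M by (intro tendsto_intros) (auto simp: isCont_def)
  then show lim: "(n \<longlongrightarrow> 0) (at u0)" using id by simp
  have n0: "n u0 = 0" using id by (simp add: n_def)
  have "(n \<longlongrightarrow> 0) (nhds u0)"
    using lim n0 tendsto_at_iff_tendsto_nhds[of n u0] by simp
  then have "\<forall>\<^sub>F u in nhds u0. n u < 1/2" by (rule order_tendstoD) simp
  then show "\<forall>\<^sub>F u in nhds u0. linear (M u) \<and> n u \<le> 1/2 \<and> (\<forall>e. norm (M u e - e) \<le> n u * norm e)"
    using lin
  proof eventually_elim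
    case (elim u)
    have l: "linear (\<lambda>e. M u e - e)" using elim by (intro linear_compose_sub linear_id[unfolded id_def])
    have "norm (M u e - e) \<le> n u * norm e" for e
    proof -
      have "norm (M u e - e) = norm (\<Sum>b\<in>Basis. (e \<bullet> b) *\<^sub>R (M u b - b))"
        using linear_euclidean_expand[OF l, of e] by simp
      also have "\<dots> \<le> (\<Sum>b\<in>Basis. norm (M u b - b) * norm e)"
      proof (rule sum_norm_le)
        fix b :: 'e assume b: "b \<in> Basis"
        show "norm ((e \<bullet> b) *\<^sub>R (M u b - b)) \<le> norm (M u b - b) * norm e"
          using mult_right_mono[OF Basis_le_norm[OF b, of e], of "norm (M u b - b)"] by (simp add:
              mult.commute)
      qed
      finally show ?thesis by (simp add: n_def sum_distrib_right)
    qed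
    then show ?case using elim by auto
  qed
qed

text \<open>Distance 1/2 from the identity bounds \<open>M\<close> from below, so it is injective,
  and injective endomorphisms in finite dimension are surjective.\<close>

lemma linear_near_identity_bij:
  fixes M :: "'e::euclidean_space \<Rightarrow> 'e"
  assumes lin: "linear M" and "\<And>e. norm (M e - e) \<le> 1/2 * norm e"
  shows "bij M" "norm e \<le> 2 * norm (M e)"
proof -
  show bd: "norm e \<le> 2 * norm (M e)" for e
    using assms(2)[of e] norm_triangle_ineq2[of e "M e"] by (simp add: norm_minus_commute)
  have "x = 0" if "M x = 0" for x using bd[of x] that by simp
  then have "inj M" by (simp add: linear_injective_0[OF lin])
  then show "bij M" using linear_injective_imp_surjective[OF lin] by (simp add: bij_def)
qed

text \<open>Any pointwise solution \<open>f\<close> is differentiable at \<open>u0\<close>, whatever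
  inverse produced it. The lower bound for \<open>M u\<close> forces continuity at
  \<open>u0\<close>; then \<open>f = b - (M - I) f\<close>, where the correction is a sum of
  continuous coefficients times functions that vanish at \<open>u0\<close> and are differentiable
  there.\<close>

lemma has_derivative_linear_solve:
  fixes M :: "'a::real_normed_vector \<Rightarrow> 'e::euclidean_space \<Rightarrow> 'e"
  assumes lin: "\<forall>\<^sub>F u in nhds u0. linear (M u)" and id: "\<And>e. M u0 e = e"
    and M: "\<And>e. ((\<lambda>u. M u e) has_derivative M' e) (at u0)" and b: "(b has_derivative b') (at u0)"
    and f: "\<forall>\<^sub>F u in nhds u0. M u (f u) = b u"
  shows "(f has_derivative (\<lambda>v. b' v - M' (b u0) v)) (at u0)"
proof -
  have cont: "isCont (\<lambda>u. M u e) u0" for e using M by (rule has_derivative_continuous)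
  obtain n where n: "(n \<longlongrightarrow> 0) (at u0)" "\<forall>\<^sub>F u in nhds u0. linear (M u) \<and> n u \<le> 1/2 \<and> (\<forall>e. norm (M u e -
      e) \<le> n u * norm e)"
    by (rule linear_family_near_identity[OF lin id cont]) (rule that; assumption)
  have f0: "f u0 = b u0" using eventually_nhds_x_imp_x[OF f] id by simp
  have bc: "isCont b u0" using b by (rule has_derivative_continuous)
  have est: "\<forall>\<^sub>F u in nhds u0. norm (f u - b u) \<le> n u * (2 * norm (b u))"
    using n(2) f
  proof eventually_elim
    case (elim u)
    have half: "norm (M u e - e) \<le> 1/2 * norm e" for e
    proof -
      have "n u * norm e \<le> 1/2 * norm e" using elim by (intro mult_right_mono) auto
      then show ?thesis using elim order_trans by blast
    qed
    \<comment> \<open>The sign of \<open>n u\<close> is recovered by evaluating the operator bound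
      at a basis vector, which has norm 1.\<close>
    have nn: "0 \<le> n u"
    proof -
      obtain i :: 'e where i: "i \<in> Basis" using nonempty_Basis by blast
      have "norm (M u i - i) \<le> n u * norm i" using elim(1) by blast
      then have "norm (M u i - i) \<le> n u" using i by simp
      then show ?thesis using norm_ge_zero order_trans by blast
    qed
    have "norm (f u - b u) = norm (M u (f u) - f u)" using elim by (simp add: norm_minus_commute)
    also have "\<dots> \<le> n u * norm (f u)" using elim by blast
    also have "\<dots> \<le> n u * (2 * norm (b u))"
      using linear_near_identity_bij(2)[of "M u" "f u", OF _ half] elim nn by (intro mult_left_mono) auto
    finally show ?case .
  qed
  have "((\<lambda>u. f u - b u) \<longlongrightarrow> 0) (at u0)"
  proof (rule Lim_null_comparison)
    show "\<forall>\<^sub>F u in at u0. norm (f u - b u) \<le> n u * (2 * norm (b u))"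
      using est by (auto simp: eventually_at_filter elim: eventually_mono)
    have "((\<lambda>u. n u * (2 * norm (b u))) \<longlongrightarrow> 0 * (2 * norm (b u0))) (at u0)"
      using bc[unfolded isCont_def] by (intro tendsto_intros n)
    then show "((\<lambda>u. n u * (2 * norm (b u))) \<longlongrightarrow> 0) (at u0)" by simp
  qed
  from tendsto_add[OF this bc[unfolded isCont_def]] have fc: "isCont f u0" using f0 by (simp add: isCont_def)
  have van: "((\<lambda>u. (f u \<bullet> i) *\<^sub>R (M u i - i)) has_derivative (\<lambda>v. (f u0 \<bullet> i) *\<^sub>R M' i v)) (at u0)" for i
  proof (rule has_derivative_scaleR_vanishing)
    show "((\<lambda>u. M u i - i) has_derivative M' i) (at u0)"
      using has_derivative_diff[OF M has_derivative_const, of i i] by simp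
    show "isCont (\<lambda>u. f u \<bullet> i) u0" using fc by (intro continuous_intros)
  qed (use id in simp)
  have d: "((\<lambda>u. b u - (\<Sum>i\<in>Basis. (f u \<bullet> i) *\<^sub>R (M u i - i))) has_derivative
     (\<lambda>v. b' v - (\<Sum>i\<in>Basis. (f u0 \<bullet> i) *\<^sub>R M' i v))) (at u0)"
    by (intro has_derivative_diff b has_derivative_sum van)
  have eq: "f u = b u - (\<Sum>i\<in>Basis. (f u \<bullet> i) *\<^sub>R (M u i - i))" if "linear (M u)" "M u (f u) = b u" for u
  proof -
    have "linear (\<lambda>e. M u e - e)" using that by (intro linear_compose_sub linear_id[unfolded id_def])
    from linear_euclidean_expand[OF this, of "f u"] that(2)
    have S: "b u - f u = (\<Sum>i\<in>Basis. (f u \<bullet> i) *\<^sub>R (M u i - i))" by simp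
    show ?thesis unfolding S[symmetric] by simp
  qed
  have lin0: "linear (M u0)" using lin by (rule eventually_nhds_x_imp_x)
  have "(f has_derivative (\<lambda>v. b' v - (\<Sum>i\<in>Basis. (f u0 \<bullet> i) *\<^sub>R M' i v))) (at u0)"
  proof (rule has_derivative_transform_eventually[OF d])
    show "\<forall>\<^sub>F u in at u0. b u - (\<Sum>i\<in>Basis. (f u \<bullet> i) *\<^sub>R (M u i - i)) = f u"
      using eventually_conj[OF lin f] eq by (auto simp: eventually_at_filter elim!: eventually_mono)
    show "b u0 - (\<Sum>i\<in>Basis. (f u0 \<bullet> i) *\<^sub>R (M u0 i - i)) = f u0"
      using eq[OF lin0] f0 id by simp
  qed simp
  moreover have "(\<Sum>i\<in>Basis. (f u0 \<bullet> i) *\<^sub>R M' i v) = M' (b u0) v" for v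
    using linear_family_derivative_expand[OF lin M, of "b u0"] f0 by simp
  ultimately show ?thesis by simp
qed

lemma linear_of_basis_expansion:
  fixes L :: "'e::euclidean_space \<Rightarrow> 'b::real_vector"
  assumes e: "\<And>y. L y = (\<Sum>b\<in>Basis. (y \<bullet> b) *\<^sub>R L b)"
  shows "linear L"
proof (rule linearI)
  fix x y r
  have "L (x + y) = (\<Sum>b\<in>Basis. (x \<bullet> b) *\<^sub>R L b) + (\<Sum>b\<in>Basis. (y \<bullet> b) *\<^sub>R L b)"
    by (subst e) (simp add: inner_add_left scaleR_add_left sum.distrib)
  then show "L (x + y) = L x + L y" by (simp only: e[symmetric])
  have "L (r *\<^sub>R x) = r *\<^sub>R (\<Sum>b\<in>Basis. (x \<bullet> b) *\<^sub>R L b)"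
    by (subst e) (simp add: scaleR_sum_right)
  then show "L (r *\<^sub>R x) = r *\<^sub>R L x" by (simp only: e[symmetric])
qed

lemma has_derivative_partial1:
  "g differentiable (at (u, w)) \<Longrightarrow> ((\<lambda>x. g (x, w)) has_derivative (\<lambda>v. fd g (u, w) (v, 0))) (at u)"
  by (rule has_derivative_compose[where f = "\<lambda>x. (x, w)" and x = u, OF _ frechet_derivative_has])
    (auto intro!: derivative_eq_intros)

lemma has_derivative_partial2:
  "g differentiable (at (u, w)) \<Longrightarrow> ((\<lambda>x. g (u, x)) has_derivative (\<lambda>v. fd g (u, w) (0, v))) (at w)"
  by (rule has_derivative_compose[where f = "\<lambda>x. (u, x)" and x = w, OF _ frechet_derivative_has])
    (auto intro!: derivative_eq_intros)

lemma has_derivative_diagonal: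
  "g differentiable (at (u, u)) \<Longrightarrow> ((\<lambda>x. g (x, x)) has_derivative (\<lambda>v. fd g (u, u) (v, v))) (at u)"
  by (rule has_derivative_compose[where f = "\<lambda>x. (x, x)" and x = u, OF _ frechet_derivative_has])
    (auto intro!: derivative_eq_intros)

section \<open>Tangent spaces and derivatives in charts\<close>

locale smooth_manifold =
  fixes A :: "('m::{t2_space,second_countable_topology}, 'e::euclidean_space) chart set"
  assumes atlas: "smooth_atlas A"
begin

lemma chart_cover: "\<exists>c\<in>A. m \<in> fst c"
  using atlas unfolding smooth_atlas_def by blast

lemma chart_open: "c \<in> A \<Longrightarrow> open (fst c)" "c \<in> A \<Longrightarrow> open (snd c ` fst c)"
  using atlas unfolding smooth_atlas_def by auto

lemma chart_homeo: "c \<in> A \<Longrightarrow> homeomorphism (fst c) (snd c ` fst c) (snd c) (chart_inv c)"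
  using atlas unfolding smooth_atlas_def by auto

lemma chart_inv_snd [simp]: "c \<in> A \<Longrightarrow> m \<in> fst c \<Longrightarrow> chart_inv c (snd c m) = m"
  using homeomorphism_apply1[OF chart_homeo] .

lemma chart_inv_in: "c \<in> A \<Longrightarrow> u \<in> snd c ` fst c \<Longrightarrow> chart_inv c u \<in> fst c"
  by auto

lemma snd_chart_inv: "c \<in> A \<Longrightarrow> u \<in> snd c ` fst c \<Longrightarrow> snd c (chart_inv c u) = u"
  using homeomorphism_apply2[OF chart_homeo] .

lemma chart_isCont: "c \<in> A \<Longrightarrow> m \<in> fst c \<Longrightarrow> isCont (snd c) m"
  using homeomorphism_cont1[OF chart_homeo] chart_open(1) continuous_on_eq_continuous_at by blast

lemma chart_image_open:
  assumes "c \<in> A" "open N"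
  shows "open (snd c ` (fst c \<inter> N))"
proof -
  have "snd c ` (fst c \<inter> N) = (snd c ` fst c) \<inter> chart_inv c -` N"
    using assms(1) by force
  then show ?thesis
    using continuous_open_preimage[OF homeomorphism_cont2[OF chart_homeo[OF assms(1)]] chart_open(2)[OF
        assms(1)] assms(2)]
    by simp
qed

lemma eventually_chart:
  assumes "c \<in> A" "m \<in> fst c" "open N" "m \<in> N"
  shows "\<forall>\<^sub>F u in nhds (snd c m). u \<in> snd c ` fst c \<and> chart_inv c u \<in> fst c \<and> chart_inv c u \<in> N \<and> snd c
      (chart_inv c u) = u"
proof -
  have "\<forall>\<^sub>F u in nhds (snd c m). u \<in> snd c ` (fst c \<inter> N)"
    using assms by (intro eventually_nhds_in_open chart_image_open) auto
  then show ?thesis by eventually_elim (use assms(1) in auto)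
qed

definition trans :: "('m, 'e) chart \<Rightarrow> ('m, 'e) chart \<Rightarrow> 'm \<Rightarrow> 'e \<Rightarrow> 'e" where
  "trans c c' m = fd (snd c' \<circ> chart_inv c) (snd c m)"

lemma trans_smooth: "c \<in> A \<Longrightarrow> c' \<in> A \<Longrightarrow> smooth_on (snd c ` (fst c \<inter> fst c')) (snd c' \<circ> chart_inv c)"
  using atlas unfolding smooth_atlas_def by auto

lemma trans_has_derivative:
  "c \<in> A \<Longrightarrow> c' \<in> A \<Longrightarrow> m \<in> fst c \<Longrightarrow> m \<in> fst c' \<Longrightarrow>
    ((snd c' \<circ> chart_inv c) has_derivative trans c c' m) (at (snd c m))"
  unfolding trans_def by (rule smooth_on_has_derivative[OF trans_smooth]) auto

lemma trans_linear:
  "c \<in> A \<Longrightarrow> c' \<in> A \<Longrightarrow> m \<in> fst c \<Longrightarrow> m \<in> fst c' \<Longrightarrow> linear (trans c c' m)"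
  using has_derivative_linear[OF trans_has_derivative] .

lemma trans_self: "c \<in> A \<Longrightarrow> m \<in> fst c \<Longrightarrow> trans c c m = (\<lambda>e. e)"
  unfolding trans_def
  by (rule fd_eqI, rule has_derivative_transform_within_open[OF has_derivative_ident chart_open(2)])
    (auto simp: snd_chart_inv)

text \<open>The cocycle identity of the transition differentials, a consequence of the chain rule.
  It makes \<open>coord_vec\<close> satisfy the compatibility condition in
  \<open>tspace\<close>.\<close>

lemma trans_comp:
  assumes c: "c0 \<in> A" "c1 \<in> A" "c2 \<in> A" and m: "m \<in> fst c0" "m \<in> fst c1" "m \<in> fst c2"
  shows "trans c0 c2 m e = trans c1 c2 m (trans c0 c1 m e)"
proof -
  have d: "((snd c2 \<circ> chart_inv c1) has_derivative trans c1 c2 m) (at ((snd c1 \<circ> chart_inv c0) (snd c0 m)))"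
    using trans_has_derivative[of c1 c2 m] c m by simp
  have "((\<lambda>u. (snd c2 \<circ> chart_inv c1) ((snd c1 \<circ> chart_inv c0) u)) has_derivative (\<lambda>e. trans c1 c2 m
      (trans c0 c1 m e))) (at (snd c0 m))"
    by (rule has_derivative_compose[OF trans_has_derivative d]) (use c m in auto)
  then have "((snd c2 \<circ> chart_inv c0) has_derivative (\<lambda>e. trans c1 c2 m (trans c0 c1 m e))) (at (snd c0 m))"
    by (rule has_derivative_transform_within_open[OF _ chart_image_open[OF c(1) chart_open(1)[OF c(2)]]])
      (use c m in auto)
  from has_derivative_unique[OF this trans_has_derivative[OF c(1,3) m(1,3)]] show ?thesis by metis
qed

lemma tspace_trans:
  "v \<in> tspace A m \<Longrightarrow> c \<in> A \<Longrightarrow> c' \<in> A \<Longrightarrow> m \<in> fst c \<Longrightarrow> m \<in> fst c' \<Longrightarrow> v c' = trans c c' m (v c)"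
  unfolding tspace_def trans_def by blast

lemma tspaceI:
  "(\<And>c c'. c \<in> A \<Longrightarrow> c' \<in> A \<Longrightarrow> m \<in> fst c \<Longrightarrow> m \<in> fst c' \<Longrightarrow> v c' = trans c c' m (v c)) \<Longrightarrow>
   (\<And>c. c \<notin> A \<or> m \<notin> fst c \<Longrightarrow> v c = 0) \<Longrightarrow> v \<in> tspace A m"
  unfolding tspace_def trans_def by blast

lemma tspace_outside: "v \<in> tspace A m \<Longrightarrow> c \<notin> A \<or> m \<notin> fst c \<Longrightarrow> v c = 0"
  unfolding tspace_def by blast

lemma coord_vec_trans:
  "coord_vec A c m e = (\<lambda>c'. if c' \<in> A \<and> m \<in> fst c' then trans c c' m e else 0)"
  unfolding coord_vec_def trans_def ..

lemma coord_vec_tspace: "c \<in> A \<Longrightarrow> m \<in> fst c \<Longrightarrow> coord_vec A c m e \<in> tspace A m"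
  by (rule tspaceI) (auto simp: coord_vec_trans trans_comp[symmetric])

lemma coord_vec_apply [simp]: "c \<in> A \<Longrightarrow> m \<in> fst c \<Longrightarrow> coord_vec A c m e c = e"
  by (simp add: coord_vec_trans trans_self)

lemma coord_vec_of_tspace:
  assumes "v \<in> tspace A m" "c \<in> A" "m \<in> fst c"
  shows "coord_vec A c m (v c) = v"
proof
  fix c'
  show "coord_vec A c m (v c) c' = v c'"
  proof (cases "c' \<in> A \<and> m \<in> fst c'")
    case True
    then show ?thesis using tspace_trans[OF assms(1,2) _ assms(3), of c'] by (simp add: coord_vec_trans)
  next
    case False
    then have "v c' = 0" using tspace_outside[OF assms(1), of c'] by blast
    then show ?thesis using False by (auto simp: coord_vec_trans)
  qed
qed

lemma tspace_eqI: "v \<in> tspace A m \<Longrightarrow> w \<in> tspace A m \<Longrightarrow> c \<in> A \<Longrightarrow> m \<in> fst c \<Longrightarrow> v c = w c \<Longrightarrow> v = w"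
  by (metis coord_vec_of_tspace)

lemma coord_vec_add: "c \<in> A \<Longrightarrow> m \<in> fst c \<Longrightarrow> coord_vec A c m (e + e') = coord_vec A c m e + coord_vec A c m e'"
  by (auto simp: coord_vec_trans fun_eq_iff linear_add[OF trans_linear])

lemma coord_vec_scaleR: "c \<in> A \<Longrightarrow> m \<in> fst c \<Longrightarrow> coord_vec A c m (r *\<^sub>R e) = r *\<^sub>R coord_vec A c m e"
  by (auto simp: coord_vec_trans fun_eq_iff scaleR_fun_def linear_cmul[OF trans_linear])

lemma tspace_add:
  assumes "v \<in> tspace A m" "w \<in> tspace A m" shows "v + w \<in> tspace A m"
proof (rule tspaceI)
  fix c c' assume c: "c \<in> A" "c' \<in> A" "m \<in> fst c" "m \<in> fst c'"
  show "(v + w) c' = trans c c' m ((v + w) c)"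
    using tspace_trans[OF assms(1) c] tspace_trans[OF assms(2) c] by (simp add: linear_add[OF
        trans_linear[OF c]])
qed (use assms in \<open>auto simp: tspace_def\<close>)

lemma tspace_scaleR:
  assumes "v \<in> tspace A m" shows "r *\<^sub>R v \<in> tspace A m"
proof (rule tspaceI)
  fix c c' assume c: "c \<in> A" "c' \<in> A" "m \<in> fst c" "m \<in> fst c'"
  show "(r *\<^sub>R v) c' = trans c c' m ((r *\<^sub>R v) c)"
    using tspace_trans[OF assms(1) c] by (simp add: scaleR_fun_def linear_cmul[OF trans_linear[OF c]])
qed (use assms in \<open>auto simp: tspace_def scaleR_fun_def\<close>)

lemma tspace_zero: "0 \<in> tspace A m"
  by (rule tspaceI) (auto simp: linear_0[OF trans_linear])

lemma tspace_sum: "finite I \<Longrightarrow> (\<And>i. i \<in> I \<Longrightarrow> v i \<in> tspace A m) \<Longrightarrow> (\<Sum>i\<in>I. v i) \<in> tspace A m"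
  by (induction I rule: finite_induct) (auto intro: tspace_add tspace_zero)

text \<open>The chart picked by \<open>SOME\<close> in \<open>vderiv\<close> is exchanged for a
  convenient one: the transition map enters through the chain rule, and its differential is absorbed
  by the compatibility condition on \<open>v\<close>.\<close>

lemma vderiv_chart:
  assumes c: "c \<in> A" "m \<in> fst c" and v: "v \<in> tspace A m"
    and f: "((\<lambda>u. f (chart_inv c u)) has_derivative f') (at (snd c m))"
  shows "vderiv A m v f = f' (v c)"
proof -
  define c0 where "c0 = (SOME c. c \<in> A \<and> m \<in> fst c)"
  have c0: "c0 \<in> A" "m \<in> fst c0" using someI_ex[of "\<lambda>c. c \<in> A \<and> m \<in> fst c"] chart_cover unfolding c0_def
      by blast+
  have d: "((\<lambda>u. f (chart_inv c u)) has_derivative f') (at ((snd c \<circ> chart_inv c0) (snd c0 m)))"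
    using f c0 by simp
  have "((\<lambda>u. f (chart_inv c ((snd c \<circ> chart_inv c0) u))) has_derivative (\<lambda>e. f' (trans c0 c m e))) (at
      (snd c0 m))"
    by (rule has_derivative_compose[OF trans_has_derivative d]) (use c c0 in auto)
  then have "((f \<circ> chart_inv c0) has_derivative (\<lambda>e. f' (trans c0 c m e))) (at (snd c0 m))"
    by (rule has_derivative_transform_within_open[OF _ chart_image_open[OF c0(1) chart_open(1)[OF c(1)]]])
      (use c c0 in auto)
  from fd_eqI[OF this] show ?thesis
    using tspace_trans[OF v c0(1) c(1) c0(2) c(2)] by (simp add: vderiv_def c0_def Let_def)
qed

text \<open>The values lie in the fixed space at \<open>m\<close>, so the component in another chart
  is the component in \<open>c\<close> followed by the constant linear map
  \<open>trans c c' m\<close>, which commutes with differentiation. The point \<open>n\<close> of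
  differentiation may differ from \<open>m\<close>, as for the differential of the
  logarithm.\<close>

lemma tderiv_chart:
  assumes c: "c \<in> A" "m \<in> fst c" "n \<in> fst c" and v: "v \<in> tspace A n"
    and F: "\<forall>\<^sub>F u in nhds (snd c n). F (chart_inv c u) \<in> tspace A m"
    and f: "((\<lambda>u. F (chart_inv c u) c) has_derivative f') (at (snd c n))"
  shows "tderiv A n v F = coord_vec A c m (f' (v c))"
proof
  fix c'
  show "tderiv A n v F c' = coord_vec A c m (f' (v c)) c'"
  proof (cases "c' \<in> A \<and> m \<in> fst c'")
    case True
    have l: "linear (trans c c' m)" using trans_linear c True by blast
    have "((\<lambda>u. trans c c' m (F (chart_inv c u) c)) has_derivative (\<lambda>e. trans c c' m (f' e))) (at (snd c n))"
      by (rule bounded_linear.has_derivative[OF linear_conv_bounded_linear[THEN iffD1, OF l] f])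
    moreover have ev: "\<forall>\<^sub>F u in nhds (snd c n). trans c c' m (F (chart_inv c u) c) = F (chart_inv c u) c'"
      using F by eventually_elim (rule tspace_trans[symmetric], use c True in auto)
    ultimately have "((\<lambda>u. F (chart_inv c u) c') has_derivative (\<lambda>e. trans c c' m (f' e))) (at (snd c n))"
      by (rule has_derivative_transform_nhds)
    from vderiv_chart[OF c(1,3) v this] show ?thesis using True by (simp add: tderiv_def coord_vec_trans)
  next
    case False
    have ev: "\<forall>\<^sub>F u in nhds (snd c n). 0 = F (chart_inv c u) c'"
      using F by eventually_elim (use False tspace_outside[of _ m c'] in force)
    have "((\<lambda>u. F (chart_inv c u) c') has_derivative (\<lambda>e. 0)) (at (snd c n))"
      by (rule has_derivative_transform_nhds[OF has_derivative_const ev])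
    from vderiv_chart[OF c(1,3) v this] show ?thesis using False by (auto simp: tderiv_def coord_vec_trans)
  qed
qed

section \<open>Coordinate representatives of gauges and forms\<close>

definition chart_dom :: "('m, 'e) chart \<Rightarrow> ('m \<times> 'm) set \<Rightarrow> ('e \<times> 'e) set" where
  "chart_dom c D = {(snd c m, snd c n) |m n. m \<in> fst c \<and> n \<in> fst c \<and> (m, n) \<in> D}"

definition chart_log :: "('m, 'e) chart \<Rightarrow> ('m \<Rightarrow> 'm \<Rightarrow> ('m, 'e) tvec) \<Rightarrow> 'e \<times> 'e \<Rightarrow> 'e" where
  "chart_log c \<psi> = (\<lambda>(u, u'). \<psi> (chart_inv c u) (chart_inv c u') c)"

definition chart_par :: "('m, 'e) chart \<Rightarrow> ('m \<Rightarrow> 'm \<Rightarrow> ('m, 'e) tvec \<Rightarrow> ('m, 'e) tvec) \<Rightarrow> 'e \<Rightarrow> 'e \<times> 'e \<Rightarrow> 'e" where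
  "chart_par c U e = (\<lambda>(u, u'). U (chart_inv c u) (chart_inv c u') (coord_vec A c (chart_inv c u') e) c)"

definition chart_form :: "('m, 'e) chart \<Rightarrow> ('m \<Rightarrow> ('m, 'e) tvec \<Rightarrow> 'v) \<Rightarrow> 'e \<Rightarrow> 'e \<Rightarrow> 'v" where
  "chart_form c \<alpha> e = (\<lambda>u. \<alpha> (chart_inv c u) (coord_vec A c (chart_inv c u) e))"

lemma chart_dom_iff:
  assumes "c \<in> A"
  shows "(u, u') \<in> chart_dom c D \<longleftrightarrow> u \<in> snd c ` fst c \<and> u' \<in> snd c ` fst c \<and> (chart_inv c u, chart_inv c
      u') \<in> D"
  using assms unfolding chart_dom_def by force

lemma chart_dom_diag: "c \<in> A \<Longrightarrow> diagonal_domain D \<Longrightarrow> u \<in> snd c ` fst c \<Longrightarrow> (u, u) \<in> chart_dom c D"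
  unfolding chart_dom_iff diagonal_domain_def by blast

lemma chart_dom_open:
  assumes c: "c \<in> A" and D: "diagonal_domain D"
  shows "open (chart_dom c D)"
proof -
  let ?f = "\<lambda>p. (chart_inv c (fst p), chart_inv c (snd p))"
  have ci: "continuous_on (snd c ` fst c) (chart_inv c)" using homeomorphism_cont2[OF chart_homeo[OF c]] .
  have "continuous_on (snd c ` fst c \<times> snd c ` fst c) ?f"
    by (intro continuous_on_Pair continuous_on_compose2[OF ci] continuous_intros) auto
  from continuous_open_preimage[OF this open_Times[OF chart_open(2)[OF c] chart_open(2)[OF c]], of D]
  have "open ((snd c ` fst c \<times> snd c ` fst c) \<inter> ?f -` D)" using D by (simp add: diagonal_domain_def)
  moreover have "chart_dom c D = (snd c ` fst c \<times> snd c ` fst c) \<inter> ?f -` D"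
    using chart_dom_iff[OF c, of _ _ D] by auto
  ultimately show ?thesis by simp
qed

lemma vector_field_coord:
  assumes c: "c \<in> A" "m \<in> fst c" and N: "open N" "m \<in> N" and Y: "smooth_vector_field_on A N Y"
  shows "((\<lambda>u. Y (chart_inv c u) c) has_derivative fd (\<lambda>u. Y (chart_inv c u) c) (snd c m)) (at (snd c m))"
  using Y c N unfolding smooth_vector_field_on_def
  by (intro smooth_on_has_derivative[of "snd c ` (fst c \<inter> N)"]) auto

text \<open>The constant coordinate fields are the test fields that determine
  \<open>cov_deriv_form\<close>. Their components in another chart are derivatives of a transition
  map, composed with the inverse transition.\<close>

lemma coord_vec_field:
  assumes c: "c \<in> A"
  shows "smooth_vector_field_on A (fst c) (\<lambda>n. coord_vec A c n e)"
  unfolding smooth_vector_field_on_def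
proof (intro conjI ballI)
  fix n assume "n \<in> fst c" then show "coord_vec A c n e \<in> tspace A n" by (rule coord_vec_tspace[OF c])
next
  fix c' assume c': "c' \<in> A"
  let ?S = "snd c' ` (fst c' \<inter> fst c)" and ?T = "snd c ` (fst c \<inter> fst c')"
  have S: "open ?S" and T: "open ?T" using chart_image_open chart_open c c' by auto
  have im: "(snd c \<circ> chart_inv c') ` ?S \<subseteq> ?T" using c c' by force
  have "Ck k ?T (\<lambda>u. fd (snd c' \<circ> chart_inv c) u e)" and "Ck k ?S (snd c \<circ> chart_inv c')" for k
    using smooth_on_deriv[OF trans_smooth[OF c c'], of e] trans_smooth[OF c' c] unfolding smooth_on_def
        by blast+
  from Ck_compose[OF S T im this]
  have "Ck k ?S (\<lambda>u. fd (snd c' \<circ> chart_inv c) ((snd c \<circ> chart_inv c') u) e)" for k .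
  then have "smooth_on ?S (\<lambda>u. fd (snd c' \<circ> chart_inv c) ((snd c \<circ> chart_inv c') u) e)"
    by (simp add: smooth_on_def)
  then show "smooth_on ?S (\<lambda>u. coord_vec A c (chart_inv c' u) e c')"
    by (rule smooth_on_cong[OF S, rotated]) (use c c' in \<open>auto simp: coord_vec_def\<close>)
qed

definition form_deriv :: "('m, 'e) chart \<Rightarrow> ('m \<Rightarrow> ('m, 'e) tvec \<Rightarrow> 'v::real_normed_vector) \<Rightarrow> 'e \<Rightarrow> 'e \<Rightarrow> 'e
    \<Rightarrow> 'v" where
  "form_deriv c \<alpha> u v w = fd (chart_form c \<alpha> w) u v"

text \<open>The derivative of the parallelism in its target variable, on the diagonal. Its negative
  is the Christoffel symbol of the covariant derivative defined by \<open>U\<close>.\<close>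

definition par_deriv :: "('m, 'e) chart \<Rightarrow> ('m \<Rightarrow> 'm \<Rightarrow> ('m, 'e) tvec \<Rightarrow> ('m, 'e) tvec) \<Rightarrow> 'e \<Rightarrow> 'e \<Rightarrow> 'e \<Rightarrow> 'e" where
  "par_deriv c U u v w = fd (chart_par c U w) (u, u) (v, 0)"

text \<open>The Hessian of the logarithm in its second variable, on the diagonal. It appears both as
  the quadratic Taylor coefficient of \<open>\<psi>\<close> and as a part of the compatibility
  tensor.\<close>

definition log_deriv2 :: "('m, 'e) chart \<Rightarrow> ('m \<Rightarrow> 'm \<Rightarrow> ('m, 'e) tvec) \<Rightarrow> 'e \<Rightarrow> 'e \<Rightarrow> 'e \<Rightarrow> 'e" where
  "log_deriv2 c \<psi> u v w = fd (\<lambda>z. fd (chart_log c \<psi>) z (0, w)) (u, u) (0, v)"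

context
  fixes \<alpha> :: "'m \<Rightarrow> ('m, 'e) tvec \<Rightarrow> 'v::real_normed_vector" and c
  assumes form: "smooth_one_form A \<alpha>" and c: "c \<in> A"
begin

lemma chart_form_smooth: "smooth_on (snd c ` fst c) (chart_form c \<alpha> e)"
  using form c unfolding smooth_one_form_def chart_form_def by blast

lemma form_coord: "m \<in> fst c \<Longrightarrow> v \<in> tspace A m \<Longrightarrow> \<alpha> m v = chart_form c \<alpha> (v c) (snd c m)"
  using c by (simp add: chart_form_def coord_vec_of_tspace)

lemma form_add: "v \<in> tspace A m \<Longrightarrow> w \<in> tspace A m \<Longrightarrow> \<alpha> m (v + w) = \<alpha> m v + \<alpha> m w"
  and form_scaleR: "v \<in> tspace A m \<Longrightarrow> \<alpha> m (r *\<^sub>R v) = r *\<^sub>R \<alpha> m v"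
  using form unfolding smooth_one_form_def linear_between_def by auto

lemma chart_form_linear:
  assumes u: "u \<in> snd c ` fst c" shows "linear (\<lambda>e. chart_form c \<alpha> e u)"
proof -
  have m: "chart_inv c u \<in> fst c" using u c by (rule chart_inv_in[rotated])
  show ?thesis unfolding chart_form_def
    by (rule linearI) (simp_all add: coord_vec_add[OF c m] coord_vec_scaleR[OF c m]
      form_add[OF coord_vec_tspace[OF c m] coord_vec_tspace[OF c m]] form_scaleR[OF coord_vec_tspace[OF c m]])
qed

lemma chart_form_has_derivative:
  "u \<in> snd c ` fst c \<Longrightarrow> (chart_form c \<alpha> w has_derivative (\<lambda>v. form_deriv c \<alpha> u v w)) (at u)"
  unfolding form_deriv_def by (rule smooth_on_has_derivative[OF chart_form_smooth])

lemma eventually_chart_form_linear: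
  "u0 \<in> snd c ` fst c \<Longrightarrow> \<forall>\<^sub>F u in nhds u0. linear (\<lambda>e. chart_form c \<alpha> e u)"
  using eventually_nhds_in_open[OF chart_open(2)[OF c]]
  by (rule eventually_mono) (auto intro: chart_form_linear)

lemma form_deriv_linear1: "u \<in> snd c ` fst c \<Longrightarrow> linear (\<lambda>v. form_deriv c \<alpha> u v w)"
  using has_derivative_linear[OF chart_form_has_derivative] .

lemma form_deriv_linear2:
  assumes u: "u \<in> snd c ` fst c" shows "linear (form_deriv c \<alpha> u v)"
  by (rule linear_of_basis_expansion,
      rule linear_family_derivative_expand[OF eventually_chart_form_linear[OF u]
          chart_form_has_derivative[OF u]])

end

context
  fixes D \<psi> U c
  assumes gauge: "geometric_gauge A D \<psi> U" and c: "c \<in> A"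
begin

lemma gauge_dom: "diagonal_domain D" and gauge_log: "logarithm A D \<psi>" and gauge_par: "parallelism A D U"
  using gauge by (auto simp: geometric_gauge_def)

lemma gauge_dom_open: "open (chart_dom c D)" and gauge_dom_diag: "u \<in> snd c ` fst c \<Longrightarrow> (u, u) \<in> chart_dom c D"
  using chart_dom_open[OF c gauge_dom] chart_dom_diag[OF c gauge_dom] by auto

lemma chart_log_smooth: "smooth_on (chart_dom c D) (chart_log c \<psi>)"
  using gauge_log c unfolding logarithm_def smooth_in_charts_def chart_log_def chart_dom_def by blast

lemma chart_par_smooth: "smooth_on (chart_dom c D) (chart_par c U e)"
  using gauge_par c unfolding parallelism_def smooth_in_charts_def chart_par_def chart_dom_def by blast

lemma log_tspace: "(m, n) \<in> D \<Longrightarrow> \<psi> m n \<in> tspace A m"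
  using gauge_log unfolding logarithm_def by blast

lemma par_linear: "(n, m) \<in> D \<Longrightarrow> linear_between (tspace A m) (tspace A n) (U n m)"
  using gauge_par unfolding parallelism_def by blast

lemma log_coord: "(m, n) \<in> D \<Longrightarrow> m \<in> fst c \<Longrightarrow> n \<in> fst c \<Longrightarrow> \<psi> m n c = chart_log c \<psi> (snd c m, snd c n)"
  using c by (simp add: chart_log_def)

lemma par_coord: "v \<in> tspace A m \<Longrightarrow> m \<in> fst c \<Longrightarrow> n \<in> fst c \<Longrightarrow> U n m v c = chart_par c U (v c) (snd c n, snd c m)"
  using c by (simp add: chart_par_def coord_vec_of_tspace)

lemma par_tspace: "(n, m) \<in> D \<Longrightarrow> v \<in> tspace A m \<Longrightarrow> U n m v \<in> tspace A n"
  using par_linear unfolding linear_between_def by blast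

lemma chart_log_diag: "u \<in> snd c ` fst c \<Longrightarrow> chart_log c \<psi> (u, u) = 0"
  using gauge_log unfolding logarithm_def chart_log_def by simp

lemma chart_par_diag: "u \<in> snd c ` fst c \<Longrightarrow> chart_par c U e (u, u) = e"
  using gauge_par c coord_vec_tspace[OF c chart_inv_in[OF c], of u e] chart_inv_in[OF c]
  unfolding parallelism_def chart_par_def by simp

lemma chart_par_linear:
  assumes "z \<in> chart_dom c D" shows "linear (\<lambda>e. chart_par c U e z)"
proof -
  obtain n m where z: "z = (snd c n, snd c m)" and m: "m \<in> fst c" and n: "n \<in> fst c" and D: "(n, m) \<in> D"
    using assms unfolding chart_dom_def by blast
  note L = par_linear[OF D, unfolded linear_between_def] and t = coord_vec_tspace[OF c m]
  show ?thesis
    by (rule linearI) (use L t c m n in \<open>simp_all add: z chart_par_def coord_vec_add coord_vec_scaleR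
        scaleR_fun_def\<close>)
qed

lemma chart_log_differentiable: "z \<in> chart_dom c D \<Longrightarrow> chart_log c \<psi> differentiable (at z)"
  by (rule smooth_on_differentiable[OF chart_log_smooth])

lemma chart_par_differentiable: "z \<in> chart_dom c D \<Longrightarrow> chart_par c U e differentiable (at z)"
  by (rule smooth_on_differentiable[OF chart_par_smooth])

lemma eventually_dom2:
  assumes "(u, u0) \<in> chart_dom c D" shows "\<forall>\<^sub>F w in nhds u0. (u, w) \<in> chart_dom c D"
proof -
  have "filterlim (\<lambda>w. (u, w)) (nhds (u, u0)) (nhds u0)"
    by (intro tendsto_Pair tendsto_const filterlim_ident)
  from eventually_compose_filterlim[OF eventually_nhds_in_open[OF gauge_dom_open assms] this] show ?thesis .
qed

lemma eventually_dom1: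
  assumes "(u0, u) \<in> chart_dom c D" shows "\<forall>\<^sub>F w in nhds u0. (w, u) \<in> chart_dom c D"
proof -
  have "filterlim (\<lambda>w. (w, u)) (nhds (u0, u)) (nhds u0)"
    by (intro tendsto_Pair tendsto_const filterlim_ident)
  from eventually_compose_filterlim[OF eventually_nhds_in_open[OF gauge_dom_open assms] this] show ?thesis .
qed

lemma log_parallelism_coord:
  assumes m: "m \<in> fst c" and n: "n \<in> fst c" and D: "(m, n) \<in> D" and v: "v \<in> tspace A n"
  shows "log_parallelism A \<psi> m n v = coord_vec A c m (fd (chart_log c \<psi>) (snd c m, snd c n) (0, v c))"
proof -
  have z: "(snd c m, snd c n) \<in> chart_dom c D" using m n D by (auto simp: chart_dom_def)
  show ?thesis unfolding log_parallelism_def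
  proof (rule tderiv_chart[OF c m n v])
    show "\<forall>\<^sub>F u in nhds (snd c n). \<psi> m (chart_inv c u) \<in> tspace A m"
      using eventually_dom2[OF z] by eventually_elim (use c m in \<open>auto simp: chart_dom_iff intro: log_tspace\<close>)
    show "((\<lambda>u. \<psi> m (chart_inv c u) c) has_derivative (\<lambda>v. fd (chart_log c \<psi>) (snd c m, snd c n) (0,
        v))) (at (snd c n))"
      using has_derivative_partial2[OF chart_log_differentiable[OF z]] c m by (simp add: chart_log_def)
  qed
qed

text \<open>The normalisation of the logarithm on the diagonal, read off in the component of the
  chart \<open>c\<close>.\<close>

lemma chart_log_deriv2: 
  assumes u: "u \<in> snd c ` fst c"
  shows "fd (chart_log c \<psi>) (u, u) (0, e) = e"
proof -
  define m where "m = chart_inv c u"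
  have m: "m \<in> fst c" "snd c m = u" using u c by (auto simp: m_def snd_chart_inv)
  have t: "coord_vec A c m e \<in> tspace A m" by (rule coord_vec_tspace[OF c m(1)])
  have D: "(m, m) \<in> D" using gauge_dom by (simp add: diagonal_domain_def)
  have "log_parallelism A \<psi> m m (coord_vec A c m e) = coord_vec A c m e"
    using gauge_log t unfolding logarithm_def log_parallelism_def by blast
  then have "coord_vec A c m e = coord_vec A c m (fd (chart_log c \<psi>) (u, u) (0, e))"
    using log_parallelism_coord[OF m(1) m(1) D t] m c by simp
  then have "coord_vec A c m e c = coord_vec A c m (fd (chart_log c \<psi>) (u, u) (0, e)) c" by simp
  then show ?thesis using c m by simp
qed

text \<open>Along the diagonal the parallelism is constantly the identity, so its two partial
  derivatives cancel. This is used because \<open>cov_deriv\<close> moves the source point of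
  \<open>U\<close>, while \<open>par_deriv\<close> moves the target.\<close>

lemma par_deriv_second:
  assumes u: "u \<in> snd c ` fst c"
  shows "fd (chart_par c U w) (u, u) (0, v) = - par_deriv c U u v w"
proof -
  note z = gauge_dom_diag[OF u]
  have "((\<lambda>x. w) has_derivative (\<lambda>v. fd (chart_par c U w) (u, u) (v, v))) (at u)"
    by (rule has_derivative_transform_within_open[OF has_derivative_diagonal[OF
        chart_par_differentiable[OF z]] chart_open(2)[OF c] u])
      (rule chart_par_diag)
  from has_derivative_unique[OF has_derivative_const this] have 0: "fd (chart_par c U w) (u, u) (v, v) =
      0" by metis
  have "linear (fd (chart_par c U w) (u, u))" by (rule linear_frechet_derivative[OF
      chart_par_differentiable[OF z]])
  from linear_add[OF this, of "(v, 0)" "(0, v)"] 0 show ?thesis by (simp add: par_deriv_def add_eq_0_iff)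
qed

text \<open>On the diagonal the differential of \<open>\<psi>\<close> in its second variable is
  constantly the identity. The compatibility tensor moves the first variable, the Taylor expansion
  the second; this identity links them.\<close>

lemma log_deriv2_first:
  assumes u: "u \<in> snd c ` fst c"
  shows "fd (\<lambda>z. fd (chart_log c \<psi>) z (0, w)) (u, u) (v, 0) = - log_deriv2 c \<psi> u v w"
proof -
  let ?g = "\<lambda>z. fd (chart_log c \<psi>) z (0, w)"
  note z = gauge_dom_diag[OF u]
  have dif: "?g differentiable (at (u, u))" by (rule smooth_on_differentiable[OF smooth_on_deriv[OF
      chart_log_smooth] z])
  have "((\<lambda>x. w) has_derivative (\<lambda>v. fd ?g (u, u) (v, v))) (at u)"
    by (rule has_derivative_transform_within_open[OF has_derivative_diagonal[OF dif] chart_open(2)[OF c] u])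
      (rule chart_log_deriv2)
  from has_derivative_unique[OF has_derivative_const this] have 0: "fd ?g (u, u) (v, v) = 0" by metis
  have "linear (fd ?g (u, u))" by (rule linear_frechet_derivative[OF dif])
  from linear_add[OF this, of "(v, 0)" "(0, v)"] 0 show ?thesis by (simp add: log_deriv2_def add_eq_0_iff2)
qed

lemma log_deriv2_symmetric: "u \<in> snd c ` fst c \<Longrightarrow> log_deriv2 c \<psi> u v w = log_deriv2 c \<psi> u w v"
  unfolding log_deriv2_def by (rule smooth_on_deriv2_symmetric[OF chart_log_smooth gauge_dom_open
      gauge_dom_diag])

lemma log_deriv2_linear1: "u \<in> snd c ` fst c \<Longrightarrow> linear (\<lambda>v. log_deriv2 c \<psi> u v w)"
proof -
  assume u: "u \<in> snd c ` fst c"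
  have l: "linear (fd (\<lambda>z. fd (chart_log c \<psi>) z (0, w)) (u, u))"
    by (rule smooth_on_linear[OF smooth_on_deriv[OF chart_log_smooth] gauge_dom_diag[OF u]])
  have "linear (\<lambda>v. (0::'e, v::'e))" by (rule linearI) auto
  from linear_compose[OF this l] show ?thesis unfolding log_deriv2_def o_def .
qed

lemma log_deriv2_linear2:
  assumes u: "u \<in> snd c ` fst c" shows "linear (log_deriv2 c \<psi> u v)"
proof -
  have "log_deriv2 c \<psi> u v = (\<lambda>w. log_deriv2 c \<psi> u w v)"
    by (rule ext) (rule log_deriv2_symmetric[OF u])
  then show ?thesis using log_deriv2_linear1[OF u, of v] by simp
qed

lemma par_deriv_linear1: "u \<in> snd c ` fst c \<Longrightarrow> linear (\<lambda>v. par_deriv c U u v w)"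
proof -
  assume u: "u \<in> snd c ` fst c"
  have l: "linear (fd (chart_par c U w) (u, u))"
    by (rule smooth_on_linear[OF chart_par_smooth gauge_dom_diag[OF u]])
  have "linear (\<lambda>v. (v::'e, 0::'e))" by (rule linearI) auto
  from linear_compose[OF this l] show ?thesis unfolding par_deriv_def o_def .
qed

lemma par_deriv_partial1:
  "u \<in> snd c ` fst c \<Longrightarrow> ((\<lambda>x. chart_par c U w (x, u)) has_derivative (\<lambda>v. par_deriv c U u v w)) (at u)"
  unfolding par_deriv_def by (rule has_derivative_partial1[OF chart_par_differentiable[OF gauge_dom_diag]])

lemma par_deriv_partial2:
  "u \<in> snd c ` fst c \<Longrightarrow> ((\<lambda>x. chart_par c U w (u, x)) has_derivative (\<lambda>v. - par_deriv c U u v w)) (at u)"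
  using has_derivative_partial2[OF chart_par_differentiable[OF gauge_dom_diag], of u w]
  by (simp add: par_deriv_second)

lemma eventually_chart_par_linear1: "u0 \<in> snd c ` fst c \<Longrightarrow> \<forall>\<^sub>F u in nhds u0. linear (\<lambda>e. chart_par c U e
    (u, u0))"
  using eventually_dom1[OF gauge_dom_diag] by (rule eventually_mono) (auto intro: chart_par_linear)

lemma eventually_chart_par_linear2: "u0 \<in> snd c ` fst c \<Longrightarrow> \<forall>\<^sub>F u in nhds u0. linear (\<lambda>e. chart_par c U e
    (u0, u))"
  using eventually_dom2[OF gauge_dom_diag] by (rule eventually_mono) (auto intro: chart_par_linear)

lemma par_deriv_linear2:
  assumes u: "u \<in> snd c ` fst c" shows "linear (par_deriv c U u v)"
  by (rule linear_of_basis_expansion,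
      rule linear_family_derivative_expand[OF eventually_chart_par_linear1[OF u] par_deriv_partial1[OF u]])

text \<open>The function differentiated in \<open>compat_tensor\<close> solves, in coordinates, a
  linear equation with coefficient \<open>M u\<close> and right-hand side \<open>b u\<close>, where
  \<open>M u0\<close> is the identity. Its derivative is therefore that of \<open>b\<close> minus
  that of \<open>M\<close>, evaluated at \<open>w\<close>.\<close>

lemma gauge_tensor_coord:
  assumes m: "m \<in> fst c" and v: "v \<in> tspace A m" and w: "w \<in> tspace A m"
  shows "gauge_tensor A \<psi> U m v w = coord_vec A c m (- log_deriv2 c \<psi> (snd c m) (v c) (w c) - par_deriv
      c U (snd c m) (v c) (w c))"
proof -
  define u0 where "u0 = snd c m"
  have u0: "u0 \<in> snd c ` fst c" using m by (simp add: u0_def)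
  define F where "F n = inv_into (tspace A m) (U n m) (log_parallelism A \<psi> n m w)" for n
  define M where "M u e = chart_par c U e (u, u0)" for u e
  define b where "b u = fd (chart_log c \<psi>) (u, u0) (0, w c)" for u
  note z = gauge_dom_diag[OF u0]
  have lin: "\<forall>\<^sub>F u in nhds u0. linear (M u)" unfolding M_def by (rule eventually_chart_par_linear1[OF u0])
  have id: "M u0 e = e" for e unfolding M_def by (rule chart_par_diag[OF u0])
  have M: "((\<lambda>u. M u e) has_derivative (\<lambda>v. par_deriv c U u0 v e)) (at u0)" for e
    unfolding M_def by (rule par_deriv_partial1[OF u0])
  have b: "(b has_derivative (\<lambda>v. - log_deriv2 c \<psi> u0 v (w c))) (at u0)"
    using has_derivative_partial1[OF smooth_on_differentiable[OF smooth_on_deriv[OF chart_log_smooth]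
        z], of "(0, w c)"]
    unfolding b_def log_deriv2_first[OF u0] .
  have cont: "isCont (\<lambda>u. M u e) u0" for e using M by (rule has_derivative_continuous)
  obtain n where n: "\<forall>\<^sub>F u in nhds u0. linear (M u) \<and> n u \<le> 1/2 \<and> (\<forall>e. norm (M u e - e) \<le> n u * norm e)"
    by (rule linear_family_near_identity[OF lin id cont]) (rule that; assumption)
  have ev: "\<forall>\<^sub>F u in nhds u0. F (chart_inv c u) \<in> tspace A m \<and> M u (F (chart_inv c u) c) = b u"
    using n eventually_dom1[OF z]
  proof eventually_elim
    case (elim u)
    define k where "k = chart_inv c u"
    have k: "k \<in> fst c" "snd c k = u" "(k, m) \<in> D" using elim(2) c m by (auto simp: k_def u0_def
        chart_dom_iff snd_chart_inv)
    have "norm (M u e - e) \<le> 1/2 * norm e" for e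
    proof -
      have "n u * norm e \<le> 1/2 * norm e" using elim by (intro mult_right_mono) auto
      then show ?thesis using elim order_trans by blast
    qed
    then have "surj (M u)" using linear_near_identity_bij(1) elim by (metis bij_is_surj)
    then obtain e where e: "M u e = b u" by (metis surjD)
    have te: "coord_vec A c m e \<in> tspace A m" by (rule coord_vec_tspace[OF c m])
    have lp: "log_parallelism A \<psi> k m w = coord_vec A c k (b u)"
      using log_parallelism_coord[OF k(1) m k(3) w] k by (simp add: b_def u0_def)
    have "U k m (coord_vec A c m e) = coord_vec A c k (b u)"
      by (rule tspace_eqI[OF par_tspace[OF k(3) te] coord_vec_tspace[OF c k(1)] c k(1)])
        (use par_coord[OF te m k(1)] c m k e in \<open>simp add: M_def u0_def\<close>)
    \<comment> \<open>\<open>inv_into\<close> gives a preimage on the image of the map. Near the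
      diagonal \<open>M u\<close> is close to the identity, hence onto, and a coordinate solution
      \<open>e\<close> yields a tangent vector that is sent to the required one.\<close>
    then have im: "log_parallelism A \<psi> k m w \<in> U k m ` tspace A m" using te lp by (metis imageI)
    have Ft: "F k \<in> tspace A m" unfolding F_def by (rule inv_into_into[OF im])
    have "U k m (F k) = coord_vec A c k (b u)" unfolding F_def lp[symmetric] by (rule f_inv_into_f[OF im])
    then have "U k m (F k) c = b u" using c k by simp
    then show ?case using Ft par_coord[OF Ft m k(1)] k by (simp add: M_def u0_def k_def)
  qed
  have b0: "b u0 = w c" unfolding b_def by (rule chart_log_deriv2[OF u0])
  have "((\<lambda>u. F (chart_inv c u) c) has_derivative (\<lambda>v. - log_deriv2 c \<psi> u0 v (w c) - par_deriv c U u0 v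
      (b u0))) (at u0)"
    by (rule has_derivative_linear_solve[OF lin id M b]) (use ev in eventually_elim, simp)
  note Fd = this[unfolded b0]
  have Ft: "\<forall>\<^sub>F u in nhds (snd c m). F (chart_inv c u) \<in> tspace A m"
    using ev unfolding u0_def by (rule eventually_mono) blast
  have "tderiv A m v F = coord_vec A c m (- log_deriv2 c \<psi> u0 (v c) (w c) - par_deriv c U u0 (v c) (w c))"
    using tderiv_chart[OF c m m v Ft Fd[unfolded u0_def]] by (simp add: u0_def)
  then show ?thesis unfolding gauge_tensor_def compat_tensor_def F_def u0_def .
qed

text \<open>The product rule for a parallelism whose source moves; the cancellation of the partial
  derivatives on the diagonal is the origin of the minus sign.\<close>

lemma cov_deriv_coord:
  assumes m: "m \<in> fst c" and v: "v \<in> tspace A m" and N: "open N" "m \<in> N" and Y: "smooth_vector_field_on A N Y"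
  shows "cov_deriv A U m v Y = coord_vec A c m (fd (\<lambda>u. Y (chart_inv c u) c) (snd c m) (v c) - par_deriv
      c U (snd c m) (v c) (Y m c))"
proof -
  define u0 where "u0 = snd c m"
  have u0: "u0 \<in> snd c ` fst c" using m by (simp add: u0_def)
  define Yc where "Yc u = Y (chart_inv c u) c" for u
  have Yd: "(Yc has_derivative fd Yc u0) (at u0)"
    using vector_field_coord[OF c m N Y] unfolding Yc_def[abs_def, symmetric] u0_def .
  have ev: "\<forall>\<^sub>F u in nhds u0. chart_inv c u \<in> fst c \<and> (m, chart_inv c u) \<in> D \<and> Y (chart_inv c u) \<in>
      tspace A (chart_inv c u) \<and> snd c (chart_inv c u) = u"
    using eventually_dom2[OF gauge_dom_diag[OF u0]] eventually_chart[OF c m N, folded u0_def]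
    by eventually_elim (use c m Y in \<open>auto simp: u0_def chart_dom_iff smooth_vector_field_on_def\<close>)
  have "((\<lambda>u. chart_par c U (Yc u) (u0, u)) has_derivative (\<lambda>v. chart_par c U (fd Yc u0 v) (u0, u0) + -
      par_deriv c U u0 v (Yc u0))) (at u0)"
    by (rule has_derivative_linear_family[where L = "\<lambda>u e. chart_par c U e (u0, u)" and L' = "\<lambda>e v. -
        par_deriv c U u0 v e",
      OF eventually_chart_par_linear2[OF u0] par_deriv_partial2[OF u0] Yd])
  moreover have "\<forall>\<^sub>F u in nhds u0. chart_par c U (Yc u) (u0, u) = U m (chart_inv c u) (Y (chart_inv c u)) c"
    using ev by eventually_elim (use par_coord m in \<open>simp add: Yc_def u0_def\<close>)
  ultimately have Ud: "((\<lambda>u. U m (chart_inv c u) (Y (chart_inv c u)) c) has_derivative (\<lambda>v. chart_par c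
      U (fd Yc u0 v) (u0, u0) + - par_deriv c U u0 v (Yc u0))) (at (snd c m))"
    unfolding u0_def by (rule has_derivative_transform_nhds)
  have Ut: "\<forall>\<^sub>F u in nhds (snd c m). U m (chart_inv c u) (Y (chart_inv c u)) \<in> tspace A m"
    using ev unfolding u0_def by (rule eventually_mono) (auto intro: par_tspace)
  have "tderiv A m v (\<lambda>n. U m n (Y n)) = coord_vec A c m (fd Yc u0 (v c) - par_deriv c U u0 (v c) (Yc u0))"
    using tderiv_chart[OF c m m v Ut Ud] chart_par_diag[OF u0] by simp
  then show ?thesis unfolding cov_deriv_def u0_def Yc_def using c m by simp
qed

text \<open>In the product rule the derivative of the field \<open>Y\<close> occurs on both sides
  and cancels, so the remaining value depends on \<open>Y m\<close> alone. Uniqueness for the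
  definite description comes from one admissible field, the constant coordinate field through
  \<open>w\<close>.\<close>

lemma cov_deriv_form_coord:
  fixes \<alpha> :: "'m \<Rightarrow> ('m, 'e) tvec \<Rightarrow> 'v::real_normed_vector"
  assumes form: "smooth_one_form A \<alpha>" and m: "m \<in> fst c" and v: "v \<in> tspace A m" and w: "w \<in> tspace A m"
  shows "cov_deriv_form A U \<alpha> m v w = form_deriv c \<alpha> (snd c m) (v c) (w c) + chart_form c \<alpha> (par_deriv c
      U (snd c m) (v c) (w c)) (snd c m)"
    (is "_ = ?a")
proof -
  define u0 where "u0 = snd c m"
  have u0: "u0 \<in> snd c ` fst c" using m by (simp add: u0_def)
  have prod: "vderiv A m v (\<lambda>n. \<alpha> n (Y n)) = ?a + \<alpha> m (cov_deriv A U m v Y)"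
    if N: "open N" "m \<in> N" and Y: "smooth_vector_field_on A N Y" and Yw: "Y m = w" for N Y
  proof -
    define Yc where "Yc u = Y (chart_inv c u) c" for u
    have Yd: "(Yc has_derivative fd Yc u0) (at u0)"
      using vector_field_coord[OF c m N Y] unfolding Yc_def[abs_def, symmetric] u0_def .
    have Y0: "Yc u0 = w c" using Yw c m by (simp add: Yc_def u0_def)
    have "((\<lambda>u. chart_form c \<alpha> (Yc u) u) has_derivative (\<lambda>v. chart_form c \<alpha> (fd Yc u0 v) u0 + form_deriv
        c \<alpha> u0 v (Yc u0))) (at u0)"
      by (rule has_derivative_linear_family[where L = "\<lambda>u e. chart_form c \<alpha> e u" and L' = "\<lambda>e v.
          form_deriv c \<alpha> u0 v e",
        OF eventually_chart_form_linear[OF form c u0] chart_form_has_derivative[OF form c u0] Yd])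
    moreover have "\<forall>\<^sub>F u in nhds u0. chart_form c \<alpha> (Yc u) u = \<alpha> (chart_inv c u) (Y (chart_inv c u))"
      using eventually_chart[OF c m N, folded u0_def]
    proof eventually_elim
      case (elim u)
      then have "Y (chart_inv c u) \<in> tspace A (chart_inv c u)" using Y by (simp add:
          smooth_vector_field_on_def)
      from form_coord[OF form c _ this] elim show ?case by (simp add: Yc_def)
    qed
    ultimately have d: "((\<lambda>u. \<alpha> (chart_inv c u) (Y (chart_inv c u))) has_derivative (\<lambda>v. chart_form c \<alpha>
        (fd Yc u0 v) u0 + form_deriv c \<alpha> u0 v (Yc u0))) (at u0)"
      by (rule has_derivative_transform_nhds)
    have lhs: "vderiv A m v (\<lambda>n. \<alpha> n (Y n)) = chart_form c \<alpha> (fd Yc u0 (v c)) u0 + form_deriv c \<alpha> u0 (v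
        c) (w c)"
      using vderiv_chart[OF c m v d[unfolded u0_def]] Y0 by (simp add: u0_def)
    have cov: "cov_deriv A U m v Y = coord_vec A c m (fd Yc u0 (v c) - par_deriv c U u0 (v c) (w c))"
      using cov_deriv_coord[OF m v N Y] Yw by (simp add: Yc_def[abs_def] u0_def)
    have "\<alpha> m (cov_deriv A U m v Y) = chart_form c \<alpha> (fd Yc u0 (v c) - par_deriv c U u0 (v c) (w c)) u0"
      unfolding cov using form_coord[OF form c m coord_vec_tspace[OF c m]] c m by (simp add: u0_def)
    also have "\<dots> = chart_form c \<alpha> (fd Yc u0 (v c)) u0 - chart_form c \<alpha> (par_deriv c U u0 (v c) (w c)) u0"
      by (rule linear_diff[OF chart_form_linear[OF form c u0]])
    finally show ?thesis using lhs by (simp add: u0_def)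
  qed
  show ?thesis unfolding cov_deriv_form_def
  proof (rule the_equality)
    show "\<forall>N Y. open N \<and> m \<in> N \<and> smooth_vector_field_on A N Y \<and> Y m = w \<longrightarrow>
      vderiv A m v (\<lambda>n. \<alpha> n (Y n)) = ?a + \<alpha> m (cov_deriv A U m v Y)" using prod by blast
  next
    fix a assume a: "\<forall>N Y. open N \<and> m \<in> N \<and> smooth_vector_field_on A N Y \<and> Y m = w \<longrightarrow>
      vderiv A m v (\<lambda>n. \<alpha> n (Y n)) = a + \<alpha> m (cov_deriv A U m v Y)"
    let ?Y = "\<lambda>n. coord_vec A c n (w c)"
    have Y: "open (fst c)" "smooth_vector_field_on A (fst c) ?Y" "?Y m = w"
      using chart_open(1)[OF c] coord_vec_field[OF c] coord_vec_of_tspace[OF w c m] by auto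
    have "vderiv A m v (\<lambda>n. \<alpha> n (?Y n)) = a + \<alpha> m (cov_deriv A U m v ?Y)"
      using a[rule_format, of "fst c" ?Y] Y m by simp
    then show "a = ?a" using prod[OF Y(1) m Y(2,3)] by simp
  qed
qed

end

text \<open>The quadratic form of the metric attains a positive minimum on a compact ball of base
  points times the unit sphere; scaling gives the constant \<open>1 / sqrt \<mu>\<close>. The bound
  turns metric estimates of vectors into coordinate ones, and coordinate bounds for linear maps into
  metric operator bounds.\<close>

lemma metric_lower_bound:
  assumes g: "riemannian_metric A g" and c: "c \<in> A" and m: "m \<in> fst c"
  obtains \<kappa> where "\<kappa> > 0" "\<forall>\<^sub>F u in nhds (snd c m). u \<in> snd c ` fst c \<and>
    (\<forall>v\<in>tspace A (chart_inv c u). norm (v c) \<le> \<kappa> * gnorm g (chart_inv c u) v)"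
proof -
  let ?S = "snd c ` fst c"
  define G where "G u e e' = g (chart_inv c u) (coord_vec A c (chart_inv c u) e) (coord_vec A c
      (chart_inv c u) e')" for u e e'
  have gl: "linear_between (tspace A n) UNIV (g n v)" "w \<in> tspace A n \<Longrightarrow> g n v w = g n w v" "v \<noteq> 0 \<Longrightarrow> g n
      v v > 0"
    if "v \<in> tspace A n" for n v w
    using g that unfolding riemannian_metric_def by blast+
  have Gs: "smooth_on ?S (\<lambda>u. G u e e')" for e e'
    using g c unfolding riemannian_metric_def G_def by blast
  have G2: "linear (G u e)" and Gsym: "G u e e' = G u e' e" and Gpos: "e \<noteq> 0 \<Longrightarrow> G u e e > 0" if u: "u \<in>
      ?S" for u e e'
  proof -
    let ?n = "chart_inv c u"
    have n: "?n \<in> fst c" using u c by (rule chart_inv_in[rotated])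
    note t = coord_vec_tspace[OF c n]
    show "linear (G u e)" unfolding G_def
      by (rule linearI) (use gl(1)[OF t] t in \<open>simp_all add: linear_between_def coord_vec_add[OF c n]
          coord_vec_scaleR[OF c n]\<close>)
    show "G u e e' = G u e' e" unfolding G_def by (rule gl(2)[OF t t])
    assume "e \<noteq> 0"
    then have "coord_vec A c ?n e \<noteq> 0" using coord_vec_apply[OF c n, of e] by auto
    then show "G u e e > 0" unfolding G_def by (rule gl(3)[OF t])
  qed
  \<comment> \<open>Smoothness of the metric is given for fixed coordinate vectors. The double basis
    expansion makes the form jointly continuous in the base point and the vector.\<close>
  have Gexp: "G u e e = (\<Sum>b\<in>Basis. \<Sum>b'\<in>Basis. (e \<bullet> b) * (e \<bullet> b') * G u b b')" if u: "u \<in> ?S" for u e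
  proof -
    have "G u e e = (\<Sum>b\<in>Basis. (e \<bullet> b) *\<^sub>R G u e b)"
      by (rule linear_euclidean_expand[OF G2[OF u]])
    also have "\<dots> = (\<Sum>b\<in>Basis. (e \<bullet> b) * G u b e)"
      by (rule sum.cong[OF refl]) (subst Gsym[OF u], simp)
    also have "\<dots> = (\<Sum>b\<in>Basis. (e \<bullet> b) * (\<Sum>b'\<in>Basis. (e \<bullet> b') * G u b b'))"
      by (rule sum.cong[OF refl]) (subst linear_euclidean_expand[OF G2[OF u], where e = e], simp)
    finally show ?thesis by (simp add: sum_distrib_left mult.assoc)
  qed
  have "snd c m \<in> ?S" using m by simp
  then obtain r where r: "r > 0" "cball (snd c m) r \<subseteq> ?S" using chart_open(2)[OF c] open_contains_cball
      by blast
  let ?K = "cball (snd c m) r \<times> sphere (0::'e) 1"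
  have "continuous_on ?K (\<lambda>p. G (fst p) b b')" for b b'
    by (rule continuous_on_compose2[OF smooth_on_continuous[OF Gs] continuous_on_fst[OF continuous_on_id]])
      (use r(2) in auto)
  then have "continuous_on ?K (\<lambda>p. \<Sum>b\<in>Basis. \<Sum>b'\<in>Basis. (snd p \<bullet> b) * (snd p \<bullet> b') * G (fst p) b b')"
    by (intro continuous_on_sum continuous_on_mult continuous_on_inner continuous_on_snd
        continuous_on_id continuous_on_const) auto
  then have cont: "continuous_on ?K (\<lambda>p. G (fst p) (snd p) (snd p))"
  proof (rule continuous_on_eq)
    fix p assume "p \<in> ?K"
    then have "fst p \<in> ?S" using r(2) by auto
    then show "(\<Sum>b\<in>Basis. \<Sum>b'\<in>Basis. (snd p \<bullet> b) * (snd p \<bullet> b') * G (fst p) b b') = G (fst p) (snd p) (snd p)"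
      by (rule Gexp[symmetric])
  qed
  obtain b0 :: 'e where b0: "b0 \<in> Basis" using nonempty_Basis by blast
  have "(snd c m, b0) \<in> ?K" using b0 r(1) by simp
  then have "?K \<noteq> {}" by blast
  moreover have "compact ?K" by (intro compact_Times compact_cball compact_sphere)
  ultimately obtain q where q: "q \<in> ?K" "\<And>p. p \<in> ?K \<Longrightarrow> G (fst q) (snd q) (snd q) \<le> G (fst p) (snd p) (snd p)"
    using continuous_attains_inf[OF _ _ cont] by blast
  define \<mu> where "\<mu> = G (fst q) (snd q) (snd q)"
  have "fst q \<in> ?S" "snd q \<noteq> 0" using q(1) r(2) by auto
  then have \<mu>: "\<mu> > 0" unfolding \<mu>_def by (rule Gpos)
  have est: "norm (v c) \<le> (1 / sqrt \<mu>) * gnorm g (chart_inv c u) v"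
    if u: "u \<in> cball (snd c m) r" and v: "v \<in> tspace A (chart_inv c u)" for u v
  proof (cases "v c = 0")
    case True
    have "0 \<le> g (chart_inv c u) v v"
      using gl(3)[OF v] gl(1)[OF v] tspace_zero[of "chart_inv c u"]
      by (cases "v = 0") (auto simp: linear_between_def dest!: spec[of _ 0])
    then show ?thesis using True \<mu> by (simp add: gnorm_def)
  next
    case False
    define e where "e = v c"
    have e: "norm e > 0" using False by (simp add: e_def)
    have uS: "u \<in> ?S" using u r(2) by blast
    have n: "chart_inv c u \<in> fst c" using uS c by (rule chart_inv_in[rotated])
    have ve: "coord_vec A c (chart_inv c u) e = v" unfolding e_def by (rule coord_vec_of_tspace[OF v c n])
    have "\<mu> \<le> G u (e /\<^sub>R norm e) (e /\<^sub>R norm e)" unfolding \<mu>_def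
      using q(2)[of "(u, e /\<^sub>R norm e)"] u e by simp
    also have "\<dots> = G u e e / (norm e)\<^sup>2"
      using linear_cmul[OF G2[OF uS]] Gsym[OF uS] by (simp add: power2_eq_square field_simps)
    finally have "\<mu> * (norm e)\<^sup>2 \<le> g (chart_inv c u) v v" using e by (simp add: field_simps G_def ve)
    then have "sqrt (\<mu> * (norm e)\<^sup>2) \<le> gnorm g (chart_inv c u) v" unfolding gnorm_def by (rule
        real_sqrt_le_mono)
    then show ?thesis using \<mu> by (simp add: real_sqrt_mult e_def field_simps)
  qed
  have ev: "\<forall>\<^sub>F u in nhds (snd c m). u \<in> ball (snd c m) r" using r(1) by (intro eventually_nhds_in_open) auto
  show ?thesis
  proof (rule that[of "1 / sqrt \<mu>"])
    show "1 / sqrt \<mu> > 0" using \<mu> by simp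
    show "\<forall>\<^sub>F u in nhds (snd c m). u \<in> ?S \<and> (\<forall>v\<in>tspace A (chart_inv c u). norm (v c) \<le> 1 / sqrt \<mu> *
        gnorm g (chart_inv c u) v)"
      using ev by eventually_elim (use r(2) est in \<open>auto simp: less_imp_le\<close>)
  qed
qed

end

section \<open>Expansions along a controlled path\<close>

text \<open>The Taylor estimates are composed with points that move along any filter; the order of
  the increment then fixes the order of each remainder.\<close>

lemma dominated_smooth_diff:
  fixes f :: "'a::euclidean_space \<Rightarrow> 'b::real_normed_vector"
  assumes f: "smooth_on S f" and S: "open S" "z0 \<in> S" and a: "(a \<longlongrightarrow> z0) G" and b: "(b \<longlongrightarrow> z0) G"
    and q: "dominated G (\<lambda>p. b p - a p) q"
  shows "dominated G (\<lambda>p. f (b p) - f (a p)) q"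
    and "dominated G (\<lambda>p. f (b p) - f (a p) - fd f (a p) (b p - a p)) (\<lambda>p. q p ^ 2)"
    and "dominated G (\<lambda>p. f (b p) - f (a p) - fd f (a p) (b p - a p)
      - (1/2) *\<^sub>R fd (\<lambda>z. fd f z (b p - a p)) (a p) (b p - a p)) (\<lambda>p. q p ^ 3)"
proof -
  have lim: "filterlim (\<lambda>p. (a p, b p)) (nhds z0 \<times>\<^sub>F nhds z0) G" by (rule filterlim_Pair[OF a b])
  have q': "dominated G (\<lambda>p. norm (b p - a p)) q" using q by (simp add: dominated_norm)
  show "dominated G (\<lambda>p. f (b p) - f (a p)) q"
    using dominated_trans[OF dominated_compose[OF dominated_lipschitz[OF f S] lim]] q' by simp
  show "dominated G (\<lambda>p. f (b p) - f (a p) - fd f (a p) (b p - a p)) (\<lambda>p. q p ^ 2)"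
    using dominated_trans[OF dominated_compose[OF dominated_taylor2[OF f S] lim]] dominated_power[OF q',
        of 2] by simp
  show "dominated G (\<lambda>p. f (b p) - f (a p) - fd f (a p) (b p - a p)
      - (1/2) *\<^sub>R fd (\<lambda>z. fd f z (b p - a p)) (a p) (b p - a p)) (\<lambda>p. q p ^ 3)"
    using dominated_trans[OF dominated_compose[OF dominated_taylor3[OF f S] lim]] dominated_power[OF q',
        of 3] by simp
qed

lemma dominated_smooth_bounded:
  fixes f :: "'a::euclidean_space \<Rightarrow> 'b::real_normed_vector"
  assumes f: "smooth_on S f" and S: "z0 \<in> S" and a: "(a \<longlongrightarrow> z0) G"
  shows "dominated G (\<lambda>p. f (a p)) (\<lambda>p. 1)"
  by (rule dominated_tendsto[OF isCont_tendsto_compose[OF smooth_on_isCont[OF f S] a]])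

section \<open>Lifts of bilinear maps to the tensor square\<close>

lemma tensor_lift_linear:
  assumes "linear L" shows "L (tensor_lift B X) = tensor_lift (\<lambda>v w. L (B v w)) X"
  by (simp add: tensor_lift_def linear_sum[OF assms] linear_cmul[OF assms])

lemma tensor_lift_sum2: "tensor_lift (\<lambda>v w. B v w + B' v w) X = tensor_lift B X + tensor_lift B' X"
  by (simp add: tensor_lift_def scaleR_add_right sum.distrib)

lemma tensor_lift_diff: "tensor_lift (\<lambda>v w. B v w - B' v w) X = tensor_lift B X - tensor_lift B' X"
  by (simp add: tensor_lift_def scaleR_diff_right sum_subtractf)

lemma tensor_lift_add: "tensor_lift B (X + Y) = tensor_lift B X + tensor_lift B Y"
  by (simp add: tensor_lift_def scaleR_add_left sum.distrib)

lemma tensor_lift_scaleR: "tensor_lift B (r *\<^sub>R X) = r *\<^sub>R tensor_lift B X"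
  by (simp add: tensor_lift_def scaleR_sum_right)

lemma linear_axis_expand:
  fixes x :: "real^'k"
  assumes "linear L" shows "L x = (\<Sum>i\<in>UNIV. (x $ i) *\<^sub>R L (axis i 1))"
proof -
  have "L x = L (\<Sum>i\<in>UNIV. (x $ i) *\<^sub>R axis i 1)"
    using basis_expansion[of x] by (simp add: scalar_mult_eq_scaleR)
  then show ?thesis by (simp add: linear_sum[OF assms] linear_cmul[OF assms])
qed

lemma tensor_lift_tensor:
  assumes l: "\<And>v. linear (B v)" "\<And>w. linear (\<lambda>v. B v w)"
  shows "tensor_lift B (tensor v w) = B v w"
proof -
  have "B v w = (\<Sum>i\<in>UNIV. (v $ i) *\<^sub>R B (axis i 1) w)" by (rule linear_axis_expand[OF l(2)])
  also have "\<dots> = (\<Sum>i\<in>UNIV. (v $ i) *\<^sub>R (\<Sum>j\<in>UNIV. (w $ j) *\<^sub>R B (axis i 1) (axis j 1)))"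
    by (rule sum.cong[OF refl], subst linear_axis_expand[OF l(1)], rule refl)
  finally show ?thesis by (simp add: tensor_lift_def tensor_def scaleR_sum_right)
qed

lemma tensor_lift_transpose: "tensor_lift B (transpose X) = tensor_lift (\<lambda>v w. B w v) X"
  unfolding tensor_lift_def transpose_def by (subst sum.swap) simp

text \<open>The lift of a symmetric form takes the same value on a matrix and on its transpose,
  hence depends on the symmetric part alone.\<close>

lemma tensor_lift_symmetric:
  fixes B :: "real^'k \<Rightarrow> real^'k \<Rightarrow> 'b::real_vector"
  assumes l: "\<And>v. linear (B v)" "\<And>w. linear (\<lambda>v. B v w)" and sym: "\<And>v w. B v w = B w v"
    and X: "(1 / 2) *\<^sub>R (X + transpose X) = (1 / 2) *\<^sub>R tensor v v"
  shows "tensor_lift B X = (1/2) *\<^sub>R B v v"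
proof -
  have "(\<lambda>v w. B w v) = B" using sym by blast
  then have "tensor_lift B X = (1/2) *\<^sub>R (tensor_lift B X + tensor_lift B (transpose X))"
    by (simp add: tensor_lift_transpose scaleR_2[symmetric])
  also have "\<dots> = tensor_lift B ((1/2) *\<^sub>R (X + transpose X))" by (simp only: tensor_lift_add
      tensor_lift_scaleR)
  also have "\<dots> = (1/2) *\<^sub>R B v v" unfolding X by (simp only: tensor_lift_scaleR tensor_lift_tensor[OF l])
  finally show ?thesis .
qed

lemma dominated_tensor_lift:
  fixes X :: "'i \<Rightarrow> real^'k^'k"
  assumes B: "\<And>i j. dominated G (\<lambda>z. B z (axis i 1) (axis j 1)) q" and X: "dominated G X r"
  shows "dominated G (\<lambda>z. tensor_lift (B z) (X z)) (\<lambda>z. r z * q z)"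
  unfolding tensor_lift_def
  by (intro dominated_sum finite dominated_scaleR B
      dominated_bounded_linear[OF bounded_linear_vec_nth] X)

lemma dominated_linear_axis:
  fixes e :: "'i \<Rightarrow> real^'k"
  assumes lin: "\<forall>\<^sub>F z in G. linear (L z)"
    and L: "\<And>i. dominated G (\<lambda>z. L z (axis i 1)) p" and e: "dominated G e q"
  shows "dominated G (\<lambda>z. L z (e z)) (\<lambda>z. q z * p z)"
proof -
  have "dominated G (\<lambda>z. \<Sum>i\<in>UNIV. (e z $ i) *\<^sub>R L z (axis i 1)) (\<lambda>z. q z * p z)"
    by (intro dominated_sum finite dominated_scaleR L dominated_bounded_linear[OF bounded_linear_vec_nth] e)
  then show ?thesis
  proof (rule dominated_cong, use lin in eventually_elim)
    case (elim z)
    then show ?case using linear_axis_expand[OF elim, of "e z"] by simp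
  qed
qed

lemma dominated_eq: "dominated G f q \<Longrightarrow> (\<And>z. q z = r z) \<Longrightarrow> dominated G f r"
  by (metis ext)

text \<open>The filter that localises all estimates: ordered pairs of times approaching the diagonal
  point, the diagonal included. Along it both values of the path eventually lie in any given chart
  domain around the value at \<open>s0\<close>.\<close>

definition pairs :: "real \<Rightarrow> real \<Rightarrow> (real \<times> real) filter" where
  "pairs T s0 = inf (nhds (s0, s0)) (principal {p. 0 \<le> fst p \<and> fst p \<le> snd p \<and> snd p \<le> T})"

definition triples :: "real \<Rightarrow> real \<Rightarrow> (real \<times> real \<times> real) filter" where
  "triples T s0 = inf (nhds (s0, s0, s0)) (principal {z. 0 \<le> fst z \<and> fst z \<le> fst (snd z) \<and> fst (snd z) \<le>
      snd (snd z) \<and> snd (snd z) \<le> T})"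

lemma eventually_pairs_order: "\<forall>\<^sub>F p in pairs T s0. 0 \<le> fst p \<and> fst p \<le> snd p \<and> snd p \<le> T"
  unfolding pairs_def eventually_inf_principal by simp

lemma eventually_triples_order: "\<forall>\<^sub>F z in triples T s0. 0 \<le> fst z \<and> fst z \<le> fst (snd z) \<and> fst (snd z) \<le>
    snd (snd z) \<and> snd (snd z) \<le> T"
  unfolding triples_def eventually_inf_principal by simp

lemma eventually_pairsD:
  assumes "\<forall>\<^sub>F p in pairs T s0. P p"
  shows "\<exists>d>0. \<forall>s t. \<bar>s - s0\<bar> < d \<and> \<bar>t - s0\<bar> < d \<and> 0 \<le> s \<and> s \<le> t \<and> t \<le> T \<longrightarrow> P (s, t)"
proof -
  have "\<forall>\<^sub>F p in nhds s0 \<times>\<^sub>F nhds s0. 0 \<le> fst p \<and> fst p \<le> snd p \<and> snd p \<le> T \<longrightarrow> P p"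
    using assms unfolding pairs_def eventually_inf_principal nhds_prod by simp
  then obtain Q1 Q2 where Q: "eventually Q1 (nhds s0)" "eventually Q2 (nhds s0)"
    "\<And>x y. Q1 x \<Longrightarrow> Q2 y \<Longrightarrow> 0 \<le> x \<and> x \<le> y \<and> y \<le> T \<longrightarrow> P (x, y)"
    unfolding eventually_prod_filter by auto
  obtain d where "d > 0" "\<And>x. dist x s0 < d \<Longrightarrow> Q1 x \<and> Q2 x"
    using eventually_conj[OF Q(1,2)] unfolding eventually_nhds_metric by blast
  then show ?thesis using Q(3) by (intro exI[of _ d]) (auto simp: dist_real_def)
qed

text \<open>Conditions on the outer times suffice in the conclusion, since the middle time is
  squeezed between them.\<close>

lemma eventually_triplesD:
  assumes "\<forall>\<^sub>F p in triples T s0. P p"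
  shows "\<exists>d>0. \<forall>s r t. \<bar>s - s0\<bar> < d \<and> \<bar>t - s0\<bar> < d \<and> 0 \<le> s \<and> s \<le> r \<and> r \<le> t \<and> t \<le> T \<longrightarrow> P (s, r, t)"
proof -
  have "\<forall>\<^sub>F p in nhds s0 \<times>\<^sub>F (nhds s0 \<times>\<^sub>F nhds s0).
      0 \<le> fst p \<and> fst p \<le> fst (snd p) \<and> fst (snd p) \<le> snd (snd p) \<and> snd (snd p) \<le> T \<longrightarrow> P p"
    using assms unfolding triples_def eventually_inf_principal nhds_prod by simp
  from eventually_prod_filter[THEN iffD1, OF this]
  obtain Q1 Q2 where Q: "eventually Q1 (nhds s0)" "eventually Q2 (nhds s0 \<times>\<^sub>F nhds s0)"
    "\<And>x y. Q1 x \<Longrightarrow> Q2 y \<Longrightarrow> 0 \<le> x \<and> x \<le> fst y \<and> fst y \<le> snd y \<and> snd y \<le> T \<longrightarrow> P (x, y)"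
    by (metis fst_conv snd_conv)
  from eventually_prod_filter[THEN iffD1, OF Q(2)]
  obtain Q3 Q4 where R: "eventually Q3 (nhds s0)" "eventually Q4 (nhds s0)"
    "\<And>x y. Q3 x \<Longrightarrow> Q4 y \<Longrightarrow> Q2 (x, y)"
    by metis
  obtain d where d: "d > 0" "\<And>x. dist x s0 < d \<Longrightarrow> Q1 x \<and> Q3 x \<and> Q4 x"
    using eventually_conj[OF Q(1) eventually_conj[OF R(1,2)]] unfolding eventually_nhds_metric by blast
  have "P (s, r, t)" if "\<bar>s - s0\<bar> < d" "\<bar>t - s0\<bar> < d" "0 \<le> s" "s \<le> r" "r \<le> t" "t \<le> T" for s r t
  proof -
    have "\<bar>r - s0\<bar> < d" using that by linarith
    then show ?thesis using Q(3)[of s "(r, t)"] R(3)[of r t] d(2) that by (auto simp: dist_real_def)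
  qed
  then show ?thesis using d(1) by blast
qed

lemma pairs_fst: "filterlim fst (inf (nhds s0) (principal {0..T})) (pairs T s0)"
  and pairs_snd: "filterlim snd (inf (nhds s0) (principal {0..T})) (pairs T s0)"
proof -
  have id: "((\<lambda>p. p) \<longlongrightarrow> (s0, s0)) (pairs T s0)"
    unfolding pairs_def by (rule filterlim_mono[OF filterlim_ident order_refl inf_le1])
  have "filterlim fst (nhds s0) (pairs T s0)" "filterlim snd (nhds s0) (pairs T s0)"
    using tendsto_fst[OF id] tendsto_snd[OF id] by simp_all
  moreover have "\<forall>\<^sub>F p in pairs T s0. fst p \<in> {0..T} \<and> snd p \<in> {0..T}"
    using eventually_pairs_order by eventually_elim auto
  ultimately show "filterlim fst (inf (nhds s0) (principal {0..T})) (pairs T s0)"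
    "filterlim snd (inf (nhds s0) (principal {0..T})) (pairs T s0)"
    by (auto simp: filterlim_inf filterlim_principal elim: eventually_mono)
qed

lemma triples_pairs:
  "filterlim (\<lambda>z. (fst z, fst (snd z))) (pairs T s0) (triples T s0)"
  "filterlim (\<lambda>z. (fst (snd z), snd (snd z))) (pairs T s0) (triples T s0)"
  "filterlim (\<lambda>z. (fst z, snd (snd z))) (pairs T s0) (triples T s0)"
proof -
  have id: "((\<lambda>p. p) \<longlongrightarrow> (s0, s0, s0)) (triples T s0)"
    unfolding triples_def by (rule filterlim_mono[OF filterlim_ident order_refl inf_le1])
  have 1: "((\<lambda>z. fst z) \<longlongrightarrow> s0) (triples T s0)" using tendsto_fst[OF id] by simp
  have 2: "((\<lambda>z. fst (snd z)) \<longlongrightarrow> s0) (triples T s0)" using tendsto_fst[OF tendsto_snd[OF id]] by simp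
  have 3: "((\<lambda>z. snd (snd z)) \<longlongrightarrow> s0) (triples T s0)" using tendsto_snd[OF tendsto_snd[OF id]] by simp
  note o = eventually_triples_order[of T s0]
  show "filterlim (\<lambda>z. (fst z, fst (snd z))) (pairs T s0) (triples T s0)"
    "filterlim (\<lambda>z. (fst (snd z), snd (snd z))) (pairs T s0) (triples T s0)"
    "filterlim (\<lambda>z. (fst z, snd (snd z))) (pairs T s0) (triples T s0)"
    unfolding pairs_def filterlim_inf filterlim_principal
    by (intro conjI tendsto_Pair 1 2 3; use o in eventually_elim; simp)+
qed

text \<open>A Lebesgue number argument: finitely many neighbourhoods cover \<open>[0, T]\<close>,
  and a short interval lies in one of them. Monotonicity in the constant allows passing to the
  largest of the finitely many local constants.\<close>

lemma local_to_uniform: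
  assumes loc: "\<And>s0. s0 \<in> {0..T} \<Longrightarrow> \<exists>C. \<exists>d>0. \<forall>s t. \<bar>s - s0\<bar> < d \<and> \<bar>t - s0\<bar> < d \<and> 0 \<le> s \<and> s \<le> t \<and> t \<le> T \<longrightarrow>
      R C s t"
    and mono: "\<And>C C' s t. 0 \<le> s \<Longrightarrow> s \<le> t \<Longrightarrow> t \<le> T \<Longrightarrow> R C s t \<Longrightarrow> C \<le> C' \<Longrightarrow> R C' s t"
  obtains C \<delta> where "(C::real) \<ge> 0" "(\<delta>::real) > 0" "\<And>s t. 0 \<le> s \<Longrightarrow> s \<le> t \<Longrightarrow> t \<le> T \<Longrightarrow> t - s \<le> \<delta> \<Longrightarrow> R C s t"
proof -
  obtain C d where Cd: "\<And>s0. s0 \<in> {0..T} \<Longrightarrow> d s0 > 0"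
    "\<And>s0 s t. s0 \<in> {0..T} \<Longrightarrow> \<bar>s - s0\<bar> < d s0 \<Longrightarrow> \<bar>t - s0\<bar> < d s0 \<Longrightarrow> 0 \<le> s \<Longrightarrow> s \<le> t \<Longrightarrow> t \<le> T \<Longrightarrow> R (C s0) s t"
    using loc by metis
  have cover: "{0..T} \<subseteq> (\<Union>s0\<in>{0..T}. ball s0 (d s0))" using Cd(1) by force
  have op: "open (ball s0 (d s0))" for s0 by simp
  obtain F where F: "F \<subseteq> {0..T}" "finite F" "{0..T} \<subseteq> (\<Union>s0\<in>F. ball s0 (d s0))"
    using compactE_image[OF compact_Icc op cover] by metis
  have op': "open G" if "G \<in> (\<lambda>s0. ball s0 (d s0)) ` F" for G using that by auto
  obtain \<epsilon> where \<epsilon>: "\<epsilon> > 0" "\<And>x. x \<in> {0..T} \<Longrightarrow> \<exists>G\<in>(\<lambda>s0. ball s0 (d s0)) ` F. ball x \<epsilon> \<subseteq> G"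
    using Heine_Borel_lemma[OF compact_Icc F(3) op'] by metis
  \<comment> \<open>The inserted 0 keeps the set nonempty and makes the maximum nonnegative.\<close>
  define C' where "C' = Max (insert 0 (C ` F))"
  have C': "C' \<ge> 0" "\<And>s0. s0 \<in> F \<Longrightarrow> C s0 \<le> C'" using F(2) by (auto simp: C'_def)
  show ?thesis
  proof (rule that[OF C'(1), of "\<epsilon> / 2"])
    show "\<epsilon> / 2 > 0" using \<epsilon> by simp
    fix s t assume st: "0 \<le> s" "s \<le> t" "t \<le> T" "t - s \<le> \<epsilon> / 2"
    obtain s0 where s0: "s0 \<in> F" "ball s \<epsilon> \<subseteq> ball s0 (d s0)" using \<epsilon>(2)[of s] st by auto
    have "s \<in> ball s \<epsilon>" "t \<in> ball s \<epsilon>" using st \<epsilon>(1) by (auto simp: dist_real_def)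
    then have "\<bar>s - s0\<bar> < d s0" "\<bar>t - s0\<bar> < d s0" using s0(2) by (auto simp: dist_real_def
        abs_minus_commute subset_eq)
    then show "R C' s t" using Cd(2)[of s0 s t] C'(2)[OF s0(1)] mono st s0(1) F(1) by blast
  qed
qed

text \<open>The punctured filter in \<open>continuous_on\<close> is replaced by one that includes
  the point itself, since a pair of times may contain \<open>s0\<close>.\<close>

lemma continuous_on_tendsto_within:
  assumes f: "continuous_on S f" and a: "a \<in> S"
  shows "(f \<longlongrightarrow> f a) (inf (nhds a) (principal S))"
proof (rule topological_tendstoI)
  fix N assume N: "open N" "f a \<in> N"
  have "(f \<longlongrightarrow> f a) (at a within S)" using assms by (simp add: continuous_on_def)
  then have "\<forall>\<^sub>F x in nhds a. x \<noteq> a \<longrightarrow> x \<in> S \<longrightarrow> f x \<in> N"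
    using topological_tendstoD[OF _ N] by (fastforce simp: eventually_at_filter)
  then show "\<forall>\<^sub>F x in inf (nhds a) (principal S). f x \<in> N"
    unfolding eventually_inf_principal by (rule eventually_mono) (use N in auto)
qed

section \<open>The controlled path in coordinates\<close>

locale controlled_manifold_path = smooth_manifold A
  for A :: "('m::{t2_space,second_countable_topology}, 'e::euclidean_space) chart set" +
  fixes g :: "'m \<Rightarrow> ('m, 'e) tvec \<Rightarrow> ('m, 'e) tvec \<Rightarrow> real"
    and p T :: real and \<omega> :: "real \<Rightarrow> real \<Rightarrow> real"
    and x :: "real \<Rightarrow> real^'k" and X :: "real \<Rightarrow> real \<Rightarrow> real^'k^'k"
    and y :: "real \<Rightarrow> 'm" and y' :: "real \<Rightarrow> real^'k \<Rightarrow> ('m, 'e) tvec"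
  assumes metric: "riemannian_metric A g"
    and T: "0 < T" and p: "1 \<le> p" "p < 3"
    and rough: "weak_geometric_rough_path p T \<omega> x X"
    and path: "(y, y') \<in> manifold_CRP A g p T \<omega> x"
begin

lemma ctrl: "control T \<omega>"
  using rough by (simp add: weak_geometric_rough_path_def)

lemma chen: "0 \<le> s \<Longrightarrow> s \<le> t \<Longrightarrow> t \<le> u \<Longrightarrow> u \<le> T \<Longrightarrow> X s u = X s t + X t u + tensor (x t - x s) (x u - x t)"
  using rough unfolding weak_geometric_rough_path_def by blast

lemma rough_bounds:
  assumes "0 \<le> s" "s \<le> t" "t \<le> T"
  shows "norm (x t - x s) \<le> \<omega> s t powr (1 / p)" "norm (X s t) \<le> \<omega> s t powr (2 / p)"
    "(1 / 2) *\<^sub>R (X s t + transpose (X s t)) = (1 / 2) *\<^sub>R tensor (x t - x s) (x t - x s)"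
  using rough assms unfolding weak_geometric_rough_path_def by blast+

text \<open>The unit of smallness: with the root of order \<open>p\<close> taken once, every order
  of approximation becomes a natural power, and orders of products can be added.\<close>

definition rho :: "real \<times> real \<Rightarrow> real" where
  "rho z = \<omega> (fst z) (snd z) powr (1 / p)"

lemma rho_nonneg: "0 \<le> rho z"
  by (simp add: rho_def)

text \<open>Exponent 0 is excluded because \<open>0 powr 0\<close> is 0 while \<open>0 ^ 0\<close>
  is 1.\<close>

lemma rho_power: "n > 0 \<Longrightarrow> rho z ^ n = \<omega> (fst z) (snd z) powr (real n / p)"
  by (cases "\<omega> (fst z) (snd z) = 0") (simp_all add: rho_def powr_power)

lemma rho_tendsto:
  assumes s0: "s0 \<in> {0..T}" shows "(rho \<longlongrightarrow> 0) (pairs T s0)"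
proof -
  let ?S = "{(s::real, t). 0 \<le> s \<and> s \<le> t \<and> t \<le> T}"
  have cont: "continuous_on ?S (\<lambda>(s, t). \<omega> s t)" and 0: "\<omega> s0 s0 = 0" using ctrl s0 by (auto simp:
      control_def)
  have S: "?S = {z. 0 \<le> fst z \<and> fst z \<le> snd z \<and> snd z \<le> T}" by auto
  have lim: "((\<lambda>z. \<omega> (fst z) (snd z)) \<longlongrightarrow> 0) (pairs T s0)"
    using continuous_on_tendsto_within[OF cont, of "(s0, s0)"] s0 0 unfolding pairs_def S by (simp add:
        case_prod_unfold)
  have "((\<lambda>z. \<omega> (fst z) (snd z) powr (1 / p)) \<longlongrightarrow> 0 powr (1 / p)) (pairs T s0)"
    by (rule tendsto_powr'[OF lim tendsto_const])
      (use eventually_pairs_order[of T s0] p in \<open>auto elim!: eventually_mono intro: control_nonneg[OF ctrl]\<close>)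
  then show ?thesis by (simp add: rho_def[abs_def])
qed

lemma rho_dominated: "s0 \<in> {0..T} \<Longrightarrow> dominated (pairs T s0) rho (\<lambda>z. 1)"
  by (rule dominated_tendsto[OF rho_tendsto])

lemma rho_power_dominated:
  assumes s0: "s0 \<in> {0..T}" and mn: "m \<le> n"
  shows "dominated (pairs T s0) (\<lambda>z. rho z ^ n) (\<lambda>z. rho z ^ m)"
proof -
  have "dominated (pairs T s0) (\<lambda>z. rho z ^ (n - m) * rho z ^ m) (\<lambda>z. 1 ^ (n - m) * rho z ^ m)"
    by (intro dominated_mult dominated_power rho_dominated[OF s0]) (rule dominatedI[where C = 1], simp)
  then show ?thesis using mn by (simp add: power_add[symmetric])
qed

lemma y_cont: "continuous_on {0..T} y"
  and y'_linear: "s \<in> {0..T} \<Longrightarrow> linear_between UNIV (tspace A (y s)) (y' s)"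
  and y'_cont: "c \<in> A \<Longrightarrow> continuous_on {s\<in>{0..T}. y s \<in> fst c} (\<lambda>s. y' s w c)"
  using path unfolding manifold_CRP_def manifold_CRP_gauge_def by auto

lemma y'_tspace: "s \<in> {0..T} \<Longrightarrow> y' s w \<in> tspace A (y s)"
  using y'_linear unfolding linear_between_def by blast

definition eta :: "('m, 'e) chart \<Rightarrow> real \<Rightarrow> 'e" where "eta c s = snd c (y s)"
definition vel :: "('m, 'e) chart \<Rightarrow> real \<Rightarrow> real^'k \<Rightarrow> 'e" where "vel c s w = y' s w c"
definition dx :: "real \<times> real \<Rightarrow> real^'k" where "dx z = x (snd z) - x (fst z)"
definition incr :: "('m, 'e) chart \<Rightarrow> real \<times> real \<Rightarrow> 'e" where "incr c z = eta c (snd z) - eta c (fst z)"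

lemma vel_linear: "s \<in> {0..T} \<Longrightarrow> linear (vel c s)"
  using y'_linear[of s] unfolding vel_def linear_between_def by (intro linearI) (simp_all add: scaleR_fun_def)

lemma dx_dominated: "dominated (pairs T s0) dx rho"
  by (rule dominatedI[where C = 1], use eventually_pairs_order[of T s0] in eventually_elim)
    (use rough_bounds(1) in \<open>simp add: dx_def rho_def\<close>)

lemma X_dominated: "dominated (pairs T s0) (\<lambda>z. X (fst z) (snd z)) (\<lambda>z. rho z ^ 2)"
  by (rule dominatedI[where C = 1], use eventually_pairs_order[of T s0] in eventually_elim)
    (use rough_bounds(2) in \<open>simp add: rho_power\<close>)

lemma y_tendsto:
  assumes "s0 \<in> {0..T}"
  shows "((\<lambda>z. y (fst z)) \<longlongrightarrow> y s0) (pairs T s0)" "((\<lambda>z. y (snd z)) \<longlongrightarrow> y s0) (pairs T s0)"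
  using filterlim_compose[OF continuous_on_tendsto_within[OF y_cont assms] pairs_fst]
    filterlim_compose[OF continuous_on_tendsto_within[OF y_cont assms] pairs_snd] .

text \<open>A diagonal domain need not be symmetric, and both orders occur: the integral evaluates
  \<open>\<psi> (y s) (y t)\<close>, the controlled form \<open>U (y t) (y s)\<close>.\<close>

lemma eventually_diagonal_domain:
  assumes s0: "s0 \<in> {0..T}" and D: "diagonal_domain D"
  shows "\<forall>\<^sub>F z in pairs T s0. (y (fst z), y (snd z)) \<in> D \<and> (y (snd z), y (fst z)) \<in> D"
  using topological_tendstoD[OF tendsto_Pair[OF y_tendsto[OF s0]], of D]
    topological_tendstoD[OF tendsto_Pair[OF y_tendsto(2,1)[OF s0]], of D] D
  by (auto simp: diagonal_domain_def eventually_conj_iff)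

lemma eventually_mesh: "\<delta> > 0 \<Longrightarrow> \<forall>\<^sub>F z in pairs T s0. snd z - fst z \<le> \<delta>"
proof -
  assume d: "\<delta> > 0"
  have "((\<lambda>z. z) \<longlongrightarrow> (s0, s0)) (pairs T s0)"
    unfolding pairs_def by (rule filterlim_mono[OF filterlim_ident order_refl inf_le1])
  from tendsto_diff[OF tendsto_snd[OF this] tendsto_fst[OF this]]
  have "((\<lambda>z. snd z - fst z) \<longlongrightarrow> 0) (pairs T s0)" by simp
  from order_tendstoD(2)[OF this d] show ?thesis by (rule eventually_mono) simp
qed

context
  fixes c s0
  assumes c: "c \<in> A" and s0: "s0 \<in> {0..T}" and ys0: "y s0 \<in> fst c"
begin

lemma eventually_in_chart:
  "\<forall>\<^sub>F z in pairs T s0. 0 \<le> fst z \<and> fst z \<le> snd z \<and> snd z \<le> T \<and> y (fst z) \<in> fst c \<and> y (snd z) \<in> fst c \<and>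
    eta c (fst z) \<in> snd c ` fst c \<and> eta c (snd z) \<in> snd c ` fst c"
  using topological_tendstoD[OF y_tendsto(1)[OF s0] chart_open(1)[OF c] ys0]
    topological_tendstoD[OF y_tendsto(2)[OF s0] chart_open(1)[OF c] ys0] eventually_pairs_order[of T s0]
  by eventually_elim (auto simp: eta_def)

lemma eta_tendsto:
  "((\<lambda>z. eta c (fst z)) \<longlongrightarrow> eta c s0) (pairs T s0)" "((\<lambda>z. eta c (snd z)) \<longlongrightarrow> eta c s0) (pairs T s0)"
  unfolding eta_def using isCont_tendsto_compose[OF chart_isCont[OF c ys0]] y_tendsto[OF s0] by auto

lemma eta_s0: "eta c s0 \<in> snd c ` fst c"
  using ys0 by (simp add: eta_def)

lemma vel_tendsto:
  "((\<lambda>z. vel c (fst z) w) \<longlongrightarrow> vel c s0 w) (pairs T s0)" "((\<lambda>z. vel c (snd z) w) \<longlongrightarrow> vel c s0 w) (pairs T s0)"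
proof -
  let ?S = "{s\<in>{0..T}. y s \<in> fst c}"
  have lim: "((\<lambda>s. vel c s w) \<longlongrightarrow> vel c s0 w) (inf (nhds s0) (principal ?S))"
    unfolding vel_def using s0 ys0 by (intro continuous_on_tendsto_within[OF y'_cont[OF c]]) auto
  have ev: "\<forall>\<^sub>F z in pairs T s0. fst z \<in> ?S \<and> snd z \<in> ?S" using eventually_in_chart by eventually_elim auto
  have "filterlim fst (inf (nhds s0) (principal ?S)) (pairs T s0)" "filterlim snd (inf (nhds s0)
      (principal ?S)) (pairs T s0)"
    using ev pairs_fst[of s0 T] pairs_snd[of s0 T] unfolding filterlim_inf filterlim_principal
    by (auto elim: eventually_mono)
  from filterlim_compose[OF lim this(1)] filterlim_compose[OF lim this(2)]
  show "((\<lambda>z. vel c (fst z) w) \<longlongrightarrow> vel c s0 w) (pairs T s0)" "((\<lambda>z. vel c (snd z) w) \<longlongrightarrow> vel c s0 w) (pairs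
      T s0)" .
qed

lemma vel_bounded: "dominated (pairs T s0) (\<lambda>z. vel c (fst z) w) (\<lambda>z. 1)" "dominated (pairs T s0) (\<lambda>z.
    vel c (snd z) w) (\<lambda>z. 1)"
  using dominated_tendsto[OF vel_tendsto(1)] dominated_tendsto[OF vel_tendsto(2)] .

lemma eventually_vel_linear: "\<forall>\<^sub>F z in pairs T s0. linear (vel c (fst z)) \<and> linear (vel c (snd z))"
  using eventually_in_chart by eventually_elim (auto intro!: vel_linear)

lemma vel_dx_dominated: "dominated (pairs T s0) (\<lambda>z. vel c (fst z) (dx z)) rho"
proof -
  have "dominated (pairs T s0) (\<lambda>z. vel c (fst z) (dx z)) (\<lambda>z. rho z * 1)"
    by (rule dominated_linear_axis[OF _ vel_bounded(1) dx_dominated])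
      (use eventually_vel_linear in \<open>auto elim: eventually_mono\<close>)
  then show ?thesis by simp
qed

lemma tball_dominated:
  assumes "\<forall>\<^sub>F z in pairs T s0. V z \<in> tball A g (y (fst z)) (C * q z)"
  shows "dominated (pairs T s0) (\<lambda>z. V z c) q"
proof -
  obtain \<kappa> where \<kappa>: "\<kappa> > 0" "\<forall>\<^sub>F u in nhds (snd c (y s0)). u \<in> snd c ` fst c \<and>
    (\<forall>v\<in>tspace A (chart_inv c u). norm (v c) \<le> \<kappa> * gnorm g (chart_inv c u) v)"
    by (rule metric_lower_bound[OF metric c ys0]) (rule that; assumption)
  have "\<forall>\<^sub>F z in pairs T s0. norm (V z c) \<le> (\<kappa> * \<bar>C\<bar>) * \<bar>q z\<bar>"
    using eventually_compose_filterlim[OF \<kappa>(2) eta_tendsto(1)[unfolded eta_def]] assms eventually_in_chart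
  proof eventually_elim
    case (elim z)
    have V: "V z \<in> tspace A (y (fst z))" "gnorm g (y (fst z)) (V z) \<le> C * q z" using elim(2) by (auto
        simp: tball_def)
    have "norm (V z c) \<le> \<kappa> * gnorm g (y (fst z)) (V z)" using elim V c by simp
    also have "\<dots> \<le> \<kappa> * (\<bar>C\<bar> * \<bar>q z\<bar>)"
      using V(2) \<kappa>(1) by (intro mult_left_mono) (auto simp: abs_mult[symmetric])
    finally show ?case by (simp add: mult.assoc)
  qed
  then show ?thesis by (rule dominatedI)
qed

lemma approxD:
  assumes "approx p T \<omega> i P B F G" and i: "i > 0"
  obtains C where "\<forall>\<^sub>F z in pairs T s0. P (fst z) (snd z) \<and> F (fst z) (snd z) - G (fst z) (snd z) \<in> B
      (fst z) (C * rho z ^ i)"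
proof -
  obtain C \<delta> where C: "\<delta> > 0" "\<And>s t. 0 \<le> s \<Longrightarrow> s \<le> t \<Longrightarrow> t \<le> T \<Longrightarrow> t - s \<le> \<delta> \<Longrightarrow> P s t \<and> F s t - G s t \<in> B s (C
      * \<omega> s t powr (real i / p))"
    using assms(1) unfolding approx_def by blast
  have "\<forall>\<^sub>F z in pairs T s0. P (fst z) (snd z) \<and> F (fst z) (snd z) - G (fst z) (snd z) \<in> B (fst z) (C *
      rho z ^ i)"
    using eventually_mesh[OF C(1)] eventually_pairs_order by eventually_elim (use C(2) i in \<open>simp add:
        rho_power\<close>)
  then show ?thesis by (rule that)
qed

lemma incr_tendsto: "(incr c \<longlongrightarrow> 0) (pairs T s0)"
  using tendsto_diff[OF eta_tendsto(2,1)] by (simp add: incr_def[abs_def])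

text \<open>The error is measured by the coordinate increment itself, whose size relative to
  \<open>rho\<close> is not yet known; it is the input of an absorption argument for that
  size.\<close>

lemma log_expansion2:
  assumes gauge: "geometric_gauge A D \<psi> U"
  shows "dominated (pairs T s0) (\<lambda>z. chart_log c \<psi> (eta c (fst z), eta c (snd z)) - incr c z) (\<lambda>z. norm
      (incr c z) ^ 2)"
proof -
  have q: "dominated (pairs T s0) (\<lambda>z. (eta c (fst z), eta c (snd z)) - (eta c (fst z), eta c (fst z)))
      (\<lambda>z. norm (incr c z))"
    by (rule dominatedI[where C = 1]) (simp add: incr_def norm_Pair)
  have "dominated (pairs T s0) (\<lambda>z. chart_log c \<psi> (eta c (fst z), eta c (snd z)) - chart_log c \<psi> (eta c
      (fst z), eta c (fst z))
     - fd (chart_log c \<psi>) (eta c (fst z), eta c (fst z)) ((eta c (fst z), eta c (snd z)) - (eta c (fst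
         z), eta c (fst z))))
     (\<lambda>z. norm (incr c z) ^ 2)"
    by (rule dominated_smooth_diff(2)[OF chart_log_smooth[OF gauge c] gauge_dom_open[OF gauge c]
        gauge_dom_diag[OF gauge c eta_s0] _ _ q])
      (intro tendsto_Pair eta_tendsto)+
  then show ?thesis
    by (rule dominated_cong) (use eventually_in_chart in eventually_elim,
      simp add: chart_log_diag[OF gauge c] chart_log_deriv2[OF gauge c] incr_def)
qed

text \<open>The defining estimates are available for some gauge. Reading them in coordinates removes
  that gauge: \<open>\<psi>\<close> agrees with the coordinate increment up to second order and
  \<open>U\<close> with the identity up to first order. The estimates for an arbitrary gauge start
  from these coordinate facts.\<close>

lemma incr_dominated: "dominated (pairs T s0) (incr c) rho"
  and incr_vel_dominated: "dominated (pairs T s0) (\<lambda>z. incr c z - vel c (fst z) (dx z)) (\<lambda>z. rho z ^ 2)"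
  and vel_diff_dominated: "dominated (pairs T s0) (\<lambda>z. vel c (snd z) w - vel c (fst z) w) rho"
proof -
  obtain D \<psi> U where gauge: "geometric_gauge A D \<psi> U" and crp: "manifold_CRP_gauge A g p T \<omega> x D \<psi> U y y'"
    using path unfolding manifold_CRP_def by blast
  let ?log = "\<lambda>z. chart_log c \<psi> (eta c (fst z), eta c (snd z))"
  have a2: "approx p T \<omega> 2 (\<lambda>s t. (y s, y t) \<in> D) (\<lambda>s. tball A g (y s)) (\<lambda>s t. \<psi> (y s) (y t)) (\<lambda>s t. y'
      s (x t - x s))"
    and a1: "approx p T \<omega> 1 (\<lambda>s t. (y s, y t) \<in> D) (\<lambda>s. Wtball A g (y s)) (\<lambda>s t w. U (y s) (y t) (y' t
        w)) (\<lambda>s t. y' s)"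
    using crp unfolding manifold_CRP_gauge_def by blast+
  have log0: "dominated (pairs T s0) (\<lambda>z. ?log z - vel c (fst z) (dx z)) (\<lambda>z. rho z ^ 2)"
  proof -
    obtain C where C: "\<forall>\<^sub>F z in pairs T s0. (y (fst z), y (snd z)) \<in> D \<and> \<psi> (y (fst z)) (y (snd z)) - y'
        (fst z) (x (snd z) - x (fst z)) \<in> tball A g (y (fst z)) (C * rho z ^ 2)"
      using approxD[OF a2] by auto
    have "dominated (pairs T s0) (\<lambda>z. (\<psi> (y (fst z)) (y (snd z)) - y' (fst z) (x (snd z) - x (fst z)))
        c) (\<lambda>z. rho z ^ 2)"
      by (rule tball_dominated[where V = "\<lambda>z. \<psi> (y (fst z)) (y (snd z)) - y' (fst z) (x (snd z) - x (fst
          z))" and C = C]) (use C in eventually_elim, simp)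
    then show ?thesis
      by (rule dominated_cong) (use eventually_in_chart in eventually_elim, simp add: chart_log_def
          eta_def vel_def dx_def c)
  qed
  have log1: "dominated (pairs T s0) ?log rho"
  proof -
    have "dominated (pairs T s0) (\<lambda>z. (?log z - vel c (fst z) (dx z)) + vel c (fst z) (dx z)) rho"
      by (intro dominated_add vel_dx_dominated dominated_trans[OF log0])
        (use rho_power_dominated[OF s0, of 1 2] in simp)
    then show ?thesis by simp
  qed
  note exp2 = log_expansion2[OF gauge]
  show inc: "dominated (pairs T s0) (incr c) rho"
  proof -
    obtain C1 where C1: "C1 \<ge> 0" "\<forall>\<^sub>F z in pairs T s0. norm (?log z) \<le> C1 * \<bar>rho z\<bar>" by (rule
        dominated_nonneg[OF log1])
    obtain C2 where C2: "C2 \<ge> 0" "\<forall>\<^sub>F z in pairs T s0. norm (?log z - incr c z) \<le> C2 * \<bar>norm (incr c z)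
        ^ 2\<bar>" by (rule dominated_nonneg[OF exp2])
    \<comment> \<open>The increment tends to 0 by continuity of \<open>y\<close>, so the quadratic
      error is eventually at most half of the increment and can be absorbed.\<close>
    have "((\<lambda>z. C2 * norm (incr c z)) \<longlongrightarrow> C2 * 0) (pairs T s0)" using tendsto_norm_zero[OF incr_tendsto]
        by (intro tendsto_intros)
    then have small: "\<forall>\<^sub>F z in pairs T s0. C2 * norm (incr c z) < 1/2" by (intro order_tendstoD(2)) auto
    have "\<forall>\<^sub>F z in pairs T s0. norm (incr c z) \<le> (2 * C1) * \<bar>rho z\<bar>"
      using C1(2) C2(2) small
    proof eventually_elim
      case (elim z)
      have "C2 * norm (incr c z) * norm (incr c z) \<le> 1/2 * norm (incr c z)" using elim(3) by (intro
          mult_right_mono) auto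
      then have "norm (?log z - incr c z) \<le> 1/2 * norm (incr c z)" using elim(2) by (simp add:
          power2_eq_square)
      then have "norm (incr c z) \<le> norm (?log z) + 1/2 * norm (incr c z)"
        using norm_triangle_sub[of "incr c z" "?log z"] by (simp add: norm_minus_commute)
      then show ?case using elim(1) by simp
    qed
    then show ?thesis by (rule dominatedI)
  qed
  have norm_inc: "dominated (pairs T s0) (\<lambda>z. norm (incr c z)) rho" using inc by (simp add: dominated_norm)
  show "dominated (pairs T s0) (\<lambda>z. incr c z - vel c (fst z) (dx z)) (\<lambda>z. rho z ^ 2)"
    using dominated_diff[OF log0 dominated_trans[OF exp2 dominated_power[OF norm_inc]]] by simp
  show "dominated (pairs T s0) (\<lambda>z. vel c (snd z) w - vel c (fst z) w) rho"
  proof -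
    obtain C where C: "\<forall>\<^sub>F z in pairs T s0. (y (fst z), y (snd z)) \<in> D \<and> (\<lambda>w. U (y (fst z)) (y (snd z))
        (y' (snd z) w)) - y' (fst z) \<in> Wtball A g (y (fst z)) (C * rho z ^ 1)"
      using approxD[OF a1] by auto
    have "dominated (pairs T s0) (\<lambda>z. (U (y (fst z)) (y (snd z)) (y' (snd z) w) - y' (fst z) w) c) rho"
      by (rule tball_dominated[where V = "\<lambda>z. U (y (fst z)) (y (snd z)) (y' (snd z) w) - y' (fst z) w"
          and C = "C * norm w"]) (use C in eventually_elim, auto simp: Wtball_def mult_ac)
    then have par0: "dominated (pairs T s0) (\<lambda>z. chart_par c U (vel c (snd z) w) (eta c (fst z), eta c
        (snd z)) - vel c (fst z) w) rho"
    proof (rule dominated_cong, use eventually_in_chart in eventually_elim)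
      case (elim z)
      have "y' (snd z) w \<in> tspace A (y (snd z))" using elim by (intro y'_tspace) auto
      from par_coord[OF gauge c this] elim show ?case by (simp add: eta_def vel_def)
    qed
    \<comment> \<open>The parallelism differs from the identity by order \<open>rho\<close>; with
      bounded velocities this removes \<open>U\<close> from the first order estimate.\<close>
    have parb: "dominated (pairs T s0) (\<lambda>z. chart_par c U b (eta c (fst z), eta c (snd z)) - b) rho" for b
    proof -
      have "dominated (pairs T s0) (\<lambda>z. (eta c (fst z), eta c (snd z)) - (eta c (fst z), eta c (fst z)))
          (\<lambda>z. norm (incr c z))"
        by (rule dominatedI[where C = 1]) (simp add: incr_def norm_Pair)
      then have q: "dominated (pairs T s0) (\<lambda>z. (eta c (fst z), eta c (snd z)) - (eta c (fst z), eta c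
          (fst z))) rho"
        by (rule dominated_trans[OF _ norm_inc])
      have "dominated (pairs T s0) (\<lambda>z. chart_par c U b (eta c (fst z), eta c (snd z)) - chart_par c U b
          (eta c (fst z), eta c (fst z))) rho"
        by (rule dominated_smooth_diff(1)[OF chart_par_smooth[OF gauge c] gauge_dom_open[OF gauge c]
            gauge_dom_diag[OF gauge c eta_s0] _ _ q])
          (intro tendsto_Pair eta_tendsto)+
      then show ?thesis
        by (rule dominated_cong) (use eventually_in_chart in eventually_elim, simp add:
            chart_par_diag[OF gauge c])
    qed
    have lin: "\<forall>\<^sub>F z in pairs T s0. linear (\<lambda>e. chart_par c U e (eta c (fst z), eta c (snd z)) - e)"
      using eventually_in_chart eventually_diagonal_domain[OF s0 gauge_dom[OF gauge c]]
    proof eventually_elim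
      case (elim z)
      then have "(eta c (fst z), eta c (snd z)) \<in> chart_dom c D" using c by (simp add: chart_dom_iff eta_def)
      from chart_par_linear[OF gauge c this] show ?case by (intro linear_compose_sub linear_id[unfolded
          id_def])
    qed
    have "dominated (pairs T s0) (\<lambda>z. chart_par c U (vel c (snd z) w) (eta c (fst z), eta c (snd z)) -
        vel c (snd z) w) (\<lambda>z. rho z * 1)"
      by (rule dominated_linear[where L = "\<lambda>z e. chart_par c U e (eta c (fst z), eta c (snd z)) - e", OF
          lin parb vel_bounded(2)])
    from dominated_diff[OF par0 this[simplified]] show ?thesis by simp
  qed
qed

end

end

lemma dominated_bilinear:
  fixes e :: "'i \<Rightarrow> 'e::euclidean_space" and e' :: "'i \<Rightarrow> 'f::euclidean_space"
  assumes lin: "\<forall>\<^sub>F z in G. (\<forall>v. linear (B z v)) \<and> (\<forall>w. linear (\<lambda>v. B z v w))"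
    and B: "\<And>b b'. b \<in> Basis \<Longrightarrow> b' \<in> Basis \<Longrightarrow> dominated G (\<lambda>z. B z b b') q"
    and e: "dominated G e r" and e': "dominated G e' r'"
  shows "dominated G (\<lambda>z. B z (e z) (e' z)) (\<lambda>z. q z * r z * r' z)"
proof (rule dominated_linear[OF _ _ e'])
  show "\<forall>\<^sub>F z in G. linear (B z (e z))" using lin by eventually_elim simp
  fix b' :: 'f assume b': "b' \<in> Basis"
  show "dominated G (\<lambda>z. B z (e z) b') (\<lambda>z. q z * r z)"
  proof (rule dominated_linear[where L = "\<lambda>z v. B z v b'", OF _ B[OF _ b'] e])
    show "\<forall>\<^sub>F z in G. linear (\<lambda>v. B z v b')" using lin by eventually_elim simp
  qed
qed

text \<open>The vector is quantified inside the eventuality, as membership in an operator norm ball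
  requires. Finiteness of the basis permits this exchange of quantifiers.\<close>

lemma dominated_linear_uniform:
  fixes L :: "'i \<Rightarrow> 'e::euclidean_space \<Rightarrow> 'b::real_normed_vector"
  assumes lin: "\<forall>\<^sub>F z in G. linear (L z)" and L: "\<And>b. b \<in> Basis \<Longrightarrow> dominated G (\<lambda>z. L z b) q"
  obtains C where "C \<ge> 0" "\<forall>\<^sub>F z in G. \<forall>e. norm (L z e) \<le> C * \<bar>q z\<bar> * norm e"
proof -
  have "\<exists>B. B \<ge> 0 \<and> (\<forall>\<^sub>F z in G. norm (L z b) \<le> B * \<bar>q z\<bar>)" if "b \<in> Basis" for b
    by (rule dominated_nonneg[OF L[OF that]]) blast
  then obtain B where B: "\<And>b. b \<in> Basis \<Longrightarrow> B b \<ge> 0 \<and> (\<forall>\<^sub>F z in G. norm (L z b) \<le> B b * \<bar>q z\<bar>)"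
    by metis
  have "\<forall>\<^sub>F z in G. \<forall>b\<in>Basis. norm (L z b) \<le> B b * \<bar>q z\<bar>"
    using B by (intro eventually_ball_finite) auto
  then have "\<forall>\<^sub>F z in G. \<forall>e. norm (L z e) \<le> (\<Sum>b\<in>Basis. B b) * \<bar>q z\<bar> * norm e"
    using lin
  proof eventually_elim
    case (elim z)
    show ?case
    proof
      fix e
      have "norm (L z e) = norm (\<Sum>b\<in>Basis. (e \<bullet> b) *\<^sub>R L z b)"
        by (rule arg_cong[where f = norm], rule linear_euclidean_expand[OF elim(2)])
      also have "\<dots> \<le> (\<Sum>b\<in>Basis. B b * (\<bar>q z\<bar> * norm e))"
      proof (rule sum_norm_le)
        fix b :: 'e assume b: "b \<in> Basis"
        have "\<bar>e \<bullet> b\<bar> * norm (L z b) \<le> norm e * (B b * \<bar>q z\<bar>)"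
          using Basis_le_norm[OF b, of e] elim(1) b by (intro mult_mono) auto
        then show "norm ((e \<bullet> b) *\<^sub>R L z b) \<le> B b * (\<bar>q z\<bar> * norm e)" by (simp add: mult_ac)
      qed
      finally show "norm (L z e) \<le> (\<Sum>b\<in>Basis. B b) * \<bar>q z\<bar> * norm e" by (simp add: sum_distrib_right
          mult.assoc)
    qed
  qed
  then show ?thesis using B by (intro that[of "\<Sum>b\<in>Basis. B b"] sum_nonneg) auto
qed

lemma sum_fun_apply: "finite I \<Longrightarrow> (\<Sum>i\<in>I. f i) x = (\<Sum>i\<in>I. f i x)"
  by (induction I rule: finite_induct) auto

lemma tensor_lift_apply: "tensor_lift B X c = tensor_lift (\<lambda>v w. B v w c) X"
  by (simp add: tensor_lift_def sum_fun_apply scaleR_fun_def)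

section \<open>Uniform estimates and expansions of the gauge along the path\<close>

context controlled_manifold_path
begin

lemma tensor_lift_tspace: "(\<And>v w. B v w \<in> tspace A m) \<Longrightarrow> tensor_lift B Z \<in> tspace A m"
  unfolding tensor_lift_def by (intro tspace_sum tspace_scaleR) auto

text \<open>\<open>approx\<close> asks for one constant and one mesh size on all of
  \<open>[0, T]\<close>; local constants are enlarged to a common one, which requires balls that
  grow with their radius.\<close>

lemma approxI:
  assumes loc: "\<And>s0. s0 \<in> {0..T} \<Longrightarrow> \<exists>C. \<forall>\<^sub>F z in pairs T s0. P (fst z) (snd z) \<and> F (fst z) (snd z) - G
      (fst z) (snd z) \<in> B (fst z) (C * rho z ^ i)"
    and mono: "\<And>s r r'. r \<le> r' \<Longrightarrow> B s r \<subseteq> B s r'" and i: "i > 0"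
  shows "approx p T \<omega> i P B F G"
proof -
  obtain C \<delta> where "\<delta> > 0" "\<And>s t. 0 \<le> s \<Longrightarrow> s \<le> t \<Longrightarrow> t \<le> T \<Longrightarrow> t - s \<le> \<delta> \<Longrightarrow> P s t \<and> F s t - G s t \<in> B s (C *
      rho (s, t) ^ i)"
  proof (rule local_to_uniform[where R = "\<lambda>C s t. P s t \<and> F s t - G s t \<in> B s (C * rho (s, t) ^ i)" and
      T = T])
    fix s0 assume "s0 \<in> {0..T}"
    from loc[OF this] obtain C where "\<forall>\<^sub>F z in pairs T s0. P (fst z) (snd z) \<and> F (fst z) (snd z) - G
        (fst z) (snd z) \<in> B (fst z) (C * rho z ^ i)" by blast
    from eventually_pairsD[OF this]
    show "\<exists>C. \<exists>d>0. \<forall>s t. \<bar>s - s0\<bar> < d \<and> \<bar>t - s0\<bar> < d \<and> 0 \<le> s \<and> s \<le> t \<and> t \<le> T \<longrightarrow> P s t \<and> F s t - G s t \<in>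
        B s (C * rho (s, t) ^ i)"
      by auto
  next
    fix C C' s t assume "P s t \<and> F s t - G s t \<in> B s (C * rho (s, t) ^ i)" "(C::real) \<le> C'"
    then show "P s t \<and> F s t - G s t \<in> B s (C' * rho (s, t) ^ i)"
      using mono[OF mult_right_mono[of C C' "rho (s, t) ^ i"]] rho_nonneg by auto
  qed (rule that; assumption)
  then show ?thesis unfolding approx_def using i by (intro exI[of _ C] exI[of _ \<delta>]) (auto simp: rho_power)
qed

lemma dominated_uniform:
  assumes "\<And>s0. s0 \<in> {0..T} \<Longrightarrow> dominated (pairs T s0) (\<lambda>z. F (fst z) (snd z)) (\<lambda>z. rho z ^ i)"
  obtains C \<delta> where "(C::real) \<ge> 0" "(\<delta>::real) > 0" "\<And>s t. 0 \<le> s \<Longrightarrow> s \<le> t \<Longrightarrow> t \<le> T \<Longrightarrow> t - s \<le> \<delta> \<Longrightarrow> norm (F s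
      t) \<le> C * rho (s, t) ^ i"
proof (rule local_to_uniform[where R = "\<lambda>C s t. norm (F s t) \<le> C * rho (s, t) ^ i" and T = T])
  fix s0 assume "s0 \<in> {0..T}"
  then obtain C where "\<forall>\<^sub>F z in pairs T s0. norm (F (fst z) (snd z)) \<le> C * \<bar>rho z ^ i\<bar>" using assms
      unfolding dominated_def by blast
  from eventually_pairsD[OF this]
  show "\<exists>C. \<exists>d>0. \<forall>s t. \<bar>s - s0\<bar> < d \<and> \<bar>t - s0\<bar> < d \<and> 0 \<le> s \<and> s \<le> t \<and> t \<le> T \<longrightarrow> norm (F s t) \<le> C * rho (s,
      t) ^ i"
    by (auto simp: rho_nonneg)
next
  fix C C' s t assume "norm (F s t) \<le> C * rho (s, t) ^ i" "(C::real) \<le> C'"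
  then show "norm (F s t) \<le> C' * rho (s, t) ^ i"
    using mult_right_mono[of C C' "rho (s, t) ^ i"] rho_nonneg by (smt (verit) zero_le_power)
qed (rule that; assumption)

text \<open>The middle time is quantified inside the relation \<open>R\<close>, so that the passage
  from local to uniform constants for pairs also serves triples.\<close>

lemma dominated_uniform_triples:
  assumes "\<And>s0. s0 \<in> {0..T} \<Longrightarrow> dominated (triples T s0) (\<lambda>z. F (fst z) (fst (snd z)) (snd (snd z))) (\<lambda>z.
      rho (fst z, snd (snd z)) ^ i)"
  obtains C \<delta> where "(C::real) \<ge> 0" "(\<delta>::real) > 0" "\<And>s r t. 0 \<le> s \<Longrightarrow> s \<le> r \<Longrightarrow> r \<le> t \<Longrightarrow> t \<le> T \<Longrightarrow> t - s \<le> \<delta> \<Longrightarrow>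
      norm (F s r t) \<le> C * rho (s, t) ^ i"
proof -
  have *: "\<exists>C \<delta>. C \<ge> 0 \<and> \<delta> > 0 \<and> (\<forall>s t. 0 \<le> s \<longrightarrow> s \<le> t \<longrightarrow> t \<le> T \<longrightarrow> t - s \<le> \<delta> \<longrightarrow> (\<forall>r\<in>{s..t}. norm (F s r t) \<le>
      C * rho (s, t) ^ i))"
  proof (rule local_to_uniform[where R = "\<lambda>C s t. \<forall>r\<in>{s..t}. norm (F s r t) \<le> C * rho (s, t) ^ i" and T = T])
    fix s0 assume "s0 \<in> {0..T}"
    then obtain C where "\<forall>\<^sub>F z in triples T s0. norm (F (fst z) (fst (snd z)) (snd (snd z))) \<le> C * \<bar>rho
        (fst z, snd (snd z)) ^ i\<bar>"
      using assms unfolding dominated_def by blast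
    from eventually_triplesD[OF this] obtain d where "d > 0" "\<forall>s r t. \<bar>s - s0\<bar> < d \<and> \<bar>t - s0\<bar> < d \<and> 0 \<le>
        s \<and> s \<le> r \<and> r \<le> t \<and> t \<le> T \<longrightarrow> norm (F s r t) \<le> C * rho (s, t) ^ i"
      by (auto simp: rho_nonneg)
    then show "\<exists>C. \<exists>d>0. \<forall>s t. \<bar>s - s0\<bar> < d \<and> \<bar>t - s0\<bar> < d \<and> 0 \<le> s \<and> s \<le> t \<and> t \<le> T \<longrightarrow> (\<forall>r\<in>{s..t}. norm (F
        s r t) \<le> C * rho (s, t) ^ i)"
      by (intro exI[of _ C] exI[of _ d]) auto
  next
    fix C C' s t assume "\<forall>r\<in>{s..t}. norm (F s r t) \<le> C * rho (s, t) ^ i" "(C::real) \<le> C'"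
    then show "\<forall>r\<in>{s..t}. norm (F s r t) \<le> C' * rho (s, t) ^ i"
      using mult_right_mono[of C C' "rho (s, t) ^ i"] rho_nonneg by (smt (verit) zero_le_power)
  next
    fix C \<delta> :: real assume "0 \<le> C" "0 < \<delta>" "\<And>s t. 0 \<le> s \<Longrightarrow> s \<le> t \<Longrightarrow> t \<le> T \<Longrightarrow> t - s \<le> \<delta> \<Longrightarrow> \<forall>r\<in>{s..t}. norm (F
        s r t) \<le> C * rho (s, t) ^ i"
    then show ?thesis by blast
  qed
  then obtain C \<delta> where "0 \<le> C" "0 < \<delta>" "\<forall>s t. 0 \<le> s \<longrightarrow> s \<le> t \<longrightarrow> t \<le> T \<longrightarrow> t - s \<le> \<delta> \<longrightarrow> (\<forall>r\<in>{s..t}. norm (F s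
      r t) \<le> C * rho (s, t) ^ i)"
    by blast
  then show ?thesis by (intro that[of C \<delta>]) auto
qed

context
  fixes c s0
  assumes c: "c \<in> A" and s0: "s0 \<in> {0..T}" and ys0: "y s0 \<in> fst c"
begin

lemma smooth_eta_dominated:
  assumes f: "smooth_on (snd c ` fst c) f"
  shows "dominated (pairs T s0) (\<lambda>z. f (eta c (fst z))) (\<lambda>z. 1)"
    and "dominated (pairs T s0) (\<lambda>z. f (eta c (snd z))) (\<lambda>z. 1)"
    and "dominated (pairs T s0) (\<lambda>z. f (eta c (snd z)) - f (eta c (fst z))) rho"
    and "dominated (pairs T s0) (\<lambda>z. f (eta c (snd z)) - f (eta c (fst z)) - fd f (eta c (fst z)) (incr
        c z)) (\<lambda>z. rho z ^ 2)"
proof -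
  note t = eta_tendsto[OF c s0 ys0] and e = eta_s0[OF c s0 ys0]
  show "dominated (pairs T s0) (\<lambda>z. f (eta c (fst z))) (\<lambda>z. 1)" "dominated (pairs T s0) (\<lambda>z. f (eta c
      (snd z))) (\<lambda>z. 1)"
    using dominated_smooth_bounded[OF f e] t by auto
  have q: "dominated (pairs T s0) (\<lambda>z. eta c (snd z) - eta c (fst z)) rho"
    using incr_dominated[OF c s0 ys0] by (simp add: incr_def[abs_def])
  note d = dominated_smooth_diff[OF f chart_open(2)[OF c] e t q]
  show "dominated (pairs T s0) (\<lambda>z. f (eta c (snd z)) - f (eta c (fst z))) rho" by (rule d(1))
  show "dominated (pairs T s0) (\<lambda>z. f (eta c (snd z)) - f (eta c (fst z)) - fd f (eta c (fst z)) (incr c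
      z)) (\<lambda>z. rho z ^ 2)"
    using d(2) by (simp add: incr_def)
qed

lemma smooth_diagonal_dominated:
  assumes f: "smooth_on S f" and S: "open S" "\<And>u. u \<in> snd c ` fst c \<Longrightarrow> (u, u) \<in> S"
  shows "dominated (pairs T s0) (\<lambda>z. f (eta c (fst z), eta c (fst z))) (\<lambda>z. 1)"
    and "dominated (pairs T s0) (\<lambda>z. f (eta c (snd z), eta c (snd z))) (\<lambda>z. 1)"
    and "dominated (pairs T s0) (\<lambda>z. f (eta c (snd z), eta c (snd z)) - f (eta c (fst z), eta c (fst z))) rho"
proof -
  note t = eta_tendsto[OF c s0 ys0] and e = S(2)[OF eta_s0[OF c s0 ys0]]
  note t1 = tendsto_Pair[OF t(1) t(1)] and t2 = tendsto_Pair[OF t(2) t(2)]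
  show "dominated (pairs T s0) (\<lambda>z. f (eta c (fst z), eta c (fst z))) (\<lambda>z. 1)" by (rule
      dominated_smooth_bounded[OF f e t1])
  show "dominated (pairs T s0) (\<lambda>z. f (eta c (snd z), eta c (snd z))) (\<lambda>z. 1)" by (rule
      dominated_smooth_bounded[OF f e t2])
  have "dominated (pairs T s0) (\<lambda>z. (eta c (snd z), eta c (snd z)) - (eta c (fst z), eta c (fst z)))
      (\<lambda>z. norm (incr c z))"
  proof (rule dominatedI[where C = 2, OF always_eventually], rule allI)
    fix z
    show "norm ((eta c (snd z), eta c (snd z)) - (eta c (fst z), eta c (fst z))) \<le> 2 * \<bar>norm (incr c z)\<bar>"
      using norm_Pair_le[of "incr c z" "incr c z"] by (simp add: incr_def)
  qed
  then have q: "dominated (pairs T s0) (\<lambda>z. (eta c (snd z), eta c (snd z)) - (eta c (fst z), eta c (fst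
      z))) rho"
    by (rule dominated_trans) (simp add: dominated_norm incr_dominated[OF c s0 ys0])
  show "dominated (pairs T s0) (\<lambda>z. f (eta c (snd z), eta c (snd z)) - f (eta c (fst z), eta c (fst z))) rho"
    by (rule dominated_smooth_diff(1)[OF f S(1) e t1 t2 q])
qed

text \<open>Base point, first argument and second argument are changed one at a time; each change is
  of order \<open>rho\<close> and is multiplied by bounded quantities.\<close>

lemma bilinear_velocity_diff_dominated:
  fixes B :: "'e \<Rightarrow> 'e \<Rightarrow> 'e \<Rightarrow> 'b::real_normed_vector"
  assumes lin: "\<And>u v. u \<in> snd c ` fst c \<Longrightarrow> linear (B u v)" "\<And>u w. u \<in> snd c ` fst c \<Longrightarrow> linear (\<lambda>v. B u v w)"
    and bd: "\<And>b b'. dominated (pairs T s0) (\<lambda>z. B (eta c (fst z)) b b') (\<lambda>z. 1)"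
    and df: "\<And>b b'. dominated (pairs T s0) (\<lambda>z. B (eta c (snd z)) b b' - B (eta c (fst z)) b b') rho"
    and e: "dominated (pairs T s0) e (\<lambda>z. 1)" "dominated (pairs T s0) e' (\<lambda>z. 1)" "dominated (pairs T
        s0) (\<lambda>z. e' z - e z) rho"
    and f: "dominated (pairs T s0) f (\<lambda>z. 1)" "dominated (pairs T s0) f' (\<lambda>z. 1)" "dominated (pairs T
        s0) (\<lambda>z. f' z - f z) rho"
  shows "dominated (pairs T s0) (\<lambda>z. B (eta c (snd z)) (e' z) (f' z) - B (eta c (fst z)) (e z) (f z)) rho"
proof -
  have l1: "\<forall>\<^sub>F z in pairs T s0. (\<forall>v. linear (B (eta c (fst z)) v)) \<and> (\<forall>w. linear (\<lambda>v. B (eta c (fst z))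
      v w))"
    using eventually_in_chart[OF c s0 ys0] by eventually_elim (use lin in blast)
  have l2: "\<forall>\<^sub>F z in pairs T s0. (\<forall>v. linear (\<lambda>w. B (eta c (snd z)) v w - B (eta c (fst z)) v w)) \<and>
      (\<forall>w. linear (\<lambda>v. B (eta c (snd z)) v w - B (eta c (fst z)) v w))"
    using eventually_in_chart[OF c s0 ys0] by eventually_elim (intro conjI allI linear_compose_sub lin; simp)
  have "dominated (pairs T s0) (\<lambda>z. (B (eta c (snd z)) (e' z) (f' z) - B (eta c (fst z)) (e' z) (f' z))
      + (B (eta c (fst z)) (e' z - e z) (f' z) + B (eta c (fst z)) (e z) (f' z - f z))) rho"
    using dominated_bilinear[where B = "\<lambda>z v w. B (eta c (snd z)) v w - B (eta c (fst z)) v w", OF l2 df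
        e(2) f(2)]
      dominated_bilinear[where B = "\<lambda>z. B (eta c (fst z))", OF l1 bd e(3) f(2)]
      dominated_bilinear[where B = "\<lambda>z. B (eta c (fst z))", OF l1 bd e(1) f(3)]
    by (intro dominated_add) simp_all
  then show ?thesis
  proof (rule dominated_cong, use eventually_in_chart[OF c s0 ys0] in eventually_elim)
    case (elim z)
    then have u: "eta c (fst z) \<in> snd c ` fst c" by blast
    show ?case using linear_diff[OF lin(2)[OF u, of "f' z"], of "e' z" "e z"] linear_diff[OF lin(1)[OF
        u, of "e z"], of "f' z" "f z"] by simp
  qed
qed

context
  fixes D \<psi> U
  assumes gauge: "geometric_gauge A D \<psi> U"
begin

lemma log_deriv2_bounded: "dominated (pairs T s0) (\<lambda>z. log_deriv2 c \<psi> (eta c (fst z)) b b') (\<lambda>z. 1)"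
  unfolding log_deriv2_def
  by (rule smooth_diagonal_dominated(1)[OF smooth_on_deriv[OF smooth_on_deriv[OF chart_log_smooth[OF
      gauge c]]]
      gauge_dom_open[OF gauge c] gauge_dom_diag[OF gauge c]])

lemma par_deriv_dominated:
  "dominated (pairs T s0) (\<lambda>z. par_deriv c U (eta c (fst z)) b b') (\<lambda>z. 1)"
  "dominated (pairs T s0) (\<lambda>z. par_deriv c U (eta c (snd z)) b b') (\<lambda>z. 1)"
  "dominated (pairs T s0) (\<lambda>z. par_deriv c U (eta c (snd z)) b b' - par_deriv c U (eta c (fst z)) b b') rho"
proof -
  note d = smooth_diagonal_dominated[OF smooth_on_deriv[OF chart_par_smooth[OF gauge c]]
      gauge_dom_open[OF gauge c] gauge_dom_diag[OF gauge c]]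
  show "dominated (pairs T s0) (\<lambda>z. par_deriv c U (eta c (fst z)) b b') (\<lambda>z. 1)"
    unfolding par_deriv_def by (rule d(1))
  show "dominated (pairs T s0) (\<lambda>z. par_deriv c U (eta c (snd z)) b b') (\<lambda>z. 1)"
    unfolding par_deriv_def by (rule d(2))
  show "dominated (pairs T s0) (\<lambda>z. par_deriv c U (eta c (snd z)) b b' - par_deriv c U (eta c (fst z)) b
      b') rho"
    unfolding par_deriv_def by (rule d(3))
qed

lemma par_expansion:
  "dominated (pairs T s0) (\<lambda>z. chart_par c U b (eta c (snd z), eta c (fst z)) - b) rho"
  "dominated (pairs T s0) (\<lambda>z. chart_par c U b (eta c (snd z), eta c (fst z)) - b - par_deriv c U (eta c
      (fst z)) (incr c z) b) (\<lambda>z. rho z ^ 2)"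
proof -
  note t = eta_tendsto[OF c s0 ys0]
  have "dominated (pairs T s0) (\<lambda>z. (eta c (snd z), eta c (fst z)) - (eta c (fst z), eta c (fst z)))
      (\<lambda>z. norm (incr c z))"
    by (rule dominatedI[where C = 1]) (simp add: incr_def norm_Pair)
  then have q: "dominated (pairs T s0) (\<lambda>z. (eta c (snd z), eta c (fst z)) - (eta c (fst z), eta c (fst
      z))) rho"
    by (rule dominated_trans) (simp add: dominated_norm incr_dominated[OF c s0 ys0])
  note d = dominated_smooth_diff[OF chart_par_smooth[OF gauge c] gauge_dom_open[OF gauge c]
      gauge_dom_diag[OF gauge c eta_s0[OF c s0 ys0]]
      tendsto_Pair[OF t(1) t(1)] tendsto_Pair[OF t(2) t(1)] q, of b]
  show "dominated (pairs T s0) (\<lambda>z. chart_par c U b (eta c (snd z), eta c (fst z)) - b) rho"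
    by (rule dominated_cong[OF d(1)]) (use eventually_in_chart[OF c s0 ys0] in eventually_elim, simp
        add: chart_par_diag[OF gauge c])
  show "dominated (pairs T s0) (\<lambda>z. chart_par c U b (eta c (snd z), eta c (fst z)) - b - par_deriv c U
      (eta c (fst z)) (incr c z) b) (\<lambda>z. rho z ^ 2)"
    by (rule dominated_cong[OF d(2)]) (use eventually_in_chart[OF c s0 ys0] in eventually_elim,
      simp add: chart_par_diag[OF gauge c] par_deriv_def incr_def)
qed

text \<open>This is the only place where the rough path has to be geometric.\<close>

lemma gauge_remainder_dominated:
  "dominated (pairs T s0) (\<lambda>z. chart_log c \<psi> (eta c (fst z), eta c (snd z))
    + tensor_lift (\<lambda>w w'. - log_deriv2 c \<psi> (eta c (fst z)) (vel c (fst z) w) (vel c (fst z) w')) (X (fst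
        z) (snd z))
    - incr c z) (\<lambda>z. rho z ^ 3)"
proof -
  note t = eta_tendsto[OF c s0 ys0] and inc = incr_dominated[OF c s0 ys0] and incv =
      incr_vel_dominated[OF c s0 ys0]
    and vdx = vel_dx_dominated[OF c s0 ys0]
  let ?Q = "\<lambda>z. log_deriv2 c \<psi> (eta c (fst z))"
  let ?log = "\<lambda>z. chart_log c \<psi> (eta c (fst z), eta c (snd z))"
  let ?v = "\<lambda>z. vel c (fst z) (dx z)"
  have "dominated (pairs T s0) (\<lambda>z. (eta c (fst z), eta c (snd z)) - (eta c (fst z), eta c (fst z)))
      (\<lambda>z. norm (incr c z))"
    by (rule dominatedI[where C = 1]) (simp add: incr_def norm_Pair)
  then have q: "dominated (pairs T s0) (\<lambda>z. (eta c (fst z), eta c (snd z)) - (eta c (fst z), eta c (fst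
      z))) rho"
    by (rule dominated_trans) (simp add: dominated_norm inc)
  have "dominated (pairs T s0) (\<lambda>z. ?log z - chart_log c \<psi> (eta c (fst z), eta c (fst z))
     - fd (chart_log c \<psi>) (eta c (fst z), eta c (fst z)) ((eta c (fst z), eta c (snd z)) - (eta c (fst
         z), eta c (fst z)))
     - (1/2) *\<^sub>R fd (\<lambda>u. fd (chart_log c \<psi>) u ((eta c (fst z), eta c (snd z)) - (eta c (fst z), eta c
         (fst z))))
         (eta c (fst z), eta c (fst z)) ((eta c (fst z), eta c (snd z)) - (eta c (fst z), eta c (fst
             z)))) (\<lambda>z. rho z ^ 3)"
    by (rule dominated_smooth_diff(3)[OF chart_log_smooth[OF gauge c] gauge_dom_open[OF gauge c]
        gauge_dom_diag[OF gauge c eta_s0[OF c s0 ys0]]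
      tendsto_Pair[OF t(1) t(1)] tendsto_Pair[OF t(1) t(2)] q])
  then have T3: "dominated (pairs T s0) (\<lambda>z. ?log z - incr c z - (1/2) *\<^sub>R ?Q z (incr c z) (incr c z))
      (\<lambda>z. rho z ^ 3)"
    by (rule dominated_cong) (use eventually_in_chart[OF c s0 ys0] in eventually_elim,
      simp add: chart_log_diag[OF gauge c] chart_log_deriv2[OF gauge c] incr_def log_deriv2_def)
  have lin: "\<forall>\<^sub>F z in pairs T s0. (\<forall>v. linear (?Q z v)) \<and> (\<forall>w. linear (\<lambda>v. ?Q z v w))"
    using eventually_in_chart[OF c s0 ys0]
    by eventually_elim (use log_deriv2_linear1[OF gauge c] log_deriv2_linear2[OF gauge c] in blast)
  \<comment> \<open>In the quadratic term the coordinate increment is replaced by the velocity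
    applied to the increment of \<open>x\<close>, one slot at a time; each replacement costs
    \<open>rho z ^ 2 * rho z\<close>.\<close>
  have "dominated (pairs T s0) (\<lambda>z. ?Q z (incr c z - ?v z) (incr c z)) (\<lambda>z. 1 * rho z ^ 2 * rho z)"
    and "dominated (pairs T s0) (\<lambda>z. ?Q z (?v z) (incr c z - ?v z)) (\<lambda>z. 1 * rho z * rho z ^ 2)"
    by (rule dominated_bilinear[OF lin log_deriv2_bounded incv inc] dominated_bilinear[OF lin
        log_deriv2_bounded vdx incv])+
  then have "dominated (pairs T s0) (\<lambda>z. ?Q z (incr c z - ?v z) (incr c z) + ?Q z (?v z) (incr c z - ?v
      z)) (\<lambda>z. rho z ^ 3)"
    by (intro dominated_add; elim dominated_eq) (simp_all add: power3_eq_cube power2_eq_square)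
  from dominated_add[OF T3 dominated_bounded_linear[OF bounded_linear_scaleR_right this, of "1/2"]]
  show ?thesis
  proof (rule dominated_cong, use eventually_in_chart[OF c s0 ys0] in eventually_elim)
    case (elim z)
    then have u: "eta c (fst z) \<in> snd c ` fst c" and s: "fst z \<in> {0..T}" by auto
    note l1 = log_deriv2_linear1[OF gauge c u] and l2 = log_deriv2_linear2[OF gauge c u] and vl =
        vel_linear[OF s, of c]
    define B where "B w w' = ?Q z (vel c (fst z) w) (vel c (fst z) w')" for w w'
    have B1: "linear (B w)" for w using linear_compose[OF vl l2] unfolding B_def o_def .
    have B2: "linear (\<lambda>w. B w w')" for w' using linear_compose[OF vl l1] unfolding B_def o_def .
    have Bs: "B w w' = B w' w" for w w' unfolding B_def by (rule log_deriv2_symmetric[OF gauge c u])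
    have tl: "tensor_lift (\<lambda>w w'. - B w w') (X (fst z) (snd z)) = - (1/2) *\<^sub>R B (dx z) (dx z)"
      using tensor_lift_symmetric[OF B1 B2 Bs rough_bounds(3)[of "fst z" "snd z"]] elim
        tensor_lift_linear[OF linear_uminus, of B "X (fst z) (snd z)"] by (simp add: dx_def linear_uminus)
    have "?Q z (incr c z - ?v z) (incr c z) + ?Q z (?v z) (incr c z - ?v z) = ?Q z (incr c z) (incr c z)
        - B (dx z) (dx z)"
      using linear_diff[OF l1[of "incr c z"], of "incr c z" "?v z"] linear_diff[OF l2[of "?v z"], of
          "incr c z" "?v z"] by (simp add: B_def)
    then show ?case unfolding B_def[symmetric] tl by (simp add: scaleR_diff_right)
  qed
qed

end

end

end

context controlled_manifold_path
begin

section \<open>The germ of the integral\<close>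

text \<open>The germ of the rough integral of the coordinate form along the coordinate path. It
  depends on the chart and is therefore used near one time only.\<close>

definition theta :: "('m, 'e) chart \<Rightarrow> ('m \<Rightarrow> ('m, 'e) tvec \<Rightarrow> 'v::real_normed_vector) \<Rightarrow> real \<times> real \<Rightarrow> 'v" where
  "theta c \<alpha> z = chart_form c \<alpha> (incr c z) (eta c (fst z)) +
    tensor_lift (\<lambda>w w'. form_deriv c \<alpha> (eta c (fst z)) (vel c (fst z) w) (vel c (fst z) w')) (X (fst z)
        (snd z))"

definition germ :: "('m \<Rightarrow> 'm \<Rightarrow> ('m, 'e) tvec) \<Rightarrow> ('m \<Rightarrow> 'm \<Rightarrow> ('m, 'e) tvec \<Rightarrow> ('m, 'e) tvec) \<Rightarrow>
    ('m \<Rightarrow> ('m, 'e) tvec \<Rightarrow> 'v::real_normed_vector) \<Rightarrow> real \<Rightarrow> real \<Rightarrow> 'v" where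
  "germ \<psi> U \<alpha> s t = \<alpha> (y s) (\<psi> (y s) (y t)
      + tensor_lift (\<lambda>w w'. gauge_tensor A \<psi> U (y s) (y' s w) (y' s w')) (X s t))
    + tensor_lift (\<lambda>w w'. cov_deriv_form A U \<alpha> (y s) (y' s w) (y' s w')) (X s t)"

context
  fixes \<alpha> :: "'m \<Rightarrow> ('m, 'e) tvec \<Rightarrow> 'v::banach"
  assumes form: "smooth_one_form A \<alpha>"
begin

context
  fixes c s0
  assumes c: "c \<in> A" and s0: "s0 \<in> {0..T}" and ys0: "y s0 \<in> fst c"
begin

lemma chart_form_bounded:
  "dominated (pairs T s0) (\<lambda>z. chart_form c \<alpha> b (eta c (fst z))) (\<lambda>z. 1)"
  "dominated (pairs T s0) (\<lambda>z. chart_form c \<alpha> b (eta c (snd z))) (\<lambda>z. 1)"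
  "dominated (pairs T s0) (\<lambda>z. chart_form c \<alpha> b (eta c (snd z)) - chart_form c \<alpha> b (eta c (fst z))) rho"
  using smooth_eta_dominated[OF c s0 ys0 chart_form_smooth[OF form c]] by auto

lemma chart_form_taylor:
  "dominated (pairs T s0) (\<lambda>z. chart_form c \<alpha> b (eta c (snd z)) - chart_form c \<alpha> b (eta c (fst z))
     - form_deriv c \<alpha> (eta c (fst z)) (incr c z) b) (\<lambda>z. rho z ^ 2)"
  using smooth_eta_dominated(4)[OF c s0 ys0 chart_form_smooth[OF form c]] by (simp add: form_deriv_def)

lemma form_deriv_bounded:
  "dominated (pairs T s0) (\<lambda>z. form_deriv c \<alpha> (eta c (fst z)) b b') (\<lambda>z. 1)"
  "dominated (pairs T s0) (\<lambda>z. form_deriv c \<alpha> (eta c (snd z)) b b') (\<lambda>z. 1)"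
  "dominated (pairs T s0) (\<lambda>z. form_deriv c \<alpha> (eta c (snd z)) b b' - form_deriv c \<alpha> (eta c (fst z)) b b') rho"
  unfolding form_deriv_def
  using smooth_eta_dominated[OF c s0 ys0 smooth_on_deriv[OF chart_form_smooth[OF form c]]] by auto

lemma eventually_chart_form_linear_path:
  "\<forall>\<^sub>F z in pairs T s0. linear (\<lambda>e. chart_form c \<alpha> e (eta c (fst z)))"
  "\<forall>\<^sub>F z in pairs T s0. linear (\<lambda>e. chart_form c \<alpha> e (eta c (snd z)))"
  using eventually_in_chart[OF c s0 ys0] by (auto elim!: eventually_mono intro: chart_form_linear[OF form c])

lemma chart_form_dominated:
  "dominated (pairs T s0) e q \<Longrightarrow> dominated (pairs T s0) (\<lambda>z. chart_form c \<alpha> (e z) (eta c (fst z))) q"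
  "dominated (pairs T s0) e q \<Longrightarrow> dominated (pairs T s0) (\<lambda>z. chart_form c \<alpha> (e z) (eta c (snd z))) q"
  using dominated_linear[where L = "\<lambda>z e. chart_form c \<alpha> e (eta c (fst z))", OF
      eventually_chart_form_linear_path(1) chart_form_bounded(1), of e q]
    dominated_linear[where L = "\<lambda>z e. chart_form c \<alpha> e (eta c (snd z))", OF
        eventually_chart_form_linear_path(2) chart_form_bounded(2), of e q]
  by simp_all

lemma eventually_form_deriv_linear:
  "\<forall>\<^sub>F z in pairs T s0. (\<forall>v. linear (form_deriv c \<alpha> (eta c (fst z)) v)) \<and> (\<forall>w. linear (\<lambda>v. form_deriv c
      \<alpha> (eta c (fst z)) v w))"
  using eventually_in_chart[OF c s0 ys0]
  by eventually_elim (use form_deriv_linear1[OF form c] form_deriv_linear2[OF form c] in blast)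

lemma form_deriv_vel_diff:
  "dominated (pairs T s0) (\<lambda>z. form_deriv c \<alpha> (eta c (snd z)) (vel c (snd z) w) (vel c (snd z) w')
     - form_deriv c \<alpha> (eta c (fst z)) (vel c (fst z) w) (vel c (fst z) w')) rho"
  by (rule bilinear_velocity_diff_dominated[OF c s0 ys0 form_deriv_linear2[OF form c]
      form_deriv_linear1[OF form c]
      form_deriv_bounded(1,3) vel_bounded[OF c s0 ys0] vel_diff_dominated[OF c s0 ys0] vel_bounded[OF c
          s0 ys0] vel_diff_dominated[OF c s0 ys0]])

lemma form_velocity_diff_dominated:
  "dominated (pairs T s0) (\<lambda>z. chart_form c \<alpha> (vel c (snd z) w) (eta c (snd z)) - chart_form c \<alpha> (vel c
      (fst z) w) (eta c (fst z))) rho"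
proof -
  have lin: "\<forall>\<^sub>F z in pairs T s0. linear (\<lambda>e. chart_form c \<alpha> e (eta c (snd z)) - chart_form c \<alpha> e (eta c
      (fst z)))"
    using eventually_chart_form_linear_path by eventually_elim (rule linear_compose_sub)
  have "dominated (pairs T s0) (\<lambda>z. chart_form c \<alpha> (vel c (snd z) w) (eta c (snd z)) - chart_form c \<alpha>
      (vel c (snd z) w) (eta c (fst z))) (\<lambda>z. rho z * 1)"
    by (rule dominated_linear[where L = "\<lambda>z e. chart_form c \<alpha> e (eta c (snd z)) - chart_form c \<alpha> e (eta
        c (fst z))", OF lin chart_form_bounded(3) vel_bounded(2)[OF c s0 ys0]])
  from dominated_add[OF this[simplified] chart_form_dominated(1)[OF vel_diff_dominated[OF c s0 ys0], of w]]
  show ?thesis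
  proof (rule dominated_cong, use eventually_chart_form_linear_path(1) in eventually_elim)
    case (elim z)
    show ?case using linear_diff[OF elim, of "vel c (snd z) w" "vel c (fst z) w"] by simp
  qed
qed

lemma tensor_lift_form_deriv_dominated:
  "dominated (pairs T s0) (\<lambda>z. tensor_lift (\<lambda>w w'. form_deriv c \<alpha> (eta c (fst z)) (vel c (fst z) w) (vel
      c (fst z) w')) (X (fst z) (snd z)))
    (\<lambda>z. rho z ^ 2)"
proof -
  have "dominated (pairs T s0) (\<lambda>z. form_deriv c \<alpha> (eta c (fst z)) (vel c (fst z) w) (vel c (fst z) w'))
      (\<lambda>z. 1 * 1 * 1)" for w w'
    by (rule dominated_bilinear[where B = "\<lambda>z. form_deriv c \<alpha> (eta c (fst z))", OF
        eventually_form_deriv_linear form_deriv_bounded(1) vel_bounded(1)[OF c s0 ys0] vel_bounded(1)[OF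
        c s0 ys0]])
  from dominated_tensor_lift[where B = "\<lambda>z w w'. form_deriv c \<alpha> (eta c (fst z)) (vel c (fst z) w) (vel c
      (fst z) w')", OF this X_dominated]
  show ?thesis by simp
qed

text \<open>The tensor term is of second order, and so is the difference between the increment and
  the velocity applied to \<open>dx\<close>. This is the source of the derivative component of the
  integral.\<close>

lemma theta_first_order:
  "dominated (pairs T s0) (\<lambda>z. theta c \<alpha> z - chart_form c \<alpha> (vel c (fst z) (dx z)) (eta c (fst z))) (\<lambda>z.
      rho z ^ 2)"
  using dominated_add[OF chart_form_dominated(1)[OF incr_vel_dominated[OF c s0 ys0]]
      tensor_lift_form_deriv_dominated]
proof (rule dominated_cong, use eventually_chart_form_linear_path(1) in eventually_elim)
  case (elim z)
  show ?case using linear_diff[OF elim, of "incr c z" "vel c (fst z) (dx z)"] by (simp add: theta_def)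
qed

context
  fixes D \<psi> U
  assumes gauge: "geometric_gauge A D \<psi> U"
begin

text \<open>The difference of the two germs is, exactly, the coordinate form applied to the gauge
  remainder. The proof verifies this identity near \<open>s0\<close>; the order then comes from the
  remainder, because the form is a bounded family of linear maps.\<close>

lemma germ_theta_dominated:
  "dominated (pairs T s0) (\<lambda>z. germ \<psi> U \<alpha> (fst z) (snd z) - theta c \<alpha> z) (\<lambda>z. rho z ^ 3)"
proof (rule dominated_cong[OF chart_form_dominated(1)[OF gauge_remainder_dominated[OF c s0 ys0 gauge]]],
    use eventually_in_chart[OF c s0 ys0] eventually_diagonal_domain[OF s0 gauge_dom[OF gauge c]] in
        eventually_elim)
  case (elim z)
  define s t where "s = fst z" and "t = snd z"
  have s: "s \<in> {0..T}" and ys: "y s \<in> fst c" and yt: "y t \<in> fst c" and D: "(y s, y t) \<in> D" and u: "eta c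
      s \<in> snd c ` fst c"
    using elim by (auto simp: s_def t_def)
  let ?u = "eta c s"
  let ?Q = "\<lambda>w w'. log_deriv2 c \<psi> ?u (vel c s w) (vel c s w')" and ?P = "\<lambda>w w'. par_deriv c U ?u (vel c
      s w) (vel c s w')"
    and ?F = "\<lambda>w w'. form_deriv c \<alpha> ?u (vel c s w) (vel c s w')"
  let ?\<beta> = "\<lambda>e. chart_form c \<alpha> e ?u" and ?log = "chart_log c \<psi> (?u, eta c t)"
  have l: "linear ?\<beta>" by (rule chart_form_linear[OF form c u])
  have gt: "gauge_tensor A \<psi> U (y s) (y' s w) (y' s w') = coord_vec A c (y s) (- ?Q w w' - ?P w w')" for w w'
    using gauge_tensor_coord[OF gauge c ys y'_tspace[OF s] y'_tspace[OF s]] by (simp add: vel_def eta_def)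
  have cd: "cov_deriv_form A U \<alpha> (y s) (y' s w) (y' s w') = ?F w w' + ?\<beta> (?P w w')" for w w'
    using cov_deriv_form_coord[OF gauge c form ys y'_tspace[OF s] y'_tspace[OF s]] by (simp add: vel_def
        eta_def)
  define V where "V = \<psi> (y s) (y t) + tensor_lift (\<lambda>w w'. gauge_tensor A \<psi> U (y s) (y' s w) (y' s w'))
      (X s t)"
  have "V \<in> tspace A (y s)" unfolding V_def gt
    by (intro tspace_add log_tspace[OF gauge c D] tensor_lift_tspace coord_vec_tspace[OF c ys])
  from form_coord[OF form c ys this] have 1: "\<alpha> (y s) V = ?\<beta> (V c)" by (simp add: eta_def)
  have "V c = ?log + tensor_lift (\<lambda>w w'. - ?Q w w' - ?P w w') (X s t)"
    unfolding V_def gt by (simp add: tensor_lift_apply c ys log_coord[OF gauge c D ys yt] eta_def)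
  then have 2: "V c = (?log + tensor_lift (\<lambda>w w'. - ?Q w w') (X s t)) - tensor_lift ?P (X s t)"
    by (simp add: tensor_lift_diff)
  have "germ \<psi> U \<alpha> s t = ?\<beta> (V c) + (tensor_lift ?F (X s t) + ?\<beta> (tensor_lift ?P (X s t)))"
    unfolding germ_def V_def[symmetric] 1 cd tensor_lift_sum2 tensor_lift_linear[OF l] ..
  also have "\<dots> = ?\<beta> (?log + tensor_lift (\<lambda>w w'. - ?Q w w') (X s t)) + tensor_lift ?F (X s t)"
    unfolding 2 linear_diff[OF l] by simp
  finally show ?case unfolding linear_diff[OF l, unfolded s_def] theta_def s_def t_def by simp
qed

lemma germ_first_order:
  "dominated (pairs T s0) (\<lambda>z. germ \<psi> U \<alpha> (fst z) (snd z) - \<alpha> (y (fst z)) (y' (fst z) (x (snd z) - x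
      (fst z)))) (\<lambda>z. rho z ^ 2)"
  using dominated_add[OF dominated_trans[OF germ_theta_dominated rho_power_dominated[OF s0]]
      theta_first_order]
proof (rule dominated_cong, simp, use eventually_in_chart[OF c s0 ys0] in eventually_elim)
  case (elim z)
  then have "fst z \<in> {0..T}" by auto
  from form_coord[OF form c _ y'_tspace[OF this]] elim show ?case by (simp add: vel_def eta_def dx_def)
qed

end

lemma triples_rho_mono:
  "dominated (triples T s0) (\<lambda>z. rho (fst z, fst (snd z))) (\<lambda>z. rho (fst z, snd (snd z)))"
  "dominated (triples T s0) (\<lambda>z. rho (fst (snd z), snd (snd z))) (\<lambda>z. rho (fst z, snd (snd z)))"
proof -
  have le: "rho (a, b) \<le> rho (s, t)" if "0 \<le> s" "s \<le> a" "a \<le> b" "b \<le> t" "t \<le> T" for a b s t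
    unfolding rho_def using that p control_mono[OF ctrl that] control_nonneg[OF ctrl, of a b]
    by (intro powr_mono2) auto
  show "dominated (triples T s0) (\<lambda>z. rho (fst z, fst (snd z))) (\<lambda>z. rho (fst z, snd (snd z)))"
    "dominated (triples T s0) (\<lambda>z. rho (fst (snd z), snd (snd z))) (\<lambda>z. rho (fst z, snd (snd z)))"
    by (rule dominatedI[where C = 1], use eventually_triples_order[of T s0] in eventually_elim, auto
        simp: rho_nonneg intro!: le)+
qed

lemma dominated_left:
  assumes "dominated (pairs T s0) f (\<lambda>z. rho z ^ n)"
  shows "dominated (triples T s0) (\<lambda>z. f (fst z, fst (snd z))) (\<lambda>z. rho (fst z, snd (snd z)) ^ n)"
  by (rule dominated_trans[OF dominated_compose[OF assms triples_pairs(1)] dominated_power[OF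
      triples_rho_mono(1)]])

lemma dominated_right:
  assumes "dominated (pairs T s0) f (\<lambda>z. rho z ^ n)"
  shows "dominated (triples T s0) (\<lambda>z. f (fst (snd z), snd (snd z))) (\<lambda>z. rho (fst z, snd (snd z)) ^ n)"
  by (rule dominated_trans[OF dominated_compose[OF assms triples_pairs(2)] dominated_power[OF
      triples_rho_mono(2)]])

lemma dominated_outer:
  assumes "dominated (pairs T s0) f (\<lambda>z. rho z ^ n)"
  shows "dominated (triples T s0) (\<lambda>z. f (fst z, snd (snd z))) (\<lambda>z. rho (fst z, snd (snd z)) ^ n)"
  by (rule dominated_compose[OF assms triples_pairs(3)])

text \<open>The defect is minus the sum of four third order terms. \<open>A\<close> is the Taylor
  remainder of the form between \<open>s\<close> and \<open>r\<close>, evaluated on the increment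
  over \<open>[r, t]\<close>; \<open>B1\<close> and \<open>B2\<close> compare the product of
  coordinate increments with the cross term of Chen's relation; \<open>C\<close> moves the base
  point of the lifted derivative from \<open>s\<close> to \<open>r\<close>.\<close>

lemma theta_defect_dominated:
  "dominated (triples T s0) (\<lambda>z. theta c \<alpha> (fst z, snd (snd z)) - theta c \<alpha> (fst z, fst (snd z)) - theta
      c \<alpha> (fst (snd z), snd (snd z)))
    (\<lambda>z. rho (fst z, snd (snd z)) ^ 3)"
proof -
  let ?r = "\<lambda>z. rho (fst z, snd (snd z))"
  let ?a = "\<lambda>z. (fst z, fst (snd z))" and ?b = "\<lambda>z. (fst (snd z), snd (snd z))"
  let ?\<beta>s = "\<lambda>z e. chart_form c \<alpha> e (eta c (fst z))" and ?\<beta>r = "\<lambda>z e. chart_form c \<alpha> e (eta c (fst (snd z)))"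
  let ?F = "\<lambda>z. form_deriv c \<alpha> (eta c (fst z))"
  let ?FX = "\<lambda>s w w'. form_deriv c \<alpha> (eta c s) (vel c s w) (vel c s w')"
  have evc: "\<forall>\<^sub>F z in triples T s0. eta c (fst z) \<in> snd c ` fst c \<and> eta c (fst (snd z)) \<in> snd c ` fst c"
    using eventually_compose_filterlim[OF eventually_in_chart[OF c s0 ys0] triples_pairs(1)] by
        eventually_elim simp
  have lF: "\<forall>\<^sub>F z in triples T s0. (\<forall>v. linear (?F z v)) \<and> (\<forall>w. linear (\<lambda>v. ?F z v w))"
    using eventually_compose_filterlim[OF eventually_form_deriv_linear triples_pairs(1)] by simp
  have F1: "dominated (triples T s0) (\<lambda>z. ?F z b b') (\<lambda>z. 1)" for b b'
    using dominated_compose[OF form_deriv_bounded(1) triples_pairs(1)] by simp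
  have "linear (\<lambda>e. chart_form c \<alpha> e u' - chart_form c \<alpha> e u - form_deriv c \<alpha> u v e)" 
    if "u \<in> snd c ` fst c" "u' \<in> snd c ` fst c" for u u' v
    using that by (intro linear_compose_sub chart_form_linear[OF form c] form_deriv_linear2[OF form c])
  then have lA: "\<forall>\<^sub>F z in triples T s0. linear (\<lambda>e. ?\<beta>r z e - ?\<beta>s z e - ?F z (incr c (?a z)) e)"
    using evc by (auto elim: eventually_mono)
  have A: "dominated (triples T s0) (\<lambda>z. ?\<beta>r z (incr c (?b z)) - ?\<beta>s z (incr c (?b z)) - ?F z (incr c
      (?a z)) (incr c (?b z))) (\<lambda>z. ?r z ^ 3)"
  proof -
    have 1: "dominated (triples T s0) (\<lambda>z. ?\<beta>r z b - ?\<beta>s z b - ?F z (incr c (?a z)) b) (\<lambda>z. ?r z ^ 2)" for b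
      using dominated_left[OF chart_form_taylor] by simp
    have 2: "dominated (triples T s0) (\<lambda>z. incr c (?b z)) ?r"
      using dominated_right[of "incr c" 1] incr_dominated[OF c s0 ys0] by simp
    show ?thesis
      by (rule dominated_eq[OF dominated_linear[where L = "\<lambda>z e. ?\<beta>r z e - ?\<beta>s z e - ?F z (incr c (?a
          z)) e", OF lA 1 2]])
        (simp add: power3_eq_cube power2_eq_square)
  qed
  let ?va = "\<lambda>z. vel c (fst z) (dx (?a z))" and ?vb = "\<lambda>z. vel c (fst z) (dx (?b z))"
  have va: "dominated (triples T s0) ?va ?r"
    using dominated_left[of "\<lambda>z. vel c (fst z) (dx z)" 1] vel_dx_dominated[OF c s0 ys0] by simp
  have ia: "dominated (triples T s0) (\<lambda>z. incr c (?a z) - ?va z) (\<lambda>z. ?r z ^ 2)"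
    using dominated_left[OF incr_vel_dominated[OF c s0 ys0]] by simp
  have ib: "dominated (triples T s0) (\<lambda>z. incr c (?b z)) ?r"
    using dominated_right[of "incr c" 1] incr_dominated[OF c s0 ys0] by simp
  have vl: "\<forall>\<^sub>F z in triples T s0. linear (vel c (fst z)) \<and> linear (vel c (fst (snd z)))"
    using eventually_compose_filterlim[OF eventually_vel_linear[OF c s0 ys0] triples_pairs(1)] by simp
  \<comment> \<open>The increment over \<open>[r, t]\<close> is compared with the velocity at
    \<open>s\<close>, because the cross term of Chen's relation is evaluated there; moving the
    velocity from \<open>r\<close> to \<open>s\<close> costs \<open>rho\<close> times
    \<open>rho\<close>.\<close>
  have ivb: "dominated (triples T s0) (\<lambda>z. incr c (?b z) - ?vb z) (\<lambda>z. ?r z ^ 2)"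
  proof -
    have 1: "dominated (triples T s0) (\<lambda>z. incr c (?b z) - vel c (fst (snd z)) (dx (?b z))) (\<lambda>z. ?r z ^ 2)"
      using dominated_right[OF incr_vel_dominated[OF c s0 ys0]] by simp
    have d: "dominated (triples T s0) (\<lambda>z. dx (?b z)) ?r"
      using dominated_right[of dx 1] dx_dominated by simp
    have v: "dominated (triples T s0) (\<lambda>z. vel c (fst (snd z)) w - vel c (fst z) w) ?r" for w
      using dominated_left[of "\<lambda>z. vel c (snd z) w - vel c (fst z) w" 1] vel_diff_dominated[OF c s0 ys0]
          by simp
    have "\<forall>\<^sub>F z in triples T s0. linear (\<lambda>w. vel c (fst (snd z)) w - vel c (fst z) w)"
      using vl by eventually_elim (auto intro: linear_compose_sub)
    from dominated_linear_axis[where L = "\<lambda>z w. vel c (fst (snd z)) w - vel c (fst z) w", OF this v d]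
    have "dominated (triples T s0) (\<lambda>z. vel c (fst (snd z)) (dx (?b z)) - ?vb z) (\<lambda>z. ?r z ^ 2)"
      by (simp add: power2_eq_square)
    from dominated_add[OF 1 this] show ?thesis by simp
  qed
  have B1: "dominated (triples T s0) (\<lambda>z. ?F z (incr c (?a z) - ?va z) (incr c (?b z))) (\<lambda>z. ?r z ^ 3)"
    by (rule dominated_eq[OF dominated_bilinear[where B = ?F, OF lF F1 ia ib]]) (simp add:
        power3_eq_cube power2_eq_square)
  have B2: "dominated (triples T s0) (\<lambda>z. ?F z (?va z) (incr c (?b z) - ?vb z)) (\<lambda>z. ?r z ^ 3)"
    by (rule dominated_eq[OF dominated_bilinear[where B = ?F, OF lF F1 va ivb]]) (simp add:
        power3_eq_cube power2_eq_square)
  have C: "dominated (triples T s0) (\<lambda>z. tensor_lift (\<lambda>w w'. ?FX (fst (snd z)) w w' - ?FX (fst z) w w')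
      (X (fst (snd z)) (snd (snd z)))) (\<lambda>z. ?r z ^ 3)"
  proof -
    have 1: "dominated (triples T s0) (\<lambda>z. ?FX (fst (snd z)) w w' - ?FX (fst z) w w') ?r" for w w'
      using dominated_left[of "\<lambda>z. ?FX (snd z) w w' - ?FX (fst z) w w'" 1] form_deriv_vel_diff by simp
    have 2: "dominated (triples T s0) (\<lambda>z. X (fst (snd z)) (snd (snd z))) (\<lambda>z. ?r z ^ 2)"
      using dominated_right[OF X_dominated] by simp
    show ?thesis
      by (rule dominated_eq[OF dominated_tensor_lift[where B = "\<lambda>z w w'. ?FX (fst (snd z)) w w' - ?FX
          (fst z) w w'", OF 1 2]])
        (simp add: power3_eq_cube power2_eq_square)
  qed
  from dominated_minus[OF dominated_add[OF A dominated_add[OF B1 dominated_add[OF B2 C]]]]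
  show ?thesis
  proof (rule dominated_cong, use evc vl lF eventually_triples_order[of T s0] in eventually_elim)
    case (elim z)
    define s r t where "s = fst z" and "r = fst (snd z)" and "t = snd (snd z)"
    have o: "0 \<le> s" "s \<le> r" "r \<le> t" "t \<le> T" using elim by (auto simp: s_def r_def t_def)
    let ?\<beta> = "\<lambda>e. chart_form c \<alpha> e (eta c s)" and ?G = "form_deriv c \<alpha> (eta c s)"
    have l: "linear ?\<beta>" using elim chart_form_linear[OF form c] by (simp add: s_def)
    have l1: "linear (\<lambda>v. ?G v w)" and l2: "linear (?G v)" for v w using elim by (auto simp: s_def)
    have vs: "linear (vel c s)" using elim by (simp add: s_def)
    have FX: "linear (?FX s w)" "linear (\<lambda>w. ?FX s w w')" for w w'
      using linear_compose[OF vs l2] linear_compose[OF vs l1] by (auto simp: o_def)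
    have i: "incr c (s, t) = incr c (s, r) + incr c (r, t)" by (simp add: incr_def)
    \<comment> \<open>Chen's relation: the cross term is a simple tensor, so its lift is the
      bilinear form itself.\<close>
    have "tensor_lift (?FX s) (X s t) = tensor_lift (?FX s) (X s r) + tensor_lift (?FX s) (X r t) + ?FX
        s (dx (s, r)) (dx (r, t))"
      unfolding chen[OF o] tensor_lift_add tensor_lift_tensor[OF FX] by (simp add: dx_def)
    then show ?case unfolding s_def[symmetric] r_def[symmetric] t_def[symmetric] theta_def tensor_lift_diff
      using linear_diff[OF l1[of "incr c (r, t)"], of "incr c (s, r)" "vel c s (dx (s, r))"]
        linear_diff[OF l2[of "vel c s (dx (s, r))"], of "incr c (r, t)" "vel c s (dx (r, t))"]
      by (simp add: i linear_add[OF l] algebra_simps)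
  qed
qed

text \<open>All three intervals lie near \<open>s0\<close>, so their germs can be compared with
  \<open>theta\<close> in one chart.\<close>

lemma germ_defect_dominated:
  assumes gauge: "geometric_gauge A D \<psi> U"
  shows "dominated (triples T s0) (\<lambda>z. germ \<psi> U \<alpha> (fst z) (snd (snd z)) - germ \<psi> U \<alpha> (fst z) (fst (snd
      z)) - germ \<psi> U \<alpha> (fst (snd z)) (snd (snd z)))
    (\<lambda>z. rho (fst z, snd (snd z)) ^ 3)"
proof -
  note g = germ_theta_dominated[OF gauge]
  from dominated_add[OF dominated_diff[OF dominated_diff[OF dominated_outer[OF g] dominated_left[OF g]]
      dominated_right[OF g]] theta_defect_dominated]
  show ?thesis by (simp add: algebra_simps)
qed

end

end

end

section \<open>Existence, uniqueness and gauge invariance\<close>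

lemma dominated_blinfun:
  fixes L :: "'i \<Rightarrow> 'e::euclidean_space \<Rightarrow>\<^sub>L 'v::real_normed_vector"
  assumes "\<And>b. b \<in> Basis \<Longrightarrow> dominated G (\<lambda>z. blinfun_apply (L z) b) q"
  shows "dominated G L q"
proof (rule dominated_trans)
  show "dominated G L (\<lambda>z. \<Sum>b\<in>Basis. norm (blinfun_apply (L z) b))"
    by (rule dominatedI[where C = 1, OF always_eventually])
      (simp add: norm_blinfun_euclidean_le abs_of_nonneg sum_nonneg)
  show "dominated G (\<lambda>z. \<Sum>b\<in>Basis. norm (blinfun_apply (L z) b)) q"
    by (intro dominated_sum finite_Basis) (simp add: dominated_norm assms)
qed

lemma dominated_bilinear_uniform:
  fixes B :: "'i \<Rightarrow> 'e::euclidean_space \<Rightarrow> 'f::euclidean_space \<Rightarrow> 'b::real_normed_vector"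
  assumes l1: "\<forall>\<^sub>F z in G. \<forall>w. linear (\<lambda>v. B z v w)" and l2: "\<forall>\<^sub>F z in G. \<forall>v. linear (B z v)"
    and B: "\<And>v w. dominated G (\<lambda>z. B z v w) q"
  obtains C where "C \<ge> 0" "\<forall>\<^sub>F z in G. \<forall>v w. norm (B z v w) \<le> C * \<bar>q z\<bar> * norm v * norm w"
proof -
  have "\<exists>C. C \<ge> 0 \<and> (\<forall>\<^sub>F z in G. \<forall>w. norm (B z b w) \<le> C * \<bar>q z\<bar> * norm w)" for b
  proof (rule dominated_linear_uniform[where L = "\<lambda>z. B z b" and G = G and q = q])
    show "\<forall>\<^sub>F z in G. linear (B z b)" using l2 by eventually_elim simp
  qed (use B in auto)
  then have "\<forall>b. \<exists>C. C \<ge> 0 \<and> (\<forall>\<^sub>F z in G. \<forall>w. norm (B z b w) \<le> C * \<bar>q z\<bar> * norm w)" by (rule allI)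
  from choice[OF this] obtain C where C0: "\<forall>b. C b \<ge> 0 \<and> (\<forall>\<^sub>F z in G. \<forall>w. norm (B z b w) \<le> C b * \<bar>q z\<bar> *
      norm w)" ..
  have C: "C b \<ge> 0" "\<forall>\<^sub>F z in G. \<forall>w. norm (B z b w) \<le> C b * \<bar>q z\<bar> * norm w" for b
    using C0[rule_format, of b] by simp_all
  have "\<forall>\<^sub>F z in G. \<forall>b\<in>Basis. \<forall>w. norm (B z b w) \<le> C b * \<bar>q z\<bar> * norm w"
    using C(2) by (intro eventually_ball_finite) auto
  then have "\<forall>\<^sub>F z in G. \<forall>v w. norm (B z v w) \<le> (\<Sum>b\<in>Basis. C b) * \<bar>q z\<bar> * norm v * norm w"
    using l1
  proof eventually_elim
    case (elim z)
    show ?case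
    proof (intro allI)
      fix v w
      have lin: "linear (\<lambda>v. B z v w)" using elim(2) by simp
      have "norm (B z v w) = norm (\<Sum>b\<in>Basis. (v \<bullet> b) *\<^sub>R B z b w)"
        by (rule arg_cong[where f = norm], rule linear_euclidean_expand[OF lin])
      also have "\<dots> \<le> (\<Sum>b\<in>Basis. C b * (\<bar>q z\<bar> * norm v * norm w))"
      proof (rule sum_norm_le)
        fix b :: 'e assume b: "b \<in> Basis"
        have "\<bar>v \<bullet> b\<bar> * norm (B z b w) \<le> norm v * (C b * \<bar>q z\<bar> * norm w)"
          using Basis_le_norm[OF b, of v] elim(1) b by (intro mult_mono) auto
        then show "norm ((v \<bullet> b) *\<^sub>R B z b w) \<le> C b * (\<bar>q z\<bar> * norm v * norm w)" by (simp add: mult_ac)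
      qed
      finally show "norm (B z v w) \<le> (\<Sum>b\<in>Basis. C b) * \<bar>q z\<bar> * norm v * norm w" by (simp add:
          sum_distrib_right mult.assoc)
    qed
  qed
  then show ?thesis using C(1) by (intro that[of "\<Sum>b\<in>Basis. C b"] sum_nonneg) auto
qed

text \<open>The sewn path is estimated on short intervals, whereas \<open>CRP\<close> asks for all
  of them. Induction on the number of steps of length \<open>\<delta>\<close> extends the estimates;
  the final constant depends on \<open>T / \<delta>\<close>.\<close>

lemma controlled_local_to_global:
  fixes z :: "real \<Rightarrow> 'v::real_normed_vector" and z' :: "real \<Rightarrow> 'w::real_normed_vector \<Rightarrow>\<^sub>L 'v"
  assumes ctrl: "control T \<omega>" and p: "0 < p" and \<delta>: "0 < \<delta>" and C: "0 \<le> C"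
    and x: "\<And>s t. 0 \<le> s \<Longrightarrow> s \<le> t \<Longrightarrow> t \<le> T \<Longrightarrow> norm (x t - x s) \<le> \<omega> s t powr (1 / p)"
    and z: "\<And>s t. 0 \<le> s \<Longrightarrow> s \<le> t \<Longrightarrow> t \<le> T \<Longrightarrow> t - s \<le> \<delta> \<Longrightarrow>
      norm (z t - z s - blinfun_apply (z' s) (x t - x s)) \<le> C * \<omega> s t powr (2 / p)"
    and z': "\<And>s t. 0 \<le> s \<Longrightarrow> s \<le> t \<Longrightarrow> t \<le> T \<Longrightarrow> t - s \<le> \<delta> \<Longrightarrow> norm (z' t - z' s) \<le> C * \<omega> s t powr (1 / p)"
  shows "\<exists>C. \<forall>s t. 0 \<le> s \<and> s \<le> t \<and> t \<le> T \<longrightarrow>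
    norm (z t - z s - blinfun_apply (z' s) (x t - x s)) \<le> C * \<omega> s t powr (2 / p) \<and>
    norm (z' t - z' s) \<le> C * \<omega> s t powr (1 / p)"
proof -
  have "\<exists>K\<ge>0. \<forall>s t. 0 \<le> s \<and> s \<le> t \<and> t \<le> T \<and> t - s \<le> real (Suc n) * \<delta> \<longrightarrow>
    norm (z t - z s - blinfun_apply (z' s) (x t - x s)) \<le> K * \<omega> s t powr (2 / p) \<and>
    norm (z' t - z' s) \<le> K * \<omega> s t powr (1 / p)" for n
  proof (induction n)
    case 0 then show ?case using z z' C by (intro exI[of _ C]) auto
  next
    case (Suc n)
    then obtain K where K: "K \<ge> 0"
      "\<And>s t. 0 \<le> s \<Longrightarrow> s \<le> t \<Longrightarrow> t \<le> T \<Longrightarrow> t - s \<le> real (Suc n) * \<delta> \<Longrightarrow> norm (z t - z s - blinfun_apply (z' s)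
          (x t - x s)) \<le> K * \<omega> s t powr (2 / p)"
      "\<And>s t. 0 \<le> s \<Longrightarrow> s \<le> t \<Longrightarrow> t \<le> T \<Longrightarrow> t - s \<le> real (Suc n) * \<delta> \<Longrightarrow> norm (z' t - z' s) \<le> K * \<omega> s t powr (1 / p)"
      by blast
    show ?case
    \<comment> \<open>\<open>K\<close> for the part up to \<open>r\<close>, \<open>C\<close> for the
      last step, and another \<open>K\<close> for changing the derivative from \<open>z' s\<close>
      to \<open>z' r\<close> on the last step, a product of two quantities of order
      \<open>\<omega> s t powr (1 / p)\<close>.\<close>
    proof (intro exI[of _ "K + C + K"] conjI allI impI)
      show "0 \<le> K + C + K" using K C by simp
      fix s t assume *: "0 \<le> s \<and> s \<le> t \<and> t \<le> T \<and> t - s \<le> real (Suc (Suc n)) * \<delta>"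
      \<comment> \<open>The last step has length at most \<open>\<delta>\<close>; on an interval
        that is already so short the cut degenerates to \<open>r = s\<close>.\<close>
      define r where "r = max s (t - \<delta>)"
      have r: "0 \<le> s" "s \<le> r" "r \<le> t" "t \<le> T" "0 \<le> r" "r \<le> T" "t - r \<le> \<delta>" "r - s \<le> real (Suc n) * \<delta>"
        using * \<delta> by (auto simp: r_def algebra_simps)
      have w: "\<omega> a b powr q \<le> \<omega> s t powr q" if "s \<le> a" "a \<le> b" "b \<le> t" "0 \<le> q" for a b q
        using that r by (intro powr_mono2 control_mono[OF ctrl] control_nonneg[OF ctrl]) auto
      have wm: "M * \<omega> a b powr q \<le> M * \<omega> s t powr q" if "s \<le> a" "a \<le> b" "b \<le> t" "0 \<le> q" "0 \<le> M" for a b q M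
        using w[OF that(1-4)] that(5) by (rule mult_left_mono)
      have p0: "0 \<le> 1 / p" "0 \<le> 2 / p" using p by auto
      have d1: "norm (z' r - z' s) \<le> K * \<omega> s t powr (1 / p)"
        using K(3)[OF r(1,2,6,8)] wm[OF order_refl r(2,3) p0(1) K(1)] by linarith
      have d2: "norm (z' t - z' r) \<le> C * \<omega> s t powr (1 / p)"
        using z'[OF r(5,3,4,7)] wm[OF r(2,3) order_refl p0(1) C] by linarith
      have nn: "0 \<le> K * \<omega> s t powr (1 / p)" using K by simp
      have "norm (z' t - z' s) \<le> norm (z' r - z' s) + norm (z' t - z' r)" 
        using norm_triangle_ineq[of "z' r - z' s" "z' t - z' r"] by simp
      also have "\<dots> \<le> (K + C + K) * \<omega> s t powr (1 / p)" using d1 d2 nn by (simp add: algebra_simps)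
      finally show "norm (z' t - z' s) \<le> (K + C + K) * \<omega> s t powr (1 / p)" .
      have e1: "norm (z r - z s - blinfun_apply (z' s) (x r - x s)) \<le> K * \<omega> s t powr (2 / p)"
        using K(2)[OF r(1,2,6,8)] wm[OF order_refl r(2,3) p0(2) K(1)] by linarith
      have e2: "norm (z t - z r - blinfun_apply (z' r) (x t - x r)) \<le> C * \<omega> s t powr (2 / p)"
        using z[OF r(5,3,4,7)] wm[OF r(2,3) order_refl p0(2) C] by linarith
      have "norm (x t - x r) \<le> \<omega> s t powr (1 / p)" using x[OF r(5,3,4)] w[OF r(2,3) order_refl p0(1)] by
          linarith
      then have "norm (z' r - z' s) * norm (x t - x r) \<le> (K * \<omega> s t powr (1 / p)) * \<omega> s t powr (1 / p)"
        using d1 nn by (intro mult_mono) auto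
      also have "\<dots> = K * \<omega> s t powr (2 / p)" by (simp add: powr_add[symmetric] mult.assoc)
      finally have e3: "norm (blinfun_apply (z' r - z' s) (x t - x r)) \<le> K * \<omega> s t powr (2 / p)"
        using norm_blinfun[of "z' r - z' s" "x t - x r"] by linarith
      have "z t - z s - blinfun_apply (z' s) (x t - x s) = (z r - z s - blinfun_apply (z' s) (x r - x s))
        + (z t - z r - blinfun_apply (z' r) (x t - x r)) + blinfun_apply (z' r - z' s) (x t - x r)"
        by (simp add: blinfun.diff_left blinfun.diff_right)
      then have "norm (z t - z s - blinfun_apply (z' s) (x t - x s)) \<le> K * \<omega> s t powr (2 / p) + C * \<omega> s
          t powr (2 / p) + K * \<omega> s t powr (2 / p)"
        by (simp only:) (intro norm_triangle_mono e1 e2 e3)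
      then show "norm (z t - z s - blinfun_apply (z' s) (x t - x s)) \<le> (K + C + K) * \<omega> s t powr (2 / p)"
        by (simp add: algebra_simps)
    qed
  qed
  note step = this
  obtain n where "T / \<delta> \<le> real n" using real_arch_simple by blast
  then have "T \<le> real n * \<delta>" using \<delta> by (simp add: field_simps)
  then have n: "t - s \<le> real (Suc n) * \<delta>" if "0 \<le> s" "t \<le> T" for s t
    using that \<delta> by (simp add: algebra_simps)
  from step[of n] n show ?thesis by blast
qed

section \<open>The form along the path and its integral\<close>

context controlled_manifold_path
begin

lemma continuous_of_increments:
  fixes f :: "real \<Rightarrow> 'b::real_normed_vector"
  assumes f: "\<And>s0. s0 \<in> {0..T} \<Longrightarrow> dominated (pairs T s0) (\<lambda>z. f (snd z) - f (fst z)) rho"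
  shows "continuous_on {0..T} f"
  unfolding continuous_on_iff
proof (intro ballI allI impI)
  fix s0 and e :: real assume s0: "s0 \<in> {0..T}" and e: "e > 0"
  obtain C where C: "C \<ge> 0" "\<forall>\<^sub>F z in pairs T s0. norm (f (snd z) - f (fst z)) \<le> C * \<bar>rho z\<bar>"
    by (rule dominated_nonneg[OF f[OF s0]])
  have "((\<lambda>z. C * \<bar>rho z\<bar>) \<longlongrightarrow> C * \<bar>0\<bar>) (pairs T s0)" by (intro tendsto_intros rho_tendsto s0)
  then have "\<forall>\<^sub>F z in pairs T s0. C * \<bar>rho z\<bar> < e" using e by (intro order_tendstoD(2)) auto
  with C(2) have "\<forall>\<^sub>F z in pairs T s0. norm (f (snd z) - f (fst z)) < e" by eventually_elim linarith
  from eventually_pairsD[OF this] obtain d where d: "d > 0"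
    "\<And>s t. \<bar>s - s0\<bar> < d \<Longrightarrow> \<bar>t - s0\<bar> < d \<Longrightarrow> 0 \<le> s \<Longrightarrow> s \<le> t \<Longrightarrow> t \<le> T \<Longrightarrow> norm (f t - f s) < e" by auto
  show "\<exists>d>0. \<forall>s\<in>{0..T}. dist s s0 < d \<longrightarrow> dist (f s) (f s0) < e"
  proof (intro exI[of _ d] conjI ballI impI)
    fix s assume s: "s \<in> {0..T}" "dist s s0 < d"
    show "dist (f s) (f s0) < e"
      using d(2)[of s s0] d(2)[of s0 s] s s0 d(1) by (cases "s \<le> s0") (auto simp: dist_norm
          norm_minus_commute)
  qed (use d in auto)
qed

lemma gnorm_nonneg: "v \<in> tspace A m \<Longrightarrow> 0 \<le> gnorm g m v"
proof -
  assume v: "v \<in> tspace A m"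
  obtain c where c: "c \<in> A" "m \<in> fst c" using chart_cover by blast
  obtain \<kappa> where \<kappa>: "\<kappa> > 0" "\<forall>\<^sub>F u in nhds (snd c m). u \<in> snd c ` fst c \<and>
    (\<forall>v\<in>tspace A (chart_inv c u). norm (v c) \<le> \<kappa> * gnorm g (chart_inv c u) v)"
    by (rule metric_lower_bound[OF metric c]) (rule that; assumption)
  have "norm (v c) \<le> \<kappa> * gnorm g m v" using eventually_nhds_x_imp_x[OF \<kappa>(2)] c v by simp
  then have "0 \<le> \<kappa> * gnorm g m v" using norm_ge_zero[of "v c"] by linarith
  then show ?thesis using \<kappa>(1) by (simp add: zero_le_mult_iff)
qed

lemma tVball_mono: "r \<le> r' \<Longrightarrow> tVball A g m r \<subseteq> tVball A g m r'"
  unfolding tVball_def using gnorm_nonneg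
  by (auto intro: order_trans[OF _ mult_right_mono[of r r']])

lemma WtVball_mono:
  assumes r: "r \<le> r'"
  shows "WtVball A g m r \<subseteq> (WtVball A g m r' :: (real^'k \<Rightarrow> ('m, 'e) tvec \<Rightarrow> 'b::real_normed_vector) set)"
proof
  fix L :: "real^'k \<Rightarrow> ('m, 'e) tvec \<Rightarrow> 'b"
  assume L: "L \<in> WtVball A g m r"
  have "norm (L w v) \<le> r' * norm w * gnorm g m v" if v: "v \<in> tspace A m" for w v
  proof -
    have "norm (L w v) \<le> r * norm w * gnorm g m v" using L v by (simp add: WtVball_def)
    also have "\<dots> \<le> r' * norm w * gnorm g m v" using r gnorm_nonneg[OF v] by (intro mult_right_mono) auto
    finally show ?thesis .
  qed
  then show "L \<in> WtVball A g m r'" by (simp add: WtVball_def)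
qed

context
  fixes \<alpha> :: "'m \<Rightarrow> ('m, 'e) tvec \<Rightarrow> 'v::banach"
  assumes form: "smooth_one_form A \<alpha>"
begin

definition cov_form :: "('m, 'e) chart \<Rightarrow> ('m \<Rightarrow> 'm \<Rightarrow> ('m, 'e) tvec \<Rightarrow> ('m, 'e) tvec) \<Rightarrow> 'e \<Rightarrow> 'e \<Rightarrow> 'e \<Rightarrow> 'v" where
  "cov_form c U u v w = form_deriv c \<alpha> u v w + chart_form c \<alpha> (par_deriv c U u v w) u"

lemma form_linear_between: "linear_between (tspace A m) UNIV (\<alpha> m)"
  using form by (simp add: smooth_one_form_def)

lemma form_velocity_linear: "s \<in> {0..T} \<Longrightarrow> linear (\<lambda>w. \<alpha> (y s) (y' s w))"
  using form_linear_between[of "y s"] y'_linear[of s] unfolding linear_between_def by (intro linearI) auto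

context
  fixes D \<psi> U
  assumes gauge: "geometric_gauge A D \<psi> U"
begin

lemma cov_form_linear:
  assumes c: "c \<in> A" and u: "u \<in> snd c ` fst c"
  shows "linear (cov_form c U u v)" "linear (\<lambda>v. cov_form c U u v w)"
  unfolding cov_form_def
  using linear_compose[OF par_deriv_linear2[OF gauge c u, of v] chart_form_linear[OF form c u]]
    linear_compose[OF par_deriv_linear1[OF gauge c u, of w] chart_form_linear[OF form c u]]
    form_deriv_linear1[OF form c u, of w] form_deriv_linear2[OF form c u, of v]
  by (auto simp: o_def intro!: linear_compose_add)

lemma cov_deriv_form_path:
  assumes c: "c \<in> A" and s: "s \<in> {0..T}" and ys: "y s \<in> fst c" and v: "v \<in> tspace A (y s)"
  shows "cov_deriv_form A U \<alpha> (y s) (y' s w) v = cov_form c U (eta c s) (vel c s w) (v c)"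
  using cov_deriv_form_coord[OF gauge c form ys y'_tspace[OF s] v] by (simp add: cov_form_def eta_def vel_def)

lemma form_along_linear:
  assumes s: "s \<in> {0..T}"
  shows "linear_between (tspace A (y s)) UNIV (cov_deriv_form A U \<alpha> (y s) (y' s w))"
    and "v \<in> tspace A (y s) \<Longrightarrow> linear (\<lambda>w. cov_deriv_form A U \<alpha> (y s) (y' s w) v)"
proof -
  obtain c where c: "c \<in> A" and ys: "y s \<in> fst c" using chart_cover by blast
  have u: "eta c s \<in> snd c ` fst c" using ys by (simp add: eta_def)
  note eq = cov_deriv_form_path[OF c s ys] and l = cov_form_linear[OF c u]
  show "linear_between (tspace A (y s)) UNIV (cov_deriv_form A U \<alpha> (y s) (y' s w))"
    unfolding linear_between_def
    using tspace_add tspace_scaleR by (auto simp: eq linear_add[OF l(1)] linear_cmul[OF l(1)]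
        scaleR_fun_def[where f = "_ :: ('m, 'e) tvec"])
  assume v: "v \<in> tspace A (y s)"
  show "linear (\<lambda>w. cov_deriv_form A U \<alpha> (y s) (y' s w) v)"
    using linear_compose[OF vel_linear[OF s, of c] l(2)] by (simp add: eq[OF v] o_def)
qed

context
  fixes c s0
  assumes c: "c \<in> A" and s0: "s0 \<in> {0..T}" and ys0: "y s0 \<in> fst c"
begin

text \<open>The difference splits into the Taylor remainder of the form, that of the parallelism
  under the form at the earlier time, the product of both first order variations, and the two errors
  of replacing the coordinate increment by the velocity applied to \<open>dx\<close>.\<close>

lemma form_transport_dominated:
  "dominated (pairs T s0) (\<lambda>z. chart_form c \<alpha> (chart_par c U b (eta c (snd z), eta c (fst z))) (eta c (snd z))
    - chart_form c \<alpha> b (eta c (fst z)) - cov_form c U (eta c (fst z)) (vel c (fst z) (dx z)) b) (\<lambda>z. rho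
        z ^ 2)"
proof -
  let ?P = "\<lambda>z. chart_par c U b (eta c (snd z), eta c (fst z))"
  let ?\<beta>s = "\<lambda>z e. chart_form c \<alpha> e (eta c (fst z))" and ?\<beta>t = "\<lambda>z e. chart_form c \<alpha> e (eta c (snd z))"
  let ?k = "\<lambda>z. incr c z - vel c (fst z) (dx z)"
  note pe = par_expansion[OF c s0 ys0 gauge, of b] and iv = incr_vel_dominated[OF c s0 ys0]
  note lb = eventually_chart_form_linear_path[OF form c s0 ys0]
  note cfd = chart_form_dominated(1)[OF form c s0 ys0]
  have ls: "\<forall>\<^sub>F z in pairs T s0. linear (\<lambda>e. ?\<beta>t z e - ?\<beta>s z e)" using lb by eventually_elim (rule
      linear_compose_sub)
  have 3: "dominated (pairs T s0) (\<lambda>z. ?\<beta>t z (?P z - b) - ?\<beta>s z (?P z - b)) (\<lambda>z. rho z ^ 2)"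
    by (rule dominated_eq[OF dominated_linear[where L = "\<lambda>z e. ?\<beta>t z e - ?\<beta>s z e", OF ls
        chart_form_bounded(3)[OF form c s0 ys0] pe(1)]])
      (simp add: power2_eq_square)
  have l4: "\<forall>\<^sub>F z in pairs T s0. linear (\<lambda>v. form_deriv c \<alpha> (eta c (fst z)) v b)"
    using eventually_in_chart[OF c s0 ys0] by eventually_elim (simp add: form_deriv_linear1[OF form c])
  have 4: "dominated (pairs T s0) (\<lambda>z. form_deriv c \<alpha> (eta c (fst z)) (?k z) b) (\<lambda>z. rho z ^ 2)"
    using dominated_linear[where L = "\<lambda>z v. form_deriv c \<alpha> (eta c (fst z)) v b", OF l4
        form_deriv_bounded(1)[OF form c s0 ys0] iv] by simp
  have l5: "\<forall>\<^sub>F z in pairs T s0. linear (\<lambda>v. par_deriv c U (eta c (fst z)) v b)"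
    using eventually_in_chart[OF c s0 ys0] by eventually_elim (simp add: par_deriv_linear1[OF gauge c])
  have 5: "dominated (pairs T s0) (\<lambda>z. par_deriv c U (eta c (fst z)) (?k z) b) (\<lambda>z. rho z ^ 2)"
    using dominated_linear[where L = "\<lambda>z v. par_deriv c U (eta c (fst z)) v b", OF l5
        par_deriv_dominated(1)[OF c s0 ys0 gauge] iv] by simp
  from dominated_add[OF chart_form_taylor[OF form c s0 ys0, of b] dominated_add[OF cfd[OF pe(2)]
      dominated_add[OF 3 dominated_add[OF 4 cfd[OF 5]]]]]
  show ?thesis
  proof (rule dominated_cong, use lb l4 l5 in eventually_elim)
    case (elim z)
    show ?case
      by (simp add: cov_form_def linear_diff[OF elim(1)] linear_diff[OF elim(2)] linear_diff[OF elim(3)]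
          linear_diff[OF elim(4)])
  qed
qed

lemma cov_form_transport_dominated:
  "dominated (pairs T s0) (\<lambda>z. cov_form c U (eta c (snd z)) (vel c (snd z) w) (chart_par c U b (eta c
      (snd z), eta c (fst z)))
    - cov_form c U (eta c (fst z)) (vel c (fst z) w) b) rho"
proof -
  let ?\<beta>s = "\<lambda>z e. chart_form c \<alpha> e (eta c (fst z))" and ?\<beta>t = "\<lambda>z e. chart_form c \<alpha> e (eta c (snd z))"
  note pd = par_deriv_dominated[OF c s0 ys0 gauge] and fb = form_deriv_bounded[OF form c s0 ys0]
  note lb = eventually_chart_form_linear_path[OF form c s0 ys0]
  have bd: "dominated (pairs T s0) (\<lambda>z. cov_form c U (eta c (fst z)) b b') (\<lambda>z. 1)" for b b'
    unfolding cov_form_def by (intro dominated_add fb(1) chart_form_dominated(1)[OF form c s0 ys0] pd(1))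
  have ls: "\<forall>\<^sub>F z in pairs T s0. linear (\<lambda>e. ?\<beta>t z e - ?\<beta>s z e)" using lb by eventually_elim (rule
      linear_compose_sub)
  have df: "dominated (pairs T s0) (\<lambda>z. cov_form c U (eta c (snd z)) b b' - cov_form c U (eta c (fst z))
      b b') rho" for b b'
  proof -
    let ?pt = "\<lambda>z. par_deriv c U (eta c (snd z)) b b'" and ?ps = "\<lambda>z. par_deriv c U (eta c (fst z)) b b'"
    have "dominated (pairs T s0) (\<lambda>z. ?\<beta>t z (?pt z) - ?\<beta>s z (?pt z)) rho"
      using dominated_linear[where L = "\<lambda>z e. ?\<beta>t z e - ?\<beta>s z e", OF ls chart_form_bounded(3)[OF form c
          s0 ys0] pd(2)] by simp
    from dominated_add[OF fb(3)[of b b'] dominated_add[OF this chart_form_dominated(1)[OF form c s0 ys0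
        pd(3)[of b b']]]]
    show ?thesis
    proof (rule dominated_cong, use lb(1) in eventually_elim)
      case (elim z)
      show ?case using linear_diff[OF elim, of "?pt z" "?ps z"] by (simp add: cov_form_def)
    qed
  qed
  have b1: "dominated (pairs T s0) (\<lambda>z. b) (\<lambda>z. 1)" by (rule dominated_tendsto[OF tendsto_const])
  have pb: "dominated (pairs T s0) (\<lambda>z. chart_par c U b (eta c (snd z), eta c (fst z))) (\<lambda>z. 1)"
    using dominated_add[OF dominated_trans[OF par_expansion(1)[OF c s0 ys0 gauge, of b] rho_dominated[OF
        s0]] b1] by simp
  show ?thesis
    by (rule bilinear_velocity_diff_dominated[where B = "cov_form c U", OF c s0 ys0 cov_form_linear[OF
        c] bd df
      vel_bounded[OF c s0 ys0] vel_diff_dominated[OF c s0 ys0] b1 pb par_expansion(1)[OF c s0 ys0 gauge]])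
qed

lemma eventually_transport_coord:
  "\<forall>\<^sub>F z in pairs T s0. fst z \<in> {0..T} \<and> snd z \<in> {0..T} \<and> y (fst z) \<in> fst c \<and> y (snd z) \<in> fst c \<and>
    eta c (fst z) \<in> snd c ` fst c \<and> eta c (snd z) \<in> snd c ` fst c \<and>
    linear (\<lambda>e. chart_par c U e (eta c (snd z), eta c (fst z))) \<and>
    (\<forall>v\<in>tspace A (y (fst z)). U (y (snd z)) (y (fst z)) v \<in> tspace A (y (snd z)) \<and>
      U (y (snd z)) (y (fst z)) v c = chart_par c U (v c) (eta c (snd z), eta c (fst z)))"
  using eventually_in_chart[OF c s0 ys0] eventually_diagonal_domain[OF s0 gauge_dom[OF gauge c]]
proof eventually_elim
  case (elim z)
  have "(eta c (snd z), eta c (fst z)) \<in> chart_dom c D" using elim c by (simp add: chart_dom_iff eta_def)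
  from chart_par_linear[OF gauge c this] elim show ?case
    by (auto simp: par_coord[OF gauge c] eta_def intro!: par_tspace[OF gauge c])
qed

lemma eventually_metric_bound:
  obtains \<kappa> where "\<kappa> > 0" "\<forall>\<^sub>F z in pairs T s0. \<forall>v\<in>tspace A (y (fst z)). norm (v c) \<le> \<kappa> * gnorm g (y
      (fst z)) v"
proof -
  obtain \<kappa> where \<kappa>: "\<kappa> > 0" "\<forall>\<^sub>F u in nhds (snd c (y s0)). u \<in> snd c ` fst c \<and>
    (\<forall>v\<in>tspace A (chart_inv c u). norm (v c) \<le> \<kappa> * gnorm g (chart_inv c u) v)"
    by (rule metric_lower_bound[OF metric c ys0]) (rule that; assumption)
  have "\<forall>\<^sub>F z in pairs T s0. \<forall>v\<in>tspace A (y (fst z)). norm (v c) \<le> \<kappa> * gnorm g (y (fst z)) v"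
    using eventually_compose_filterlim[OF \<kappa>(2) eta_tendsto(1)[OF c s0 ys0, unfolded eta_def]]
        eventually_in_chart[OF c s0 ys0]
    by eventually_elim (use c in simp)
  with \<kappa>(1) show ?thesis by (rule that)
qed

text \<open>The expression is a linear function of the coordinate vector of \<open>v\<close>, so
  bounds on basis vectors give an operator bound; the metric comparison then replaces the coordinate
  norm by \<open>gnorm\<close>.\<close>

lemma form_along_local1:
  "\<exists>C. \<forall>\<^sub>F z in pairs T s0. (\<lambda>v. \<alpha> (y (snd z)) (U (y (snd z)) (y (fst z)) v) - \<alpha> (y (fst z)) v
      - cov_deriv_form A U \<alpha> (y (fst z)) (y' (fst z) (x (snd z) - x (fst z))) v) \<in> tVball A g (y (fst
          z)) (C * rho z ^ 2)"
proof -
  define E where "E z e = chart_form c \<alpha> (chart_par c U e (eta c (snd z), eta c (fst z))) (eta c (snd z))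
    - chart_form c \<alpha> e (eta c (fst z)) - cov_form c U (eta c (fst z)) (vel c (fst z) (dx z)) e" for z e
  have lin: "\<forall>\<^sub>F z in pairs T s0. linear (E z)"
    using eventually_transport_coord
  proof eventually_elim
    case (elim z)
    then have l: "linear (\<lambda>e. chart_par c U e (eta c (snd z), eta c (fst z)))" by blast
    have "linear (\<lambda>e. chart_form c \<alpha> e (eta c (snd z)))" using elim by (intro chart_form_linear[OF form
        c]) auto
    from linear_compose[OF l this] show ?case unfolding E_def o_def
      using elim by (intro linear_compose_sub chart_form_linear[OF form c] cov_form_linear[OF c]) auto
  qed
  have dom: "dominated (pairs T s0) (\<lambda>z. E z b) (\<lambda>z. rho z ^ 2)" for b unfolding E_def by (rule
      form_transport_dominated)
  obtain C where C: "C \<ge> 0" "\<forall>\<^sub>F z in pairs T s0. \<forall>e. norm (E z e) \<le> C * \<bar>rho z ^ 2\<bar> * norm e"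
    by (rule dominated_linear_uniform[OF lin dom])
  obtain \<kappa> where \<kappa>: "\<kappa> > 0" "\<forall>\<^sub>F z in pairs T s0. \<forall>v\<in>tspace A (y (fst z)). norm (v c) \<le> \<kappa> * gnorm g (y
      (fst z)) v"
    by (rule eventually_metric_bound)
  show ?thesis
  proof (intro exI[of _ "C * \<kappa>"], use C(2) \<kappa>(2) eventually_transport_coord in eventually_elim)
    case (elim z)
    show ?case unfolding tVball_def
    proof (intro CollectI ballI)
      fix v assume v: "v \<in> tspace A (y (fst z))"
      have "\<alpha> (y (snd z)) (U (y (snd z)) (y (fst z)) v) - \<alpha> (y (fst z)) v
        - cov_deriv_form A U \<alpha> (y (fst z)) (y' (fst z) (x (snd z) - x (fst z))) v = E z (v c)"
        using elim(3) v cov_deriv_form_path[OF c _ _ v] form_coord[OF form c _ v]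
        by (auto simp: E_def dx_def eta_def form_coord[OF form c])
      moreover have "norm (E z (v c)) \<le> C * rho z ^ 2 * (\<kappa> * gnorm g (y (fst z)) v)"
        using elim(1)[rule_format, of "v c"] mult_left_mono[OF elim(2)[rule_format, OF v], of "C * rho z
            ^ 2"] C(1) by simp
      ultimately show "norm (\<alpha> (y (snd z)) (U (y (snd z)) (y (fst z)) v) - \<alpha> (y (fst z)) v
        - cov_deriv_form A U \<alpha> (y (fst z)) (y' (fst z) (x (snd z) - x (fst z))) v) \<le> C * \<kappa> * rho z ^ 2 *
            gnorm g (y (fst z)) v"
        by (simp add: mult_ac)
    qed
  qed
qed

lemma form_along_local2:
  "\<exists>C. \<forall>\<^sub>F z in pairs T s0. (\<lambda>w v. cov_deriv_form A U \<alpha> (y (snd z)) (y' (snd z) w) (U (y (snd z)) (y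
      (fst z)) v)
      - cov_deriv_form A U \<alpha> (y (fst z)) (y' (fst z) w) v) \<in> WtVball A g (y (fst z)) (C * rho z ^ 1)"
proof -
  define E where "E z w e = cov_form c U (eta c (snd z)) (vel c (snd z) w) (chart_par c U e (eta c (snd
      z), eta c (fst z)))
    - cov_form c U (eta c (fst z)) (vel c (fst z) w) e" for z w e
  have l1: "\<forall>\<^sub>F z in pairs T s0. \<forall>e. linear (\<lambda>w. E z w e)"
    using eventually_transport_coord
  proof eventually_elim
    case (elim z)
    have "linear (\<lambda>w. cov_form c U (eta c t) (vel c t w) e)" if "t \<in> {0..T}" "eta c t \<in> snd c ` fst c" for t e
      using linear_compose[OF vel_linear[OF that(1), of c] cov_form_linear(2)[OF c that(2)]] by (simp
          add: o_def)
    then show ?case unfolding E_def using elim by (intro allI linear_compose_sub) auto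
  qed
  have l2: "\<forall>\<^sub>F z in pairs T s0. \<forall>w. linear (E z w)"
    using eventually_transport_coord
  proof eventually_elim
    case (elim z)
    then have l: "linear (\<lambda>e. chart_par c U e (eta c (snd z), eta c (fst z)))" by blast
    have "linear (cov_form c U (eta c (snd z)) v)" for v using elim by (intro cov_form_linear[OF c]) auto
    from linear_compose[OF l this] show ?case unfolding E_def o_def
      using elim by (intro allI linear_compose_sub cov_form_linear[OF c]) auto
  qed
  have dom: "dominated (pairs T s0) (\<lambda>z. E z w b) rho" for w b unfolding E_def by (rule
      cov_form_transport_dominated)
  obtain C where C: "C \<ge> 0" "\<forall>\<^sub>F z in pairs T s0. \<forall>w e. norm (E z w e) \<le> C * \<bar>rho z\<bar> * norm w * norm e"
    by (rule dominated_bilinear_uniform[OF l1 l2 dom])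
  obtain \<kappa> where \<kappa>: "\<kappa> > 0" "\<forall>\<^sub>F z in pairs T s0. \<forall>v\<in>tspace A (y (fst z)). norm (v c) \<le> \<kappa> * gnorm g (y
      (fst z)) v"
    by (rule eventually_metric_bound)
  show ?thesis
  proof (intro exI[of _ "C * \<kappa>"], use C(2) \<kappa>(2) eventually_transport_coord in eventually_elim)
    case (elim z)
    show ?case unfolding WtVball_def
    proof (intro CollectI ballI allI)
      fix w v assume v: "v \<in> tspace A (y (fst z))"
      have "cov_deriv_form A U \<alpha> (y (snd z)) (y' (snd z) w) (U (y (snd z)) (y (fst z)) v)
        - cov_deriv_form A U \<alpha> (y (fst z)) (y' (fst z) w) v = E z w (v c)"
        using elim(3) v cov_deriv_form_path[OF c _ _ v] by (auto simp: E_def cov_deriv_form_path[OF c])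
      moreover have "norm (E z w (v c)) \<le> C * rho z * norm w * (\<kappa> * gnorm g (y (fst z)) v)"
        using elim(1)[rule_format, of w "v c"] mult_left_mono[OF elim(2)[rule_format, OF v], of "C * rho
            z * norm w"] C(1)
        by (simp add: rho_nonneg)
      ultimately show "norm (cov_deriv_form A U \<alpha> (y (snd z)) (y' (snd z) w) (U (y (snd z)) (y (fst z)) v)
        - cov_deriv_form A U \<alpha> (y (fst z)) (y' (fst z) w) v) \<le> C * \<kappa> * rho z ^ 1 * norm w * gnorm g (y
            (fst z)) v"
        by (simp add: mult_ac)
    qed
  qed
qed

end

lemma eventually_dom_swap: "s0 \<in> {0..T} \<Longrightarrow> \<forall>\<^sub>F z in pairs T s0. (y (fst z), y (snd z)) \<in> D \<and> (y (snd z),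
    y (fst z)) \<in> D"
  using eventually_diagonal_domain gauge by (auto simp: geometric_gauge_def)

lemma form_along_CRP: "form_along A U (y, y') \<alpha> \<in> form_CRP A g p T \<omega> x y D U"
  unfolding form_along_def form_CRP_def split_conv
proof (intro CollectI case_prodI conjI ballI allI)
  show "approx p T \<omega> 2 (\<lambda>s t. (y t, y s) \<in> D) (\<lambda>s. tVball A g (y s))
    (\<lambda>s t v. \<alpha> (y t) (U (y t) (y s) v) - \<alpha> (y s) v - cov_deriv_form A U \<alpha> (y s) (y' s (x t - x s)) v)
        (\<lambda>s t. 0)"
  proof (rule approxI)
    fix s0 assume s0: "s0 \<in> {0..T}"
    obtain c where c: "c \<in> A" "y s0 \<in> fst c" using chart_cover by blast
    obtain C where C: "\<forall>\<^sub>F z in pairs T s0. (\<lambda>v. \<alpha> (y (snd z)) (U (y (snd z)) (y (fst z)) v) - \<alpha> (y (fst z)) v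
      - cov_deriv_form A U \<alpha> (y (fst z)) (y' (fst z) (x (snd z) - x (fst z))) v) \<in> tVball A g (y (fst
          z)) (C * rho z ^ 2)"
      using form_along_local1[OF c(1) s0 c(2)] by blast
    show "\<exists>C. \<forall>\<^sub>F z in pairs T s0. (y (snd z), y (fst z)) \<in> D \<and> (\<lambda>v. \<alpha> (y (snd z)) (U (y (snd z)) (y
        (fst z)) v) - \<alpha> (y (fst z)) v
      - cov_deriv_form A U \<alpha> (y (fst z)) (y' (fst z) (x (snd z) - x (fst z))) v) - 0 \<in> tVball A g (y
          (fst z)) (C * rho z ^ 2)"
      by (rule exI[of _ C], use C eventually_dom_swap[OF s0] in eventually_elim) (simp only: diff_zero
          simp_thms)
  qed (use tVball_mono in auto)
  show "approx p T \<omega> 1 (\<lambda>s t. (y t, y s) \<in> D) (\<lambda>s. WtVball A g (y s))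
    (\<lambda>s t w v. cov_deriv_form A U \<alpha> (y t) (y' t w) (U (y t) (y s) v) - cov_deriv_form A U \<alpha> (y s) (y' s
        w) v) (\<lambda>s t. 0)"
  proof (rule approxI)
    fix s0 assume s0: "s0 \<in> {0..T}"
    obtain c where c: "c \<in> A" "y s0 \<in> fst c" using chart_cover by blast
    obtain C where C: "\<forall>\<^sub>F z in pairs T s0. (\<lambda>w v. cov_deriv_form A U \<alpha> (y (snd z)) (y' (snd z) w) (U (y
        (snd z)) (y (fst z)) v)
      - cov_deriv_form A U \<alpha> (y (fst z)) (y' (fst z) w) v) \<in> WtVball A g (y (fst z)) (C * rho z ^ 1)"
      using form_along_local2[OF c(1) s0 c(2)] by blast
    show "\<exists>C. \<forall>\<^sub>F z in pairs T s0. (y (snd z), y (fst z)) \<in> D \<and> (\<lambda>w v. cov_deriv_form A U \<alpha> (y (snd z))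
        (y' (snd z) w) (U (y (snd z)) (y (fst z)) v)
      - cov_deriv_form A U \<alpha> (y (fst z)) (y' (fst z) w) v) - 0 \<in> WtVball A g (y (fst z)) (C * rho z ^ 1)"
      by (rule exI[of _ C], use C eventually_dom_swap[OF s0] in eventually_elim) (simp only: diff_zero
          simp_thms)
  qed (use WtVball_mono in auto)
qed (use form_linear_between form_along_linear in auto)

lemma is_rough_integral_iff:
  "is_rough_integral A p T \<omega> x X D \<psi> U (form_along A U (y, y') \<alpha>) (y, y') (z, z') \<longleftrightarrow>
    (z, z') \<in> CRP p T \<omega> x \<and> z 0 = 0 \<and> (\<forall>s\<in>{0..T}. \<forall>w. blinfun_apply (z' s) w = \<alpha> (y s) (y' s w)) \<and>
    approx p T \<omega> 3 (\<lambda>s t. (y s, y t) \<in> D) (\<lambda>s. cball 0) (\<lambda>s t. z t - z s) (germ \<psi> U \<alpha>)"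
  by (simp add: is_rough_integral_def form_along_def germ_def[abs_def])

text \<open>The germ of the gauge is sewn directly, so the third order estimate comes with it.
  Membership in \<open>CRP\<close> follows from the first order expansion of the germ and the
  variation of \<open>\<alpha>\<close> along the velocity, known on short intervals and then
  extended.\<close>

lemma rough_integral_exists:
  "\<exists>Z. is_rough_integral A p T \<omega> x X D \<psi> U (form_along A U (y, y') \<alpha>) (y, y') Z"
proof -
  obtain C \<delta> where C: "C \<ge> 0" "\<delta> > 0" "\<And>s r t. 0 \<le> s \<Longrightarrow> s \<le> r \<Longrightarrow> r \<le> t \<Longrightarrow> t \<le> T \<Longrightarrow> t - s \<le> \<delta> \<Longrightarrow>
      norm (germ \<psi> U \<alpha> s t - germ \<psi> U \<alpha> s r - germ \<psi> U \<alpha> r t) \<le> C * rho (s, t) ^ 3"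
  proof (rule dominated_uniform_triples[where F = "\<lambda>s r t. germ \<psi> U \<alpha> s t - germ \<psi> U \<alpha> s r - germ \<psi> U \<alpha>
      r t" and i = 3])
    fix s0 assume s0: "s0 \<in> {0..T}"
    obtain c where c: "c \<in> A" "y s0 \<in> fst c" using chart_cover by blast
    show "dominated (triples T s0) (\<lambda>z. germ \<psi> U \<alpha> (fst z) (snd (snd z)) - germ \<psi> U \<alpha> (fst z) (fst (snd
        z)) - germ \<psi> U \<alpha> (fst (snd z)) (snd (snd z)))
      (\<lambda>z. rho (fst z, snd (snd z)) ^ 3)"
      by (rule germ_defect_dominated[OF form c(1) s0 c(2) gauge])
  qed (rule that; assumption)
  interpret S: almost_additive T "3 / p" C \<delta> \<omega> "germ \<psi> U \<alpha>"
    using ctrl T p C by unfold_locales (auto simp: rho_power)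
  \<comment> \<open>\<open>restrict\<close> supplies the conventional value off
    \<open>[0, T]\<close> that \<open>CRP\<close> demands.\<close>
  define z where "z = restrict (S.sewn 0) {0..T}"
  define z' where "z' = restrict (\<lambda>s. Blinfun (\<lambda>w. \<alpha> (y s) (y' s w))) {0..T}"
  \<comment> \<open>A linear map on the finite-dimensional space \<open>W\<close> is bounded, so
    \<open>Blinfun\<close> represents it faithfully.\<close>
  have z'_apply: "blinfun_apply (z' s) w = \<alpha> (y s) (y' s w)" if "s \<in> {0..T}" for s w
    using that form_velocity_linear[OF that] by (simp add: z'_def bounded_linear_Blinfun_apply
        linear_conv_bounded_linear)
  have z0: "z 0 = 0" using S.sewn_add[of 0 0 0] T by (simp add: z_def)
  have zinc: "z t - z s = S.sewn s t" if "0 \<le> s" "s \<le> t" "t \<le> T" for s t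
    using S.sewn_add[of 0 s t] that by (simp add: z_def)
  have zg: "dominated (pairs T s0) (\<lambda>u. z (snd u) - z (fst u) - germ \<psi> U \<alpha> (fst u) (snd u)) (\<lambda>u. rho u ^
      3)" for s0
  proof (rule dominatedI[where C = S.K], use eventually_mesh[OF C(2)] eventually_pairs_order in
      eventually_elim)
    case (elim u)
    then show ?case using S.sewn_bound[of "fst u" "snd u"] by (simp add: zinc rho_power)
  qed
  have z1: "dominated (pairs T s0) (\<lambda>u. z (snd u) - z (fst u) - blinfun_apply (z' (fst u)) (x (snd u) -
      x (fst u))) (\<lambda>u. rho u ^ 2)"
    and z2: "dominated (pairs T s0) (\<lambda>u. z' (snd u) - z' (fst u)) rho"
    and z3: "dominated (pairs T s0) (\<lambda>u. z (snd u) - z (fst u)) rho" if s0: "s0 \<in> {0..T}" for s0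
  proof -
    obtain c where c: "c \<in> A" "y s0 \<in> fst c" using chart_cover by blast
    note ev = eventually_in_chart[OF c(1) s0 c(2)]
    have r23: "dominated (pairs T s0) (\<lambda>z. rho z ^ 3) (\<lambda>z. rho z ^ 2)" by (rule rho_power_dominated[OF
        s0]) simp
    from dominated_add[OF dominated_trans[OF zg r23] germ_first_order[OF form c(1) s0 c(2) gauge]]
    show z1: "dominated (pairs T s0) (\<lambda>u. z (snd u) - z (fst u) - blinfun_apply (z' (fst u)) (x (snd u)
        - x (fst u))) (\<lambda>u. rho u ^ 2)"
    proof (rule dominated_cong, use ev in eventually_elim)
      case (elim u)
      then show ?case by (simp add: z'_apply)
    qed
    have coord: "\<alpha> (y s) (y' s w) = chart_form c \<alpha> (vel c s w) (eta c s)" if "s \<in> {0..T}" "y s \<in> fst c"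
        for s w
      using form_coord[OF form c(1) that(2) y'_tspace[OF that(1)]] by (simp add: vel_def eta_def)
    show "dominated (pairs T s0) (\<lambda>u. z' (snd u) - z' (fst u)) rho"
    proof (rule dominated_blinfun)
      fix b :: "real^'k"
      show "dominated (pairs T s0) (\<lambda>u. blinfun_apply (z' (snd u) - z' (fst u)) b) rho"
        by (rule dominated_cong[OF form_velocity_diff_dominated[OF form c(1) s0 c(2), of b]])
          (use ev in eventually_elim, simp add: blinfun.diff_left z'_apply coord)
    qed
    have "dominated (pairs T s0) (\<lambda>u. blinfun_apply (z' (fst u)) (x (snd u) - x (fst u))) rho"
      by (rule dominated_cong[OF chart_form_dominated(1)[OF form c(1) s0 c(2) vel_dx_dominated[OF c(1)
          s0 c(2)]]])
        (use ev in eventually_elim, simp add: z'_apply coord dx_def)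
    from dominated_add[OF dominated_trans[OF z1] this] rho_power_dominated[OF s0, of 1 2]
    show "dominated (pairs T s0) (\<lambda>u. z (snd u) - z (fst u)) rho" by simp
  qed
  obtain C1 \<delta>1 where 1: "C1 \<ge> 0" "\<delta>1 > 0" "\<And>s t. 0 \<le> s \<Longrightarrow> s \<le> t \<Longrightarrow> t \<le> T \<Longrightarrow> t - s \<le> \<delta>1 \<Longrightarrow>
      norm (z t - z s - blinfun_apply (z' s) (x t - x s)) \<le> C1 * rho (s, t) ^ 2"
  proof (rule dominated_uniform[where F = "\<lambda>s t. z t - z s - blinfun_apply (z' s) (x t - x s)" and i = 2])
    fix s0 assume "s0 \<in> {0..T}"
    then show "dominated (pairs T s0) (\<lambda>u. z (snd u) - z (fst u) - blinfun_apply (z' (fst u)) (x (snd u)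
        - x (fst u))) (\<lambda>u. rho u ^ 2)"
      by (rule z1)
  qed (rule that; assumption)
  obtain C2 \<delta>2 where 2: "C2 \<ge> 0" "\<delta>2 > 0" "\<And>s t. 0 \<le> s \<Longrightarrow> s \<le> t \<Longrightarrow> t \<le> T \<Longrightarrow> t - s \<le> \<delta>2 \<Longrightarrow>
      norm (z' t - z' s) \<le> C2 * rho (s, t) ^ 1"
  proof (rule dominated_uniform[where F = "\<lambda>s t. z' t - z' s" and i = 1])
    fix s0 assume "s0 \<in> {0..T}"
    then show "dominated (pairs T s0) (\<lambda>u. z' (snd u) - z' (fst u)) (\<lambda>u. rho u ^ 1)"
      using z2 by simp
  qed (rule that; assumption)
  have global: "\<exists>C. \<forall>s t. 0 \<le> s \<and> s \<le> t \<and> t \<le> T \<longrightarrow>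
    norm (z t - z s - blinfun_apply (z' s) (x t - x s)) \<le> C * \<omega> s t powr (2 / p) \<and>
    norm (z' t - z' s) \<le> C * \<omega> s t powr (1 / p)"
  proof (rule controlled_local_to_global[OF ctrl, of p "min \<delta>1 \<delta>2" "max C1 C2"])
    fix s t assume st: "0 \<le> s" "s \<le> t" "t \<le> T"
    show "norm (x t - x s) \<le> \<omega> s t powr (1 / p)" by (rule rough_bounds(1)[OF st])
    assume small: "t - s \<le> min \<delta>1 \<delta>2"
    have "norm (z t - z s - blinfun_apply (z' s) (x t - x s)) \<le> C1 * \<omega> s t powr (2 / p)" using 1(3)[OF
        st] small by (simp add: rho_power)
    also have "\<dots> \<le> max C1 C2 * \<omega> s t powr (2 / p)" by (intro mult_right_mono) auto
    finally show "norm (z t - z s - blinfun_apply (z' s) (x t - x s)) \<le> max C1 C2 * \<omega> s t powr (2 / p)" .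
    have "norm (z' t - z' s) \<le> C2 * \<omega> s t powr (1 / p)" using 2(3)[OF st] small by (simp add: rho_def)
    also have "\<dots> \<le> max C1 C2 * \<omega> s t powr (1 / p)" by (intro mult_right_mono) auto
    finally show "norm (z' t - z' s) \<le> max C1 C2 * \<omega> s t powr (1 / p)" .
  qed (use 1 2 p in auto)
  have crp: "(z, z') \<in> CRP p T \<omega> x"
    unfolding CRP_def using global continuous_of_increments[OF z3] continuous_of_increments[OF z2]
    by (auto simp: z_def z'_def)
  have "approx p T \<omega> 3 (\<lambda>s t. (y s, y t) \<in> D) (\<lambda>s. cball 0) (\<lambda>s t. z t - z s) (germ \<psi> U \<alpha>)"
  proof (rule approxI)
    fix s0 assume s0: "s0 \<in> {0..T}"
    obtain K where K: "\<forall>\<^sub>F u in pairs T s0. norm (z (snd u) - z (fst u) - germ \<psi> U \<alpha> (fst u) (snd u)) \<le>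
        K * \<bar>rho u ^ 3\<bar>"
      using zg unfolding dominated_def by blast
    show "\<exists>C. \<forall>\<^sub>F u in pairs T s0. (y (fst u), y (snd u)) \<in> D \<and> z (snd u) - z (fst u) - germ \<psi> U \<alpha> (fst
        u) (snd u) \<in> cball 0 (C * rho u ^ 3)"
      by (rule exI[of _ K], use K eventually_dom_swap[OF s0] in eventually_elim) (simp add: rho_nonneg)
  qed auto
  then show ?thesis using crp z0 z'_apply is_rough_integral_iff[of z z'] by blast
qed

text \<open>Both paths approximate the same germ, so the increments of their difference are of order
  \<open>3 / p > 1\<close> in the control and the difference is constant. The derivatives are
  prescribed, and extensionality settles the values off \<open>[0, T]\<close>.\<close>

lemma rough_integral_unique:
  assumes "is_rough_integral A p T \<omega> x X D \<psi> U (form_along A U (y, y') \<alpha>) (y, y') Z1"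
    and "is_rough_integral A p T \<omega> x X D \<psi> U (form_along A U (y, y') \<alpha>) (y, y') Z2"
  shows "Z1 = Z2"
proof -
  obtain z1 z1' z2 z2' where Z: "Z1 = (z1, z1')" "Z2 = (z2, z2')" by (metis surj_pair)
  note 1 = assms(1)[unfolded Z is_rough_integral_iff] and 2 = assms(2)[unfolded Z is_rough_integral_iff]
  have ext: "z1 \<in> extensional {0..T}" "z1' \<in> extensional {0..T}" "z2 \<in> extensional {0..T}" "z2' \<in>
      extensional {0..T}"
    using 1 2 by (auto simp: CRP_def)
  have "approx p T \<omega> 3 (\<lambda>s t. (y s, y t) \<in> D) (\<lambda>s. cball 0) (\<lambda>s t. z1 t - z1 s) (germ \<psi> U \<alpha>)" using 1 by blast
  then obtain C1 \<delta>1 where a0: "\<delta>1 > 0" "\<forall>s t. 0 \<le> s \<and> s \<le> t \<and> t \<le> T \<and> t - s \<le> \<delta>1 \<longrightarrow>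
      (y s, y t) \<in> D \<and> z1 t - z1 s - germ \<psi> U \<alpha> s t \<in> cball 0 (C1 * \<omega> s t powr (real 3 / p))"
    unfolding approx_def by blast
  have a: "norm (z1 t - z1 s - germ \<psi> U \<alpha> s t) \<le> C1 * \<omega> s t powr (3 / p)" if "0 \<le> s" "s \<le> t" "t \<le> T" "t
      - s \<le> \<delta>1" for s t
    using a0(2)[rule_format, of s t] that by simp
  have "approx p T \<omega> 3 (\<lambda>s t. (y s, y t) \<in> D) (\<lambda>s. cball 0) (\<lambda>s t. z2 t - z2 s) (germ \<psi> U \<alpha>)" using 2 by blast
  then obtain C2 \<delta>2 where b0: "\<delta>2 > 0" "\<forall>s t. 0 \<le> s \<and> s \<le> t \<and> t \<le> T \<and> t - s \<le> \<delta>2 \<longrightarrow>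
      (y s, y t) \<in> D \<and> z2 t - z2 s - germ \<psi> U \<alpha> s t \<in> cball 0 (C2 * \<omega> s t powr (real 3 / p))"
    unfolding approx_def by blast
  have b: "norm (z2 t - z2 s - germ \<psi> U \<alpha> s t) \<le> C2 * \<omega> s t powr (3 / p)" if "0 \<le> s" "s \<le> t" "t \<le> T" "t
      - s \<le> \<delta>2" for s t
    using b0(2)[rule_format, of s t] that by simp
  have "z1 t = z2 t" if t: "t \<in> {0..T}" for t
  proof -
    have "(\<lambda>t. z1 t - z2 t) t = (\<lambda>t. z1 t - z2 t) 0"
    proof (rule control_increment_constant[OF ctrl, of "3 / p" "min \<delta>1 \<delta>2" _ "C1 + C2"])
      fix s t assume st: "0 \<le> s" "s \<le> t" "t \<le> T" "t - s \<le> min \<delta>1 \<delta>2"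
      have "norm ((z1 t - z2 t) - (z1 s - z2 s)) = norm ((z1 t - z1 s - germ \<psi> U \<alpha> s t) - (z2 t - z2 s -
          germ \<psi> U \<alpha> s t))"
        by (rule arg_cong[where f = norm]) simp
      also have "\<dots> \<le> C1 * \<omega> s t powr (3 / p) + C2 * \<omega> s t powr (3 / p)"
        using a[of s t] b[of s t] st by (intro order_trans[OF norm_triangle_ineq4 add_mono]) auto
      finally show "norm ((z1 t - z2 t) - (z1 s - z2 s)) \<le> (C1 + C2) * \<omega> s t powr (3 / p)" by (simp add:
          algebra_simps)
    qed (use a0 b0 p t in auto)
    then show ?thesis using 1 2 by simp
  qed
  moreover have "z1' s = z2' s" if "s \<in> {0..T}" for s using 1 2 that by (intro blinfun_eqI) auto
  ultimately show ?thesis unfolding Z using ext by (auto intro: extensionalityI)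
qed

end

text \<open>At each time both germs are compared with \<open>theta\<close> in the same chart, and
  \<open>theta\<close> drops out of the difference. The condition for the new domain holds near the
  diagonal by continuity of the path.\<close>

lemma approx_germ_change:
  assumes G: "geometric_gauge A D \<psi> U" and G': "geometric_gauge A D' \<psi>' U'"
    and "approx p T \<omega> 3 (\<lambda>s t. (y s, y t) \<in> D) (\<lambda>s. cball 0) F (germ \<psi> U \<alpha>)"
  shows "approx p T \<omega> 3 (\<lambda>s t. (y s, y t) \<in> D') (\<lambda>s. cball 0) F (germ \<psi>' U' \<alpha>)"
proof (rule approxI)
  fix s0 assume s0: "s0 \<in> {0..T}"
  obtain c where c: "c \<in> A" "y s0 \<in> fst c" using chart_cover by blast
  obtain C where "\<forall>\<^sub>F z in pairs T s0. (y (fst z), y (snd z)) \<in> D \<and> F (fst z) (snd z) - germ \<psi> U \<alpha> (fst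
      z) (snd z) \<in> cball 0 (C * rho z ^ 3)"
    by (rule approxD[OF c(1) s0 c(2) assms(3)]) auto
  then have "dominated (pairs T s0) (\<lambda>z. F (fst z) (snd z) - germ \<psi> U \<alpha> (fst z) (snd z)) (\<lambda>z. rho z ^ 3)"
    by (intro dominatedI[where C = C]) (auto elim!: eventually_mono simp: rho_nonneg)
  from dominated_add[OF this dominated_diff[OF germ_theta_dominated[OF form c(1) s0 c(2) G]
      germ_theta_dominated[OF form c(1) s0 c(2) G']]]
  have "dominated (pairs T s0) (\<lambda>z. F (fst z) (snd z) - germ \<psi>' U' \<alpha> (fst z) (snd z)) (\<lambda>z. rho z ^ 3)" by simp
  then obtain K where K: "\<forall>\<^sub>F z in pairs T s0. norm (F (fst z) (snd z) - germ \<psi>' U' \<alpha> (fst z) (snd z)) \<le>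
      K * \<bar>rho z ^ 3\<bar>"
    unfolding dominated_def by blast
  show "\<exists>C. \<forall>\<^sub>F z in pairs T s0. (y (fst z), y (snd z)) \<in> D' \<and> F (fst z) (snd z) - germ \<psi>' U' \<alpha> (fst z)
      (snd z) \<in> cball 0 (C * rho z ^ 3)"
    by (rule exI[of _ K], use K eventually_dom_swap[OF G' s0] in eventually_elim) (simp add: rho_nonneg)
qed auto

text \<open>The clauses on membership, initial value and derivative do not mention the gauge, so the
  change of germ is the whole content.\<close>

lemma is_rough_integral_gauge_invariant:
  assumes "geometric_gauge A D \<psi> U" "geometric_gauge A D' \<psi>' U'"
  shows "is_rough_integral A p T \<omega> x X D \<psi> U (form_along A U (y, y') \<alpha>) (y, y') Z \<longleftrightarrow>
    is_rough_integral A p T \<omega> x X D' \<psi>' U' (form_along A U' (y, y') \<alpha>) (y, y') Z"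
proof (cases Z)
  case (Pair z z')
  show ?thesis unfolding Pair is_rough_integral_iff[OF assms(1)] is_rough_integral_iff[OF assms(2)]
    using approx_germ_change[OF assms, of "\<lambda>s t. z t - z s"] approx_germ_change[OF assms(2,1), of "\<lambda>s t.
        z t - z s"] by blast
qed

end

end

theorem theorem4p3:
  fixes A :: "('m::{t2_space,second_countable_topology}, 'e::euclidean_space) chart set"
    and g :: "'m \<Rightarrow> ('m, 'e) tvec \<Rightarrow> ('m, 'e) tvec \<Rightarrow> real"
    and p T :: real and \<omega> :: "real \<Rightarrow> real \<Rightarrow> real"
    and x :: "real \<Rightarrow> real^'k" and X :: "real \<Rightarrow> real \<Rightarrow> real^'k^'k"
    and y :: "real \<Rightarrow> 'm" and y' :: "real \<Rightarrow> real^'k \<Rightarrow> ('m, 'e) tvec"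
    and \<alpha> :: "'m \<Rightarrow> ('m, 'e) tvec \<Rightarrow> 'v::banach"
  assumes "smooth_atlas A" and "riemannian_metric A g"
    and "0 < T" and "1 \<le> p" and "p < 3"
    and "weak_geometric_rough_path p T \<omega> x X"
    and "(y, y') \<in> manifold_CRP A g p T \<omega> x"
    and "smooth_one_form A \<alpha>"
    and "geometric_gauge A D \<psi> U" and "geometric_gauge A D' \<psi>' U'"
  shows "form_along A U (y, y') \<alpha> \<in> form_CRP A g p T \<omega> x y D U \<and>
    (\<exists>!Z. is_rough_integral A p T \<omega> x X D \<psi> U (form_along A U (y, y') \<alpha>) (y, y') Z) \<and>
    rough_integral A p T \<omega> x X D \<psi> U (form_along A U (y, y') \<alpha>) (y, y') =
    rough_integral A p T \<omega> x X D' \<psi>' U' (form_along A U' (y, y') \<alpha>) (y, y')"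
proof -
  interpret controlled_manifold_path A g p T \<omega> x X y y'
    using assms by unfold_locales
  note form = \<open>smooth_one_form A \<alpha>\<close> and gauges = \<open>geometric_gauge A D \<psi> U\<close> \<open>geometric_gauge A D' \<psi>' U'\<close>
  show ?thesis
    \<comment> \<open>The rewriting turns both integrals into the same definite description;
      existence and uniqueness are rewritten in the same way on both sides of the argument.\<close>
    unfolding rough_integral_def is_rough_integral_gauge_invariant[OF form gauges]
    using form_along_CRP[OF form gauges(1)] rough_integral_exists[OF form gauges(1)]
        rough_integral_unique[OF form gauges(1)]
    unfolding is_rough_integral_gauge_invariant[OF form gauges] by blast
qed

end
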